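(* Let $\Delta\subseteq\mathbb{R}^n$ be an $n$-dimensional simple regular lattice polytope with $d$ facets, written as $\Delta=\{x:\langle u_i,x\rangle\le c_i,\ i=1,\ldots,d\}$ with $c_i\in\mathbb{Z}$ and $u_i\in(\mathbb{Z}^n)^*$ the primitive outward normal of the $i$-th facet. For $h\in\mathbb{R}^d$ let $\Delta_h=\{x:\langle u_i,x\rangle\le c_i+h_i,\ i=1,\ldots,d\}$. Then for every $f\in C^\infty_0(\mathbb{R}^n)$, $$\frac1{N^n}\sum_{k\in\mathbb{Z}^n\cap N\Delta}f\!\left(\frac kN\right)\ \sim\ \left(\tau\!\left(\frac1N\frac{\partial}{\partial h}\right)\int_{\Delta_h}f(x)\,dx\right)(h=0),$$ where $\tau(s_1,\ldots,s_d)=\tau(s_1)\cdots\tau(s_d)$.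
   Context: A lattice polytope has all vertices in $\mathbb{Z}^n$. It is simple if each codimension-$k$ face is the intersection of exactly $k$ facets; then each face corresponds to a subset $F\subseteq\{1,\ldots,d\}$ with $|F|$ equal to its codimension, the face being $\{x\in\Delta:\langle u_i,x\rangle=c_i,\ i\in F\}$. It is regular if for each such face $F$, the vectors $\{u_i\}_{i\in F}$ form a $\mathbb{Z}$-basis of $U_F\cap(\mathbb{Z}^n)^*$, where $U_F$ is their real span (equivalently, at each vertex the edge directions form a lattice basis of $\mathbb{Z}^n$). $\tau(s)=\frac{s}{1-e^{-s}}$ is the Todd function. Meaning of $\sim$: with Taylor series $\tau(s_1,\ldots,s_d)=\sum_\alpha t_\alpha s^\alpha$ and $F(h)=\int_{\Delta_h}f\,dx$ (smooth in $h$ near $0$), the left side minus $\sum_{|\alpha|<M}t_\alpha N^{-|\alpha|}(\partial_h^\alpha F)(0)$ is $O(N^{-M})$ as $N\to\infty$ for every $M$. *)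

theory Defs
  imports "HOL-Analysis.Analysis" "HOL-Library.Landau_Symbols"
begin

section \<open>Lattice polytopes\<close>

text \<open>
  The dual lattice \<open>(\<int>\<^sup>n)\<^sup>*\<close> is identified with \<open>\<int>\<^sup>n\<close> through the standard inner product.
\<close>

definition int_lattice :: "(real^'n) set" where
  "int_lattice = {x. \<forall>j. x $ j \<in> \<int>}"

definition lattice_polytope :: "(real^'n) set \<Rightarrow> bool" where
  "lattice_polytope P \<longleftrightarrow> polytope P \<and> {v. v extreme_point_of P} \<subseteq> int_lattice"

text \<open>
  The empty set is a face in the sense of \<^const>\<open>face_of\<close> and has to be excluded.
  The intersection with \<open>P\<close> accounts for the face \<open>P\<close> itself, which lies in no facet.
\<close>

definition simple_polytope :: "(real^'n) set \<Rightarrow> bool" where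
  "simple_polytope P \<longleftrightarrow> polytope P \<and>
     (\<forall>G. G face_of P \<and> G \<noteq> {} \<longrightarrow>
        int (card {H. H facet_of P \<and> G \<subseteq> H}) = aff_dim P - aff_dim G \<and>
        G = P \<inter> \<Inter>{H. H facet_of P \<and> G \<subseteq> H})"

definition primitive_vector :: "real^'n \<Rightarrow> bool" where
  "primitive_vector v \<longleftrightarrow> v \<in> int_lattice \<and> v \<noteq> 0 \<and>
     (\<forall>w\<in>int_lattice. \<forall>m::int. v = of_int m *\<^sub>R w \<longrightarrow> \<bar>m\<bar> = 1)"

definition shifted_polyhedron ::
  "('d::finite \<Rightarrow> real^'n) \<Rightarrow> ('d \<Rightarrow> int) \<Rightarrow> real^'d \<Rightarrow> (real^'n) set" where
  "shifted_polyhedron u c h = {x. \<forall>i. u i \<bullet> x \<le> of_int (c i) + h $ i}"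

definition face_at ::
  "('d::finite \<Rightarrow> real^'n) \<Rightarrow> ('d \<Rightarrow> int) \<Rightarrow> 'd set \<Rightarrow> (real^'n) set" where
  "face_at u c I = {x \<in> shifted_polyhedron u c 0. \<forall>i\<in>I. u i \<bullet> x = of_int (c i)}"

text \<open>
  The indices enumerate the facets without repetition; since \<open>P\<close> lies on the side
  \<open>u i \<bullet> x \<le> c i\<close>, the vector \<open>u i\<close> is the outward normal of the \<open>i\<close>-th facet.
\<close>

definition primitive_facet_presentation ::
  "(real^'n) set \<Rightarrow> ('d::finite \<Rightarrow> real^'n) \<Rightarrow> ('d \<Rightarrow> int) \<Rightarrow> bool" where
  "primitive_facet_presentation P u c \<longleftrightarrow>
     P = shifted_polyhedron u c 0 \<and>
     (\<forall>i. primitive_vector (u i)) \<and>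
     bij_betw (\<lambda>i. face_at u c {i}) UNIV {H. H facet_of P}"

definition int_basis_on :: "'d::finite set \<Rightarrow> ('d \<Rightarrow> real^'n) \<Rightarrow> (real^'n) set \<Rightarrow> bool" where
  "int_basis_on I b L \<longleftrightarrow> (\<forall>i\<in>I. b i \<in> L) \<and>
     (\<forall>v\<in>L. \<exists>!a :: 'd \<Rightarrow> int. (\<forall>i. i \<notin> I \<longrightarrow> a i = 0) \<and> v = (\<Sum>i\<in>I. of_int (a i) *\<^sub>R b i))"

text \<open>
  The faces of a simple polytope are the nonempty sets \<^term>\<open>face_at u c I\<close> where \<open>card I\<close> is
  the codimension.
\<close>

definition regular_presentation ::
  "('d::finite \<Rightarrow> real^'n) \<Rightarrow> ('d \<Rightarrow> int) \<Rightarrow> bool" where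
  "regular_presentation u c \<longleftrightarrow>
     (\<forall>I. face_at u c I \<noteq> {} \<and>
          int (card I) = aff_dim (shifted_polyhedron u c 0) - aff_dim (face_at u c I) \<longrightarrow>
          int_basis_on I u (span (u ` I) \<inter> int_lattice))"

section \<open>Smooth functions and iterated partial derivatives\<close>

definition partial_diff :: "'k::finite \<Rightarrow> (real^'k \<Rightarrow> real) \<Rightarrow> real^'k \<Rightarrow> real" where
  "partial_diff i g x = deriv (\<lambda>t. g (x + t *\<^sub>R axis i 1)) 0"

text \<open>\<open>C_diff m U g\<close>: the function \<open>g\<close> is of class \<open>C\<^sup>m\<close> on the open set \<open>U\<close>.\<close>

primrec C_diff :: "nat \<Rightarrow> (real^'k::finite) set \<Rightarrow> (real^'k \<Rightarrow> real) \<Rightarrow> bool" where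
  "C_diff 0 U g \<longleftrightarrow> continuous_on U g"
| "C_diff (Suc m) U g \<longleftrightarrow> g differentiable_on U \<and> (\<forall>i. C_diff m U (partial_diff i g))"

definition smooth_on :: "(real^'k::finite) set \<Rightarrow> (real^'k \<Rightarrow> real) \<Rightarrow> bool" where
  "smooth_on U g \<longleftrightarrow> open U \<and> (\<forall>m. C_diff m U g)"

definition test_function :: "(real^'k::finite \<Rightarrow> real) \<Rightarrow> bool" where
  "test_function f \<longleftrightarrow> smooth_on UNIV f \<and> compact (closure (support_on UNIV f))"

text \<open>
  The order on the index type only fixes the order in which the partial derivatives are taken:
  with indices \<open>i1 < \<dots> < id\<close> this is \<open>(\<partial>\<^bsub>i1\<^esub>)\<^bsup>\<alpha> i1\<^esup> \<dots> (\<partial>\<^bsub>id\<^esub>)\<^bsup>\<alpha> id\<^esup> g\<close>.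
\<close>

definition multi_diff ::
  "('k \<Rightarrow> nat) \<Rightarrow> (real^'k::{finite,linorder} \<Rightarrow> real) \<Rightarrow>
    real^'k::{finite,linorder} \<Rightarrow> real" where
  "multi_diff \<alpha> g = foldr (\<lambda>i. partial_diff i ^^ \<alpha> i) (sorted_list_of_set UNIV) g"

definition multi_order :: "('k::finite \<Rightarrow> nat) \<Rightarrow> nat" where
  "multi_order \<alpha> = (\<Sum>i\<in>UNIV. \<alpha> i)"

lemma finite_multi_order_less: "finite {\<alpha> :: 'k::finite \<Rightarrow> nat. multi_order \<alpha> < M}"
proof -
  have "\<alpha> i \<le> multi_order \<alpha>" for \<alpha> :: "'k \<Rightarrow> nat" and i
    unfolding multi_order_def by (rule member_le_sum) auto
  then have "{\<alpha> :: 'k \<Rightarrow> nat. multi_order \<alpha> < M} \<subseteq> PiE UNIV (\<lambda>_. {..<M})"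
    by (auto simp: PiE_def intro: le_less_trans)
  then show ?thesis
    by (rule finite_subset) (auto intro: finite_PiE)
qed

section \<open>The Todd function and the asymptotic relation\<close>

text \<open>The singularity of \<open>s / (1 - exp (- s))\<close> at \<open>0\<close> is removable.\<close>

definition todd :: "real \<Rightarrow> real" where
  "todd s = (if s = 0 then 1 else s / (1 - exp (- s)))"

definition multi_todd :: "real^'d::finite \<Rightarrow> real" where
  "multi_todd s = (\<Prod>i\<in>UNIV. todd (s $ i))"

definition todd_coeff :: "('d::{finite,linorder} \<Rightarrow> nat) \<Rightarrow> real" where
  "todd_coeff \<alpha> = multi_diff \<alpha> multi_todd 0 / (\<Prod>i\<in>UNIV. fact (\<alpha> i))"

text \<open>
  \<open>S N \<sim> (\<tau> (1/N \<partial>/\<partial>h) F) (h = 0)\<close> as \<open>N \<rightarrow> \<infinity>\<close>. Smoothness of \<open>F\<close> near \<open>0\<close> is part of the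
  relation, so that the partial derivatives on the right-hand side are meaningful.
\<close>

definition todd_asymptotic ::
  "(nat \<Rightarrow> real) \<Rightarrow> (real^'d::{finite,linorder} \<Rightarrow> real) \<Rightarrow> bool" where
  "todd_asymptotic S F \<longleftrightarrow>
     (\<exists>U. 0 \<in> U \<and> smooth_on U F) \<and>
     (\<forall>M::nat. (\<lambda>N::nat. S N -
         (\<Sum>\<alpha> | multi_order \<alpha> < M.
            todd_coeff \<alpha> * (1 / real N ^ multi_order \<alpha>) * multi_diff \<alpha> F 0))
        \<in> O(\<lambda>N. 1 / real N ^ M))"

definition riemann_sum :: "(real^'n) set \<Rightarrow> (real^'n \<Rightarrow> real) \<Rightarrow> nat \<Rightarrow> real" where
  "riemann_sum P f N =
     1 / real N ^ CARD('n) * (\<Sum>k \<in> int_lattice \<inter> (*\<^sub>R) (real N) ` P. f (k /\<^sub>R real N))"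

end

theory Submission
  imports Defs
begin

text \<open>
  Let \<open>D\<close> be the derivative along a vector \<open>w\<close>. Since \<open>\<tau>(s) (1 - exp (- s)) = s\<close>, applying first the
  truncated operator \<open>\<tau>(e D)\<close> and then the difference \<open>g(x) - g(x - e w)\<close> gives \<open>e D g\<close> up to a
  high power of \<open>e\<close>. At a vertex of \<open>\<Delta>\<close> the active normals form a lattice basis, so there is a dual
  lattice basis \<open>w\<^sub>1, \<dots>, w\<^sub>n\<close>, and shifting \<open>h\<^sub>j\<close> translates the vertex cone along \<open>w\<^sub>j\<close>. Iterating
  over \<open>j\<close>, the integral of \<open>\<tau>(e D\<^sub>1) \<dots> \<tau>(e D\<^sub>n) g\<close> over one cell of the cone (a translate of the
  lattice parallelepiped of size \<open>e\<close>) is \<open>e\<^sup>n\<close> times the value of \<open>g\<close> at the corner of the cell,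
  again up to a high power of \<open>e\<close>. With \<open>e = 1/N\<close>, summing over the cells yields the Riemann sum of
  the cone. A partition of unity subordinate to the open stars of the vertices reduces the polytope
  to its vertex cones.
\<close>

section \<open>Directional derivatives and classes of smooth functions\<close>

text \<open>The error budget shapes the estimates. On the order of N^n cells meet the support, so an
  error O(N^-M) in the sum demands an error O(e^(n+M)) on each cell, with a constant independent of
  its position. The n differences supply e^n; integrating a uniform bound over the cone, where the
  integrand lives in a fixed ball, makes the constant uniform. Under a cone integral, a difference
  along w_j cuts off the cone whose j-th bound is lowered by e, so n differences leave one half-open
  cell. Half-openness makes the cells tile the cone with exactly one point of (1/N)Z^n in each, the
  corner; corners are such points because the bounds c are integers. No change of variables to an
  orthant is made: the volume of a cell comes from comparing fundamental domains, and the integral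
  of D_1 ... D_n g over a cone from letting e tend to 0. The partition of unity is never normalised:
  vertices are peeled off one at a time by f = \<rho> f + (1 - \<rho>) f, until the rest vanishes
  near the polytope. The cutoffs keep a positive slack at the inactive facets, so that small shifts
  h act on each piece as on its cone.\<close>

definition dird :: "real^'k \<Rightarrow> (real^'k::finite \<Rightarrow> real) \<Rightarrow> real^'k \<Rightarrow> real" where
  "dird w g x = deriv (\<lambda>t. g (x + t *\<^sub>R w)) 0"

lemma partial_diff_eq_dird: "partial_diff i = dird (axis i 1)"
  by (simp add: fun_eq_iff partial_diff_def dird_def)

lemma has_real_derivative_line:
  assumes "(g has_derivative D) (at (x + t *\<^sub>R w))"
  shows "((\<lambda>t. g (x + t *\<^sub>R w)) has_real_derivative D w) (at t)"
proof -
  have "((\<lambda>t. x + t *\<^sub>R w) has_derivative (\<lambda>t. t *\<^sub>R w)) (at t)"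
    by (auto intro!: derivative_eq_intros)
  from has_derivative_compose[OF this assms]
  have "((\<lambda>t. g (x + t *\<^sub>R w)) has_derivative (\<lambda>t. D (t *\<^sub>R w))) (at t)" .
  moreover have "D (t *\<^sub>R w) = D w * t" for t
    using linear_cmul[OF has_derivative_linear[OF assms], of t w] by (simp add: mult.commute)
  ultimately show ?thesis
    by (simp add: has_field_derivative_def)
qed

lemma dird_eq:
  assumes "(g has_derivative D) (at x)"
  shows "dird w g x = D w"
  using has_real_derivative_line[of g D x 0 w] assms
  by (simp add: dird_def DERIV_imp_deriv)

lemma dird_eq_frechet:
  assumes "g differentiable (at x)"
  shows "dird w g x = frechet_derivative g (at x) w"
  using assms by (intro dird_eq) (simp add: frechet_derivative_works)

lemma has_derivative_dird:
  assumes "g differentiable (at x)"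
  shows "(g has_derivative (\<lambda>w. dird w g x)) (at x)"
  using assms by (simp add: dird_eq_frechet frechet_derivative_works)

lemma linear_dird:
  assumes "g differentiable (at x)"
  shows "linear (\<lambda>w. dird w g x)"
  using has_derivative_linear[OF has_derivative_dird[OF assms]] .

lemma dird_partial_diff:
  assumes "g differentiable (at x)"
  shows "dird w g x = (\<Sum>k\<in>UNIV. w $ k * partial_diff k g x)"
proof -
  interpret linear "\<lambda>w. dird w g x" by (rule linear_dird[OF assms])
  have "dird w g x = dird (\<Sum>k\<in>UNIV. (w $ k) *\<^sub>R axis k 1) g x"
    using basis_expansion[of w] by (simp add: scalar_mult_eq_scaleR)
  then show ?thesis
    by (simp add: sum scale partial_diff_eq_dird)
qed

lemma dird_cong_open:
  assumes "open U" "x \<in> U" "\<And>y. y \<in> U \<Longrightarrow> f y = g y"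
  shows "dird w f x = dird w g x"
proof -
  have "isCont (\<lambda>t. x + t *\<^sub>R w) 0" by (intro continuous_intros)
  then have "((\<lambda>t. x + t *\<^sub>R w) \<longlongrightarrow> x + 0 *\<^sub>R w) (nhds 0)"
    unfolding isCont_def using tendsto_at_iff_tendsto_nhds by blast
  then have "\<forall>\<^sub>F t in nhds 0. x + t *\<^sub>R w \<in> U"
    using topological_tendstoD assms(1,2) by fastforce
  then have "\<forall>\<^sub>F t in nhds 0. f (x + t *\<^sub>R w) = g (x + t *\<^sub>R w)"
    by eventually_elim (rule assms(3))
  then show ?thesis
    unfolding dird_def by (rule deriv_cong_ev) simp
qed

lemma dird_add:
  "f differentiable (at x) \<Longrightarrow> g differentiable (at x) \<Longrightarrow>
     dird w (\<lambda>x. f x + g x) x = dird w f x + dird w g x"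
  by (intro dird_eq[THEN trans]) (auto intro!: has_derivative_add has_derivative_dird)

lemma dird_cmult:
  "f differentiable (at x) \<Longrightarrow> dird w (\<lambda>x. c * f x) x = c * dird w f x"
  by (intro dird_eq[THEN trans]) (auto intro!: has_derivative_mult_right has_derivative_dird)

lemma dird_mult:
  assumes "f differentiable (at x)" "g differentiable (at x)"
  shows "dird w (\<lambda>x. f x * g x) x = f x * dird w g x + dird w f x * g x"
  by (rule dird_eq[OF has_derivative_mult[OF has_derivative_dird[OF assms(1)]
        has_derivative_dird[OF assms(2)]]])

lemma dird_inverse:
  assumes "f differentiable (at x)" "f x \<noteq> 0"
  shows "dird w (\<lambda>x. inverse (f x)) x = - 1 * (dird w f x * (inverse (f x) * inverse (f x)))"
  using dird_eq[OF Deriv.has_derivative_inverse[OF assms(2) has_derivative_dird[OF assms(1)]]]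
  by simp

lemma dird_const [simp]: "dird w (\<lambda>x. c) = (\<lambda>x. 0)"
  by (simp add: dird_def fun_eq_iff)

lemma dird_0 [simp]: "dird 0 f = (\<lambda>x. 0)"
  by (simp add: dird_def fun_eq_iff)

lemma dird_translate: "dird w (\<lambda>x. f (x - a)) = (\<lambda>x. dird w f (x - a))"
  by (simp add: dird_def fun_eq_iff algebra_simps)

section \<open>Closure properties of the classes C^m and of smooth functions\<close>

lemma differentiable_on_openD:
  "g differentiable_on U \<Longrightarrow> open U \<Longrightarrow> x \<in> U \<Longrightarrow> g differentiable (at x)"
  by (simp add: differentiable_on_eq_differentiable_at)

lemma differentiable_on_cong:
  assumes "\<And>x. x \<in> U \<Longrightarrow> f x = g x" "f differentiable_on U"
  shows "g differentiable_on U"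
  using assms unfolding differentiable_on_def differentiable_def
  by (metis has_derivative_transform)

text \<open>At a point of the open set \<open>U\<close> each \<open>partial_diff\<close> sees only
  values in \<open>U\<close>. This allows a derivative to be replaced by a formula that is valid on
  \<open>U\<close> only.\<close>

lemma C_diff_cong:
  assumes "open U" "\<And>x. x \<in> U \<Longrightarrow> f x = g x"
  shows "C_diff m U f \<longleftrightarrow> C_diff m U g"
  using assms(2)
proof (induction m arbitrary: f g)
  case 0
  then show ?case by (simp cong: continuous_on_cong)
next
  case (Suc m)
  have "f differentiable_on U \<longleftrightarrow> g differentiable_on U"
    using differentiable_on_cong[of U f g] differentiable_on_cong[of U g f] Suc.prems by auto
  moreover have "C_diff m U (partial_diff i f) = C_diff m U (partial_diff i g)" for i
    by (intro Suc.IH) (auto simp: partial_diff_eq_dird Suc.prems intro!: dird_cong_open[OF assms(1)])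
  ultimately show ?case by simp
qed

lemma C_diff_Suc_imp: "C_diff (Suc m) U g \<Longrightarrow> C_diff m U g"
  by (induction m arbitrary: g) (auto intro: differentiable_imp_continuous_on)

lemma C_diff_const: "C_diff m U (\<lambda>x. c)"
  by (induction m arbitrary: c) (auto simp: partial_diff_eq_dird)

lemma C_diff_add:
  assumes "open U"
  shows "C_diff m U f \<Longrightarrow> C_diff m U g \<Longrightarrow> C_diff m U (\<lambda>x. f x + g x)"
proof (induction m arbitrary: f g)
  case 0
  then show ?case by (auto intro: continuous_on_add)
next
  case (Suc m)
  have "C_diff m U (partial_diff i (\<lambda>x. f x + g x))
     = C_diff m U (\<lambda>x. partial_diff i f x + partial_diff i g x)" for i
    using Suc.prems assms unfolding partial_diff_eq_dird
    by (intro C_diff_cong dird_add) (auto dest: differentiable_on_openD)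
  with Suc show ?case by auto
qed

lemma C_diff_mult:
  assumes "open U"
  shows "C_diff m U f \<Longrightarrow> C_diff m U g \<Longrightarrow> C_diff m U (\<lambda>x. f x * g x)"
proof (induction m arbitrary: f g)
  case 0
  then show ?case by (auto intro: continuous_on_mult)
next
  case (Suc m)
  have "C_diff m U (partial_diff i (\<lambda>x. f x * g x))
     = C_diff m U (\<lambda>x. f x * partial_diff i g x + partial_diff i f x * g x)" for i
    using Suc.prems assms unfolding partial_diff_eq_dird
    by (intro C_diff_cong dird_mult) (auto dest: differentiable_on_openD)
  moreover have "C_diff m U f" "C_diff m U g"
    using Suc.prems C_diff_Suc_imp by blast+
  ultimately show ?case
    using Suc by (auto intro!: C_diff_add assms)
qed

text \<open>The derivative -f'/f^2 is written as a product of the constant -1, f' and two copies of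
  1/f, so that closure under products and the induction hypothesis for 1/f suffice.\<close>

lemma C_diff_inverse:
  assumes "open U" "\<And>x. x \<in> U \<Longrightarrow> f x \<noteq> 0"
  shows "C_diff m U f \<Longrightarrow> C_diff m U (\<lambda>x. inverse (f x))"
proof (induction m)
  case 0
  then show ?case using assms by (auto intro: continuous_on_inverse)
next
  case (Suc m)
  have "C_diff m U (partial_diff i (\<lambda>x. inverse (f x)))
     = C_diff m U (\<lambda>x. - 1 * (partial_diff i f x * (inverse (f x) * inverse (f x))))" for i
    using Suc.prems assms unfolding partial_diff_eq_dird
    by (intro C_diff_cong dird_inverse) (auto dest: differentiable_on_openD)
  moreover have "C_diff m U f"
    using Suc.prems C_diff_Suc_imp by blast
  moreover have "(\<lambda>x. inverse (f x)) differentiable_on U"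
    using Suc.prems assms by (auto simp: differentiable_on_def intro!: differentiable_inverse)
  moreover have "C_diff m U (\<lambda>x. inverse (f x))"
    using \<open>C_diff m U f\<close> by (rule Suc.IH)
  moreover have "C_diff m U (partial_diff i f)" for i
    using Suc.prems by simp
  ultimately have "C_diff m U (partial_diff i (\<lambda>x. inverse (f x)))" for i
    by (simp only:) (intro C_diff_mult C_diff_const assms(1))
  with \<open>(\<lambda>x. inverse (f x)) differentiable_on U\<close> show ?case by simp
qed

lemma smooth_on_open: "smooth_on U g \<Longrightarrow> open U"
  by (simp add: smooth_on_def)

text \<open>Differentiation leaves the single function but often stays in an explicit family; such a
  family \<open>P\<close>, closed under partial derivatives up to equality on \<open>U\<close>,
  consists of smooth functions by induction on the order. It serves for translates, cone integrals
  and flat exponentials.\<close>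

lemma smooth_on_coinduct [consumes 2, case_names step]:
  assumes "open U" "P g"
    and step: "\<And>g. P g \<Longrightarrow> g differentiable_on U \<and>
           (\<forall>i. \<exists>g'. P g' \<and> (\<forall>x\<in>U. partial_diff i g x = g' x))"
  shows "smooth_on U g"
proof -
  have "C_diff m U g" for m
    using assms(2)
  proof (induction m arbitrary: g)
    case 0
    then show ?case using step[OF 0] by (auto intro: differentiable_imp_continuous_on)
  next
    case (Suc m)
    have "C_diff m U (partial_diff i g)" for i
    proof -
      obtain g' where "P g'" "\<forall>x\<in>U. partial_diff i g x = g' x"
        using step[OF Suc.prems] by blast
      then show ?thesis
        using C_diff_cong[OF assms(1)] Suc.IH by metis
    qed
    then show ?case using step[OF Suc.prems] by simp
  qed
  with assms(1) show ?thesis by (simp add: smooth_on_def)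
qed

lemma smooth_on_const: "open U \<Longrightarrow> smooth_on U (\<lambda>x. c)"
  by (simp add: smooth_on_def C_diff_const)

lemma smooth_on_add: "smooth_on U f \<Longrightarrow> smooth_on U g \<Longrightarrow> smooth_on U (\<lambda>x. f x + g x)"
  by (simp add: smooth_on_def C_diff_add)

lemma smooth_on_mult: "smooth_on U f \<Longrightarrow> smooth_on U g \<Longrightarrow> smooth_on U (\<lambda>x. f x * g x)"
  by (simp add: smooth_on_def C_diff_mult)

lemma smooth_on_cmult: "smooth_on U f \<Longrightarrow> smooth_on U (\<lambda>x. c * f x)"
  by (intro smooth_on_mult smooth_on_const smooth_on_open)

lemma smooth_on_diff: "smooth_on U f \<Longrightarrow> smooth_on U g \<Longrightarrow> smooth_on U (\<lambda>x. f x - g x)"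
  using smooth_on_add[of U f "\<lambda>x. - 1 * g x"] smooth_on_cmult[of U g "- 1"] by simp

lemma smooth_on_sum:
  "open U \<Longrightarrow> (\<And>i. i \<in> I \<Longrightarrow> smooth_on U (f i)) \<Longrightarrow> smooth_on U (\<lambda>x. \<Sum>i\<in>I. f i x)"
  by (induction I rule: infinite_finite_induct) (auto intro: smooth_on_const smooth_on_add)

lemma smooth_on_prod:
  "open U \<Longrightarrow> (\<And>i. i \<in> I \<Longrightarrow> smooth_on U (f i)) \<Longrightarrow> smooth_on U (\<lambda>x. \<Prod>i\<in>I. f i x)"
  by (induction I rule: infinite_finite_induct) (auto intro: smooth_on_const smooth_on_mult)

lemma smooth_on_inverse:
  "smooth_on U f \<Longrightarrow> (\<And>x. x \<in> U \<Longrightarrow> f x \<noteq> 0) \<Longrightarrow> smooth_on U (\<lambda>x. inverse (f x))"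
  by (simp add: smooth_on_def C_diff_inverse)

lemma smooth_on_partial_diff: "smooth_on U f \<Longrightarrow> smooth_on U (partial_diff i f)"
  unfolding smooth_on_def by (metis C_diff.simps(2))

lemma smooth_on_differentiable: "smooth_on U f \<Longrightarrow> x \<in> U \<Longrightarrow> f differentiable (at x)"
  unfolding smooth_on_def by (metis C_diff.simps(2) differentiable_on_openD)

lemma smooth_on_cong:
  "smooth_on U f \<Longrightarrow> (\<And>x. x \<in> U \<Longrightarrow> f x = g x) \<Longrightarrow> smooth_on U g"
  unfolding smooth_on_def using C_diff_cong by blast

lemma smooth_on_subset:
  assumes "smooth_on U f" "open V" "V \<subseteq> U"
  shows "smooth_on V f"
  using assms(2,1)
proof (rule smooth_on_coinduct[where P = "smooth_on U"])
  fix g assume "smooth_on U g"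
  then show "g differentiable_on V \<and> (\<forall>i. \<exists>g'. smooth_on U g' \<and> (\<forall>x\<in>V. partial_diff i g x = g' x))"
    using assms(2,3) smooth_on_partial_diff smooth_on_differentiable
    by (metis differentiable_on_eq_differentiable_at subsetD)
qed

lemma smooth_on_continuous: "smooth_on U f \<Longrightarrow> continuous_on U f"
  by (metis C_diff.simps(1) smooth_on_def)

lemma smooth_on_dird:
  assumes "smooth_on U f"
  shows "smooth_on U (dird w f)"
proof (rule smooth_on_cong)
  show "smooth_on U (\<lambda>x. \<Sum>k\<in>UNIV. w $ k * partial_diff k f x)"
    by (intro smooth_on_sum smooth_on_cmult smooth_on_partial_diff assms smooth_on_open[OF assms])
qed (simp add: dird_partial_diff smooth_on_differentiable[OF assms])

lemma smooth_on_translate: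
  assumes "smooth_on UNIV f"
  shows "smooth_on UNIV (\<lambda>x. f (x - a))"
proof (rule smooth_on_coinduct[where P = "\<lambda>g. \<exists>f. smooth_on UNIV f \<and> g = (\<lambda>x. f (x - a))"])
  fix g assume "\<exists>f. smooth_on UNIV f \<and> g = (\<lambda>x. f (x - a))"
  then obtain f where f: "smooth_on UNIV f" "g = (\<lambda>x. f (x - a))" by blast
  have "g differentiable (at x)" for x
  proof -
    have "((\<lambda>x. x - a) has_derivative (\<lambda>h. h)) (at x)"
      by (auto intro!: derivative_eq_intros)
    from has_derivative_compose[OF this has_derivative_dird[OF smooth_on_differentiable[OF f(1) UNIV_I]]]
    show ?thesis
      unfolding f(2) differentiable_def by blast
  qed
  then have "g differentiable_on UNIV"
    by (simp add: differentiable_on_def)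
  moreover have "\<exists>g'. (\<exists>f. smooth_on UNIV f \<and> g' = (\<lambda>x. f (x - a))) \<and>
      (\<forall>x\<in>UNIV. partial_diff i g x = g' x)" for i
    by (intro exI[of _ "partial_diff i g"] conjI exI[of _ "partial_diff i f"]
        smooth_on_partial_diff f(1)) (simp_all add: f(2) partial_diff_eq_dird dird_translate)
  ultimately show "g differentiable_on UNIV \<and> (\<forall>i. \<exists>g'. (\<exists>f. smooth_on UNIV f \<and>
      g' = (\<lambda>x. f (x - a))) \<and> (\<forall>x\<in>UNIV. partial_diff i g x = g' x))"
    by blast
qed (use assms in auto)

section \<open>Test functions\<close>

text \<open>In finite dimension the closure of the support is compact iff the support is bounded. A
  radius is the form in which compact support enters the later estimates.\<close>

lemma test_function_iff:
  "test_function f \<longleftrightarrow> smooth_on UNIV f \<and> (\<exists>R. \<forall>x. norm x > R \<longrightarrow> f x = 0)"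
proof -
  have "bounded {x. f x \<noteq> 0} \<longleftrightarrow> (\<exists>R. \<forall>x. norm x > R \<longrightarrow> f x = 0)"
    unfolding bounded_iff by (simp add: not_le[symmetric]) blast
  then show ?thesis
    by (simp add: test_function_def support_on_def compact_closure)
qed

lemma test_functionI:
  "smooth_on UNIV f \<Longrightarrow> (\<And>x. norm x > R \<Longrightarrow> f x = 0) \<Longrightarrow> test_function f"
  by (auto simp: test_function_iff)

lemma test_function_smooth: "test_function f \<Longrightarrow> smooth_on UNIV f"
  by (simp add: test_function_def)

lemma test_function_differentiable: "test_function f \<Longrightarrow> f differentiable (at x)"
  using test_function_smooth smooth_on_differentiable by blast

lemma test_function_add:
  assumes "test_function f" "test_function g"
  shows "test_function (\<lambda>x. f x + g x)"
proof -
  obtain R R' where "\<And>x. norm x > R \<Longrightarrow> f x = 0" "\<And>x. norm x > R' \<Longrightarrow> g x = 0"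
    using assms test_function_iff by metis
  then have "f x + g x = 0" if "norm x > max R R'" for x using that by simp
  with smooth_on_add[OF assms[THEN test_function_smooth]] show ?thesis
    by (rule test_functionI)
qed

lemma test_function_smooth_mult:
  assumes "smooth_on UNIV f" "test_function g"
  shows "test_function (\<lambda>x. f x * g x)"
proof -
  obtain R where R: "\<And>x. norm x > R \<Longrightarrow> g x = 0"
    using assms test_function_iff by metis
  show ?thesis
    using smooth_on_mult[OF assms(1) test_function_smooth[OF assms(2)]]
    by (rule test_functionI[where R = R]) (simp add: R)
qed

lemma test_function_0: "test_function (\<lambda>x. 0)"
  by (simp add: test_function_iff smooth_on_const)

lemma test_function_cmult: "test_function f \<Longrightarrow> test_function (\<lambda>x. c * f x)"
  by (simp add: test_function_smooth_mult smooth_on_const)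

lemma test_function_diff: "test_function f \<Longrightarrow> test_function g \<Longrightarrow> test_function (\<lambda>x. f x - g x)"
  using test_function_add[of f "\<lambda>x. - 1 * g x"] test_function_cmult[of g "- 1"] by simp

lemma test_function_sum:
  "(\<And>i. i \<in> I \<Longrightarrow> test_function (f i)) \<Longrightarrow> test_function (\<lambda>x. \<Sum>i\<in>I. f i x)"
  by (induction I rule: infinite_finite_induct) (auto intro: test_function_0 test_function_add)

lemma dird_eq_0_outside:
  assumes "\<And>x. norm x > R \<Longrightarrow> f x = 0" "norm x > R"
  shows "dird w f x = 0"
proof -
  have "dird w f x = dird w (\<lambda>x. 0) x"
    using assms by (intro dird_cong_open[of "{x. norm x > R}"])
      (auto intro!: open_Collect_less continuous_intros)
  then show ?thesis by simp
qed

lemma test_function_dird: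
  assumes "test_function f"
  shows "test_function (dird w f)"
proof -
  obtain R where "\<And>x. norm x > R \<Longrightarrow> f x = 0"
    using assms test_function_iff by metis
  then have "dird w f x = 0" if "norm x > R" for x
    using that by (rule dird_eq_0_outside)
  with smooth_on_dird[OF test_function_smooth[OF assms]] show ?thesis
    by (rule test_functionI)
qed

lemma test_function_dird_funpow: "test_function f \<Longrightarrow> test_function ((dird w ^^ a) f)"
  by (induction a) (auto intro: test_function_dird)

lemma test_function_translate:
  assumes "test_function f"
  shows "test_function (\<lambda>x. f (x - a))"
proof -
  obtain R where R: "\<And>x. norm x > R \<Longrightarrow> f x = 0"
    using assms test_function_iff by metis
  have "f (x - a) = 0" if "norm x > R + norm a" for x
    using norm_triangle_ineq2[of x a] that by (intro R) simp
  with smooth_on_translate[OF test_function_smooth[OF assms]] show ?thesis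
    by (rule test_functionI)
qed

lemma test_function_bounded:
  assumes "test_function f"
  obtains B where "B \<ge> 0" "\<And>x. \<bar>f x\<bar> \<le> B"
proof -
  obtain R where R: "\<And>x. norm x > R \<Longrightarrow> f x = 0"
    using assms test_function_iff by metis
  have "continuous_on (cball 0 R) f"
    using assms smooth_on_continuous test_function_smooth continuous_on_subset by blast
  then have "bounded (f ` cball 0 R)"
    by (intro compact_imp_bounded compact_continuous_image) auto
  then obtain B where B: "\<forall>x\<in>cball 0 R. \<bar>f x\<bar> \<le> B"
    unfolding bounded_iff by auto
  have "\<bar>f x\<bar> \<le> max B 0" for x
    using B R[of x] by (cases "norm x \<le> R") force+
  with that[of "max B 0"] show ?thesis by simp
qed

lemma test_function_integrable:
  fixes f :: "real^'n \<Rightarrow> real"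
  assumes "test_function f"
  shows "integrable lborel f"
proof -
  obtain R where R: "\<And>x. norm x > R \<Longrightarrow> f x = 0"
    using assms test_function_iff by metis
  have "continuous_on (cball 0 R) f"
    using assms smooth_on_continuous test_function_smooth continuous_on_subset by blast
  then have "integrable lborel (\<lambda>x. indicator (cball 0 R) x *\<^sub>R f x)"
    by (intro borel_integrable_compact) auto
  also have "(\<lambda>x. indicator (cball 0 R) x *\<^sub>R f x) = f"
    using R by (auto simp: indicator_def fun_eq_iff not_le)
  finally show ?thesis .
qed

lemma test_function_set_integrable:
  fixes f :: "real^'n \<Rightarrow> real"
  assumes "test_function f" "A \<in> sets borel"
  shows "set_integrable lborel A f"
  using integrable_mult_indicator[OF _ test_function_integrable[OF assms(1)], of A] assms(2)
  by (simp add: set_integrable_def)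

lemma test_function_line:
  "test_function g \<Longrightarrow> ((\<lambda>t. g (x + t *\<^sub>R w)) has_real_derivative dird w g (x + t *\<^sub>R w)) (at t)"
  by (intro has_real_derivative_line has_derivative_dird test_function_differentiable)

section \<open>The coefficients of the Todd function\<close>

definition todd_fps :: "real fps" where
  "todd_fps = fps_X / (1 - fps_exp (- 1))"

text \<open>The Taylor coefficients of the one-variable Todd function, read off the formal series so
  that identities between them are coefficient comparisons.\<close>

definition todd1 :: "nat \<Rightarrow> real" where
  "todd1 a = fps_nth todd_fps a"

lemma subdegree_one_minus_exp: "subdegree (1 - fps_exp (- 1 :: real)) = 1"
  by (rule subdegreeI) auto

lemma todd_has_fps_expansion: "todd has_fps_expansion todd_fps"
proof -
  have "(\<lambda>x::real. if x = 0 then 1 else x / (1 - exp (- x))) has_fps_expansion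
      fps_X / (1 - fps_exp (- 1))"
  proof (rule has_fps_expansion_divide)
    show "(\<lambda>x::real. 1 - exp (- x)) has_fps_expansion 1 - fps_exp (- 1)"
      by (intro fps_expansion_intros)
    show "(1 - fps_exp (- 1 :: real)) \<noteq> 0"
      using subdegree_one_minus_exp by auto
  qed (auto simp: subdegree_one_minus_exp intro: fps_expansion_intros)
  moreover have "todd = (\<lambda>x::real. if x = 0 then 1 else x / (1 - exp (- x)))"
    by (simp add: todd_def fun_eq_iff)
  ultimately show ?thesis by (simp add: todd_fps_def)
qed

text \<open>Compare the coefficients of X^m in
  \<open>todd_fps * (1 - fps_exp (- 1)) = fps_X\<close>. The term a = m drops out because 1 -
  exp(-X) has no constant term, and the minus sign in front of the exponential makes the right-hand
  side -1. The cancellation in \<open>bdiff_todd_trunc\<close> rests on this.\<close>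

lemma todd1_recurrence:
  "(\<Sum>a<m. todd1 a * ((- 1) ^ (m - a) / fact (m - a))) = (if m = 1 then - 1 else 0)"
proof -
  have "(1 - fps_exp (- 1 :: real)) dvd fps_X"
  proof (subst fps_dvd_iff)
    show "(1 - fps_exp (- 1 :: real)) \<noteq> 0"
      using subdegree_one_minus_exp by auto
  qed (auto simp: subdegree_one_minus_exp)
  then have "todd_fps * (1 - fps_exp (- 1)) = fps_X"
    by (simp add: todd_fps_def)
  then have "(\<Sum>a=0..m. todd1 a * fps_nth (1 - fps_exp (- 1)) (m - a)) = fps_nth fps_X m"
    unfolding todd1_def by (metis fps_mult_nth)
  moreover have "{0..m} = insert m {..<m}" by auto
  moreover have "(\<Sum>a<m. todd1 a * fps_nth (1 - fps_exp (- 1)) (m - a)) =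
      (\<Sum>a<m. - (todd1 a * ((- 1) ^ (m - a) / fact (m - a))))"
    by (intro sum.cong) auto
  ultimately show ?thesis
    by (auto simp: sum_negf split: if_splits)
qed

lemma todd1_0 [simp]: "todd1 0 = 1"
  using todd1_recurrence[of 1] by simp

text \<open>An iterated \<open>deriv\<close> at 0 depends on values nearby, so the series has to
  represent \<open>todd\<close> and all its derivatives on an open set. Inside the disc of
  convergence, where the series is known to equal \<open>todd\<close>, the equality passes from each
  derivative to the next.\<close>

lemma todd_local_derivatives:
  obtains S where "open S" "0 \<in> S"
    "\<forall>a. \<forall>x\<in>S. ((deriv ^^ a) todd has_real_derivative (deriv ^^ Suc a) todd x) (at x)"
    "\<forall>a. (deriv ^^ a) todd 0 = fact a * todd1 a"
proof -
  let ?F = "\<lambda>a. (fps_deriv ^^ a) todd_fps"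
  obtain V where V: "open V" "0 \<in> V" "\<And>z. z \<in> V \<Longrightarrow> eval_fps todd_fps z = todd z"
    using todd_has_fps_expansion unfolding has_fps_expansion_def eventually_nhds by blast
  define S where "S = V \<inter> eball 0 (fps_conv_radius todd_fps)"
  have S: "open S" "0 \<in> S"
    using V todd_has_fps_expansion by (auto simp: S_def has_fps_expansion_def zero_ereal_def)
  have rad: "fps_conv_radius todd_fps \<le> fps_conv_radius (?F a)" for a
    by (induction a) (auto intro: order_trans fps_conv_radius_deriv)
  have "(eval_fps (?F a) has_real_derivative eval_fps (?F (Suc a)) x) (at x)" if "x \<in> S" for a x
    using has_field_derivative_eval_fps[of x "?F a" UNIV] that rad[of a]
    by (auto simp: S_def intro: less_le_trans)
  note der = this
  have eq: "(deriv ^^ a) todd x = eval_fps (?F a) x" if "x \<in> S" for a x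
    using that
  proof (induction a arbitrary: x)
    case 0
    then show ?case using V by (simp add: S_def)
  next
    case (Suc a)
    have "\<forall>\<^sub>F y in nhds x. y \<in> S"
      using S Suc.prems by (intro eventually_nhds_in_open)
    then have "\<forall>\<^sub>F y in nhds x. (deriv ^^ a) todd y = eval_fps (?F a) y"
      by eventually_elim (rule Suc.IH)
    then have "deriv ((deriv ^^ a) todd) x = deriv (eval_fps (?F a)) x"
      by (rule deriv_cong_ev) simp
    also have "\<dots> = eval_fps (?F (Suc a)) x"
      using der[OF Suc.prems] by (rule DERIV_imp_deriv)
    finally show ?case by simp
  qed
  show ?thesis
  proof (rule that[OF S]; intro allI ballI)
    show "((deriv ^^ a) todd has_real_derivative (deriv ^^ Suc a) todd x) (at x)" if "x \<in> S" for a x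
    proof -
      have "((deriv ^^ a) todd has_real_derivative eval_fps (?F (Suc a)) x) (at x)"
        using der[OF that, of a]
        by (rule has_field_derivative_transform_within_open[OF _ S(1) that]) (simp add: eq)
      then show ?thesis by (simp only: eq[OF that])
    qed
    show "(deriv ^^ a) todd 0 = fact a * todd1 a" for a
      by (simp add: eq S(2) eval_fps_at_0 fps_0th_higher_deriv todd1_def)
  qed
qed

text \<open>\<open>multi_todd\<close> separates the variables: a partial derivative raises the order
  of a single factor, and the factorials produced at 0 cancel against those in
  \<open>todd_coeff\<close>.\<close>

lemma todd_coeff_eq:
  fixes \<alpha> :: "'d::{finite,linorder} \<Rightarrow> nat"
  shows "todd_coeff \<alpha> = (\<Prod>i\<in>UNIV. todd1 (\<alpha> i))"
proof -
  obtain S where S: "open S" "0 \<in> S"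
    and der: "\<forall>a. \<forall>x\<in>S. ((deriv ^^ a) todd has_real_derivative (deriv ^^ Suc a) todd x) (at x)"
    and at0: "\<forall>a. (deriv ^^ a) todd 0 = fact a * todd1 a"
    by (rule todd_local_derivatives)
  define B where "B = {s :: real^'d::{finite,linorder}. \<forall>i. s $ i \<in> S}"
  have "open B" unfolding B_def using open_vector_box[of "\<lambda>_. S"] S(1) by simp
  \<comment> \<open>Every iterated partial derivative agrees on \<open>B\<close> with some
    \<open>G \<beta>\<close>, in which factor \<open>j\<close> is differentiated
    \<open>\<beta> j\<close> times. The box \<open>B\<close> keeps each coordinate in the set where
    the derivatives of \<open>todd\<close> are under control.\<close>
  define G where "G \<beta> s = (\<Prod>j\<in>UNIV. (deriv ^^ \<beta> j) todd (s $ j))" for \<beta> :: "'d \<Rightarrow> nat" and s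
  have step: "partial_diff i (G \<beta>) s = G (\<beta>(i := Suc (\<beta> i))) s" if "s \<in> B" for i \<beta> s
  proof -
    let ?P = "\<Prod>j\<in>UNIV-{i}. (deriv ^^ \<beta> j) todd (s $ j)"
    have 1: "G \<beta> (s + t *\<^sub>R axis i 1) = (deriv ^^ \<beta> i) todd (s $ i + t) * ?P" for t
      unfolding G_def by (subst prod.remove[of _ i]) (auto simp: axis_def)
    have "((\<lambda>t. (deriv ^^ \<beta> i) todd (s $ i + t) * ?P) has_real_derivative
        (deriv ^^ Suc (\<beta> i)) todd (s $ i) * ?P) (at 0)"
      using der[rule_format, of "s $ i + 0" "\<beta> i"] that DERIV_shift[of "(deriv ^^ \<beta> i) todd" _ 0 "s $ i"]
      by (intro DERIV_cmult_right) (auto simp: B_def add.commute)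
    then have "partial_diff i (G \<beta>) s = (deriv ^^ Suc (\<beta> i)) todd (s $ i) * ?P"
      unfolding partial_diff_def 1 by (rule DERIV_imp_deriv)
    also have "\<dots> = G (\<beta>(i := Suc (\<beta> i))) s"
      unfolding G_def by (subst prod.remove[of UNIV i]) auto
    finally show ?thesis .
  qed
  have pow: "(partial_diff i ^^ a) g s = G (\<beta>(i := \<beta> i + a)) s"
    if "s \<in> B" "\<And>s. s \<in> B \<Longrightarrow> g s = G \<beta> s" for i a g \<beta> s
    using that(1)
  proof (induction a arbitrary: s)
    case 0
    then show ?case using that by simp
  next
    case (Suc a)
    have "(partial_diff i ^^ Suc a) g s = partial_diff i (G (\<beta>(i := \<beta> i + a))) s"
      unfolding funpow.simps comp_apply unfolding partial_diff_eq_dird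
      by (rule dird_cong_open[OF \<open>open B\<close> Suc.prems]) (rule Suc.IH[unfolded partial_diff_eq_dird])
    also have "\<dots> = G (\<beta>(i := \<beta> i + Suc a)) s"
      using step[OF Suc.prems, of i "\<beta>(i := \<beta> i + a)"] by simp
    finally show ?case .
  qed
  \<comment> \<open>The multi-index carries the orders of the variables already processed and is
    zero at the others.\<close>
  have fold: "foldr (\<lambda>i. partial_diff i ^^ \<alpha> i) xs multi_todd s = G (\<lambda>i. if i \<in> set xs then \<alpha> i else 0) s"
    if "distinct xs" "s \<in> B" for xs s
    using that
  proof (induction xs arbitrary: s)
    case Nil
    then show ?case by (simp add: multi_todd_def G_def)
  next
    case (Cons i xs)
    let ?\<beta> = "\<lambda>i. if i \<in> set xs then \<alpha> i else 0"
    have "foldr (\<lambda>i. partial_diff i ^^ \<alpha> i) (i # xs) multi_todd s = G (?\<beta>(i := ?\<beta> i + \<alpha> i)) s"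
      using pow[of s "foldr (\<lambda>i. partial_diff i ^^ \<alpha> i) xs multi_todd" ?\<beta> "\<alpha> i" i] Cons by simp
    also have "?\<beta>(i := ?\<beta> i + \<alpha> i) = (\<lambda>j. if j \<in> set (i # xs) then \<alpha> j else 0)"
      using Cons.prems by auto
    finally show ?case .
  qed
  have "multi_diff \<alpha> multi_todd 0 = G \<alpha> 0"
    unfolding multi_diff_def using fold[of "sorted_list_of_set UNIV" 0] S(2) by (simp add: B_def)
  also have "\<dots> = (\<Prod>i\<in>UNIV. fact (\<alpha> i)) * (\<Prod>i\<in>UNIV. todd1 (\<alpha> i))"
    by (simp add: G_def at0 prod.distrib)
  finally show ?thesis
    by (simp add: todd_coeff_def)
qed

section \<open>Difference operators and truncated Todd operators\<close>

text \<open>The mean value theorem is applied twice: along \<open>v\<close> to the difference of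
  \<open>f\<close> on two parallel lines, then along \<open>w\<close> to \<open>dird v f\<close>.
  The left-hand side is symmetric in \<open>v\<close> and \<open>w\<close>, which is what
  \<open>dird_commute\<close> exploits.\<close>

lemma second_difference_mvt:
  assumes "smooth_on UNIV f" "s > 0"
  obtains p q where "0 \<le> p" "p \<le> s" "0 \<le> q" "q \<le> s"
    "f (x + s *\<^sub>R v + s *\<^sub>R w) - f (x + s *\<^sub>R v) - (f (x + s *\<^sub>R w) - f x) =
       s\<^sup>2 * dird w (dird v f) (x + p *\<^sub>R v + q *\<^sub>R w)"
proof -
  have line: "((\<lambda>t. g (y + t *\<^sub>R z)) has_real_derivative dird z g (y + t *\<^sub>R z)) (at t)"
    if "smooth_on UNIV g" for g y z t
    by (intro has_real_derivative_line has_derivative_dird smooth_on_differentiable[OF that] UNIV_I)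
  have "((\<lambda>t. f (x + s *\<^sub>R w + t *\<^sub>R v) - f (x + t *\<^sub>R v)) has_real_derivative
      dird v f (x + s *\<^sub>R w + t *\<^sub>R v) - dird v f (x + t *\<^sub>R v)) (at t)" for t
    by (intro DERIV_diff line assms(1))
  from MVT2[OF \<open>s > 0\<close> this] obtain p where p: "p > 0" "p < s"
    "f (x + s *\<^sub>R w + s *\<^sub>R v) - f (x + s *\<^sub>R v) - (f (x + s *\<^sub>R w + 0 *\<^sub>R v) - f (x + 0 *\<^sub>R v)) =
     (s - 0) * (dird v f (x + s *\<^sub>R w + p *\<^sub>R v) - dird v f (x + p *\<^sub>R v))"
    by blast
  have "((\<lambda>t. dird v f (x + p *\<^sub>R v + t *\<^sub>R w)) has_real_derivative
      dird w (dird v f) (x + p *\<^sub>R v + t *\<^sub>R w)) (at t)" for t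
    by (intro line smooth_on_dird assms(1))
  from MVT2[OF \<open>s > 0\<close> this] obtain q where q: "q > 0" "q < s"
    "dird v f (x + p *\<^sub>R v + s *\<^sub>R w) - dird v f (x + p *\<^sub>R v + 0 *\<^sub>R w) =
     (s - 0) * dird w (dird v f) (x + p *\<^sub>R v + q *\<^sub>R w)"
    by blast
  have "f (x + s *\<^sub>R v + s *\<^sub>R w) - f (x + s *\<^sub>R v) - (f (x + s *\<^sub>R w) - f x) =
     s * (dird v f (x + p *\<^sub>R v + s *\<^sub>R w) - dird v f (x + p *\<^sub>R v))"
    using p(3) by (simp add: algebra_simps)
  also have "\<dots> = s\<^sup>2 * dird w (dird v f) (x + p *\<^sub>R v + q *\<^sub>R w)"
    using q(3) by (simp add: power2_eq_square)
  finally show ?thesis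
    using that[of p q] p q by simp
qed

text \<open>The same second difference divided by s^2 is a value of either mixed derivative at a
  point near \<open>x\<close>; continuity of both forces equality at \<open>x\<close>.\<close>

lemma dird_commute:
  assumes "smooth_on UNIV f"
  shows "dird v (dird w f) = dird w (dird v f)"
proof (rule ext)
  fix x
  have "\<bar>dird v (dird w f) x - dird w (dird v f) x\<bar> \<le> 0 + 2 * e" if "e > 0" for e
  proof -
    have cont: "continuous (at x) (dird a (dird b f))" for a b
      using smooth_on_continuous[OF smooth_on_dird[OF smooth_on_dird[OF assms]]]
      by (simp add: continuous_on_eq_continuous_at)
    obtain d1 where d1: "d1 > 0"
      "\<forall>y. dist y x < d1 \<longrightarrow> dist (dird v (dird w f) y) (dird v (dird w f) x) < e"
      using cont[of v w] \<open>e > 0\<close> unfolding continuous_at_eps_delta by blast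
    obtain d2 where d2: "d2 > 0"
      "\<forall>y. dist y x < d2 \<longrightarrow> dist (dird w (dird v f) y) (dird w (dird v f) x) < e"
      using cont[of w v] \<open>e > 0\<close> unfolding continuous_at_eps_delta by blast
    \<comment> \<open>The summand 1 keeps \<open>K\<close> positive when both directions vanish. The
      side \<open>s\<close> is then small enough for the whole parallelogram to lie within both
      continuity radii.\<close>
    define K where "K = norm v + norm w + 1"
    define s where "s = min d1 d2 / (2 * K)"
    have n: "K > 0"
      by (simp add: K_def add_nonneg_pos)
    with d1(1) d2(1) have "s > 0" by (simp add: s_def)
    have "s * K = min d1 d2 / 2"
      using n by (simp add: s_def)
    moreover have "s * (norm v + norm w) \<le> s * K"
      using \<open>s > 0\<close> by (intro mult_left_mono) (auto simp: K_def)
    ultimately have s: "s * (norm v + norm w) < min d1 d2"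
      using d1(1) d2(1) by linarith
    have near: "dist (x + p *\<^sub>R a + q *\<^sub>R b) x < min d1 d2"
      if "0 \<le> p" "p \<le> s" "0 \<le> q" "q \<le> s" "norm a + norm b = norm v + norm w" for p q a b
    proof -
      have "dist (x + p *\<^sub>R a + q *\<^sub>R b) x = norm (p *\<^sub>R a + q *\<^sub>R b)"
        by (simp add: dist_norm add.assoc)
      also have "\<dots> \<le> p * norm a + q * norm b"
        using that norm_triangle_ineq[of "p *\<^sub>R a" "q *\<^sub>R b"] by simp
      also have "\<dots> \<le> s * norm a + s * norm b"
        using that by (intro add_mono mult_right_mono) auto
      also have "\<dots> = s * (norm v + norm w)"
        using that(5) by (simp add: distrib_left[symmetric])
      finally show ?thesis using s by simp
    qed
    obtain p q where pq: "0 \<le> p" "p \<le> s" "0 \<le> q" "q \<le> s"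
      "f (x + s *\<^sub>R v + s *\<^sub>R w) - f (x + s *\<^sub>R v) - (f (x + s *\<^sub>R w) - f x) =
       s\<^sup>2 * dird w (dird v f) (x + p *\<^sub>R v + q *\<^sub>R w)"
      by (rule second_difference_mvt[OF assms \<open>s > 0\<close>])
    obtain p' q' where pq': "0 \<le> p'" "p' \<le> s" "0 \<le> q'" "q' \<le> s"
      "f (x + s *\<^sub>R w + s *\<^sub>R v) - f (x + s *\<^sub>R w) - (f (x + s *\<^sub>R v) - f x) =
       s\<^sup>2 * dird v (dird w f) (x + p' *\<^sub>R w + q' *\<^sub>R v)"
      by (rule second_difference_mvt[OF assms \<open>s > 0\<close>])
    have "s\<^sup>2 * dird w (dird v f) (x + p *\<^sub>R v + q *\<^sub>R w)
      = s\<^sup>2 * dird v (dird w f) (x + p' *\<^sub>R w + q' *\<^sub>R v)"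
      unfolding pq(5)[symmetric] pq'(5)[symmetric] by (simp add: algebra_simps)
    then have "dird w (dird v f) (x + p *\<^sub>R v + q *\<^sub>R w) = dird v (dird w f) (x + p' *\<^sub>R w + q' *\<^sub>R v)"
      using \<open>s > 0\<close> by simp
    then show ?thesis
      using d1(2)[rule_format, of "x + p' *\<^sub>R w + q' *\<^sub>R v"] d2(2)[rule_format, of "x + p *\<^sub>R v + q *\<^sub>R w"]
        near[OF pq(1-4), of v w] near[OF pq'(1-4), of w v]
      by (simp add: dist_real_def)
  qed
  then have "\<bar>dird v (dird w f) x - dird w (dird v f) x\<bar> \<le> 0"
    by (metis field_le_epsilon half_gt_zero mult.commute nonzero_mult_div_cancel_left
        times_divide_eq_right zero_neq_numeral)
  then show "dird v (dird w f) x = dird w (dird v f) x" by simp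
qed

text \<open>Maclaurin's formula for t -> g(x + t w) at t = -e. The bound \<open>B\<close> holds
  everywhere, so the unknown intermediate point is harmless, and 1/K! is estimated by 1.\<close>

lemma taylor_line:
  assumes "test_function g" "\<And>y. \<bar>(dird w ^^ K) g y\<bar> \<le> B"
  shows "\<bar>g (x - e *\<^sub>R w) - (\<Sum>b<K. (- e) ^ b / fact b * (dird w ^^ b) g x)\<bar> \<le> B * \<bar>e\<bar> ^ K"
proof -
  have "B \<ge> 0" using assms(2) abs_ge_zero order_trans by blast
  let ?d = "\<lambda>m t. (dird w ^^ m) g (x + t *\<^sub>R w)"
  have "\<forall>m t. DERIV (?d m) t :> ?d (Suc m) t"
    using test_function_line[OF test_function_dird_funpow[OF assms(1)]] by simp
  from Maclaurin_all_le[OF refl this, of "- e" K] obtain t where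
    "?d 0 (- e) = (\<Sum>m<K. ?d m 0 / fact m * (- e) ^ m) + ?d K t / fact K * (- e) ^ K" by blast
  then have "\<bar>g (x - e *\<^sub>R w) - (\<Sum>b<K. (- e) ^ b / fact b * (dird w ^^ b) g x)\<bar> =
      \<bar>?d K t\<bar> / fact K * \<bar>e\<bar> ^ K"
    by (simp add: algebra_simps abs_mult power_abs)
  also have "\<dots> \<le> B / 1 * \<bar>e\<bar> ^ K"
    using assms(2) \<open>B \<ge> 0\<close> by (intro mult_right_mono frac_le) (auto simp: fact_ge_1)
  finally show ?thesis by simp
qed

text \<open>On Taylor expansions this is the operator 1 - exp(-e D) with D the derivative along
  \<open>w\<close>, that is, the denominator of the Todd function.\<close>

definition bdiff :: "real \<Rightarrow> real^'n \<Rightarrow> (real^'n \<Rightarrow> real) \<Rightarrow> real^'n \<Rightarrow> real" where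
  "bdiff e w g x = g x - g (x - e *\<^sub>R w)"

text \<open>The operator \<tau>(e D), cut off by the order in this one direction. Products of such
  operators are thus truncated over a box of exponents, whereas the asymptotic relation truncates by
  total order; \<open>vertex_asymptotic\<close> compares the two.\<close>

definition todd_trunc :: "nat \<Rightarrow> real \<Rightarrow> real^'n \<Rightarrow> (real^'n \<Rightarrow> real) \<Rightarrow> real^'n \<Rightarrow> real" where
  "todd_trunc M e w g x = (\<Sum>a<M. todd1 a * e ^ a * (dird w ^^ a) g x)"

text \<open>This is \<tau>(s)(1 - exp(-s)) = s with s = e D: after Taylor expansion of the shifted
  terms the coefficient of each D^m g with m different from 1 cancels by
  \<open>todd1_recurrence\<close>.\<close>

lemma bdiff_todd_trunc:
  assumes "test_function g" "M \<ge> 1"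
  obtains C where "C \<ge> 0"
    "\<And>e x. 0 < e \<Longrightarrow> \<bar>bdiff e w (todd_trunc M e w g) x - e * dird w g x\<bar> \<le> C * e ^ (M + 1)"
proof -
  let ?D = "\<lambda>a. (dird w ^^ a) g"
  obtain B where B: "B \<ge> 0" "\<And>x. \<bar>?D (M + 1) x\<bar> \<le> B"
    using test_function_bounded[OF test_function_dird_funpow[OF assms(1)]] by blast
  define C where "C = (\<Sum>a<M. \<bar>todd1 a\<bar>) * B"
  have "\<bar>bdiff e w (todd_trunc M e w g) x - e * dird w g x\<bar> \<le> C * e ^ (M + 1)" if "0 < e" for e x
  proof -
    \<comment> \<open>The expansion of D^a g stops at total order \<open>M\<close>, so all
      remainders involve the same derivative D^(M+1) g, and multiplied by e^a they are all of size
      e^(M+1).\<close>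
    define R where "R a = ?D a (x - e *\<^sub>R w) -
      (\<Sum>b<M + 1 - a. (- e) ^ b / fact b * ?D (a + b) x)" for a
    have R: "\<bar>R a\<bar> \<le> B * e ^ (M + 1 - a)" if "a < M" for a
    proof -
      have eq: "(dird w ^^ b) (?D a) = ?D (a + b)" for b
        by (simp add: funpow_add[symmetric] add.commute flip: comp_apply[of "dird w ^^ b"])
      show ?thesis
        using taylor_line[OF test_function_dird_funpow[OF assms(1), where a = a and w = w], where w = w and K = "M + 1 - a" and B = B and x = x and e = e]
          B(2) \<open>0 < e\<close> that unfolding eq R_def by simp
    qed
    have expand: "?D a x - ?D a (x - e *\<^sub>R w) =
        - (\<Sum>m\<in>{a<..M}. (- e) ^ (m - a) / fact (m - a) * ?D m x) - R a" if "a < M" for a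
    proof -
      have "(\<Sum>b<M + 1 - a. (- e) ^ b / fact b * ?D (a + b) x)
         = (\<Sum>m\<in>{a..M}. (- e) ^ (m - a) / fact (m - a) * ?D m x)"
        using that by (intro sum.reindex_bij_witness[of _ "\<lambda>m. m - a" "\<lambda>b. a + b"]) auto
      moreover have "{a..M} = insert a {a<..M}" using that by auto
      ultimately show ?thesis by (simp add: R_def)
    qed
    have "bdiff e w (todd_trunc M e w g) x = (\<Sum>a<M. todd1 a * e ^ a * (?D a x - ?D a (x - e *\<^sub>R w)))"
      by (simp add: bdiff_def todd_trunc_def right_diff_distrib sum_subtractf)
    also have "\<dots> = - (\<Sum>a<M. \<Sum>m\<in>{a<..M}. todd1 a * e ^ a * ((- e) ^ (m - a) / fact (m - a) * ?D m x))
        - (\<Sum>a<M. todd1 a * e ^ a * R a)"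
      by (simp add: expand right_diff_distrib sum_subtractf sum_distrib_left sum_negf)
    \<comment> \<open>Interchanging the sums collects the terms by the total order \<open>m\<close>
      of the derivative, and the inner sum becomes the one in the Todd recurrence.\<close>
    also have "(\<Sum>a<M. \<Sum>m\<in>{a<..M}. todd1 a * e ^ a * ((- e) ^ (m - a) / fact (m - a) * ?D m x))
        = (\<Sum>m\<in>{..M}. \<Sum>a<m. todd1 a * e ^ a * ((- e) ^ (m - a) / fact (m - a) * ?D m x))"
      unfolding sum.Sigma[OF finite_lessThan ballI[OF finite_greaterThanAtMost]]
        sum.Sigma[OF finite_atMost ballI[OF finite_lessThan]]
      by (intro sum.reindex_bij_witness[of _ "\<lambda>(m, a). (a, m)" "\<lambda>(a, m). (m, a)"]) auto
    also have "\<dots> = (\<Sum>m\<in>{..M}. e ^ m * ?D m x *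
         (\<Sum>a<m. todd1 a * ((- 1) ^ (m - a) / fact (m - a))))"
    proof (intro sum.cong refl)
      fix m assume "m \<in> {..M}"
      have "e ^ a * (- e) ^ (m - a) = e ^ m * (- 1) ^ (m - a)" if "a < m" for a
        using that by (subst power_minus) (simp add: power_add[symmetric] mult.commute mult.left_commute)
      then show "(\<Sum>a<m. todd1 a * e ^ a * ((- e) ^ (m - a) / fact (m - a) * ?D m x)) =
          e ^ m * ?D m x * (\<Sum>a<m. todd1 a * ((- 1) ^ (m - a) / fact (m - a)))"
        unfolding sum_distrib_left by (intro sum.cong) (auto simp: field_simps)
    qed
    \<comment> \<open>Only m = 1 survives; \<open>M \<ge> 1\<close> puts it in the range of
      summation.\<close>
    also have "\<dots> = - (e * dird w g x)"
      unfolding todd1_recurrence using assms(2)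
      by (simp add: if_distrib sum.delta cong: if_cong)
    finally have "\<bar>bdiff e w (todd_trunc M e w g) x - e * dird w g x\<bar> = \<bar>\<Sum>a<M. todd1 a * e ^ a * R a\<bar>"
      by simp
    also have "\<dots> \<le> (\<Sum>a<M. \<bar>todd1 a\<bar> * (B * e ^ (M + 1)))"
    proof (rule order_trans[OF sum_abs sum_mono])
      fix a assume "a \<in> {..<M}"
      then have "e ^ a * \<bar>R a\<bar> \<le> e ^ a * (B * e ^ (M + 1 - a))"
        using R \<open>0 < e\<close> by (intro mult_left_mono) auto
      also have "\<dots> = B * e ^ (M + 1)"
        using \<open>a \<in> {..<M}\<close> by (simp add: power_add[symmetric] mult.left_commute)
      finally have "\<bar>todd1 a\<bar> * (e ^ a * \<bar>R a\<bar>) \<le> \<bar>todd1 a\<bar> * (B * e ^ (M + 1))"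
        by (rule mult_left_mono) simp
      then show "\<bar>todd1 a * e ^ a * R a\<bar> \<le> \<bar>todd1 a\<bar> * (B * e ^ (M + 1))"
        using \<open>0 < e\<close> by (simp add: abs_mult mult.assoc)
    qed
    also have "\<dots> = C * e ^ (M + 1)"
      by (simp add: C_def sum_distrib_right mult.assoc)
    finally show ?thesis .
  qed
  moreover have "C \<ge> 0"
    using B(1) by (auto simp: C_def intro!: mult_nonneg_nonneg sum_nonneg)
  ultimately show ?thesis using that by blast
qed

section \<open>Iterated difference and Todd operators\<close>

lemma dird_diff:
  "f differentiable (at x) \<Longrightarrow> g differentiable (at x) \<Longrightarrow>
     dird w (\<lambda>x. f x - g x) x = dird w f x - dird w g x"
  by (intro dird_eq[THEN trans]) (auto intro!: has_derivative_diff has_derivative_dird)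

lemma dird_lincomb:
  assumes "\<And>i. i \<in> I \<Longrightarrow> f i differentiable (at x)"
  shows "dird w (\<lambda>x. \<Sum>i\<in>I. c i * f i x) x = (\<Sum>i\<in>I. c i * dird w (f i) x)"
proof -
  have "((\<lambda>x. \<Sum>i\<in>I. c i * f i x) has_derivative (\<lambda>w. \<Sum>i\<in>I. c i * dird w (f i) x)) (at x)"
    by (intro has_derivative_sum has_derivative_mult_right has_derivative_dird assms)
  then show ?thesis by (rule dird_eq)
qed

text \<open>Models operators with constant coefficients: they preserve test functions and commute
  with every directional derivative. Linearity is not part of the notion; where it is used, it comes
  from the explicit formulas.\<close>

definition dop :: "((real^'n \<Rightarrow> real) \<Rightarrow> real^'n \<Rightarrow> real) \<Rightarrow> bool" where
  "dop P \<longleftrightarrow> (\<forall>g. test_function g \<longrightarrow> test_function (P g) \<and> (\<forall>v. dird v (P g) = P (dird v g)))"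

lemma dop_test: "dop P \<Longrightarrow> test_function g \<Longrightarrow> test_function (P g)"
  by (simp add: dop_def)

lemma dop_commute: "dop P \<Longrightarrow> test_function g \<Longrightarrow> dird v (P g) = P (dird v g)"
  by (simp add: dop_def)

lemma dop_commute_funpow: "dop P \<Longrightarrow> test_function g \<Longrightarrow> (dird v ^^ a) (P g) = P ((dird v ^^ a) g)"
  by (induction a) (simp_all add: dop_commute test_function_dird_funpow)

lemma dop_foldr:
  assumes "\<And>i. i \<in> set js \<Longrightarrow> dop (F i)"
  shows "dop (foldr F js)"
  using assms by (induction js) (simp_all add: dop_def)

lemma dop_dird: "dop (dird w)"
  by (simp add: dop_def test_function_dird dird_commute[OF test_function_smooth])

lemma dop_bdiff: "dop (bdiff e w)"
proof -
  have eq: "bdiff e w g = (\<lambda>x. g x - g (x - e *\<^sub>R w))" for g :: "real^'a \<Rightarrow> real"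
    by (simp add: fun_eq_iff bdiff_def)
  have "dird v (\<lambda>x. g x - g (x - e *\<^sub>R w)) x = dird v g x - dird v (\<lambda>x. g (x - e *\<^sub>R w)) x"
    if "test_function g" for g :: "real^'a \<Rightarrow> real" and v x
    using that by (intro dird_diff test_function_differentiable test_function_translate)
  then show ?thesis
    unfolding dop_def eq
    by (auto simp: dird_translate fun_eq_iff intro!: test_function_diff test_function_translate)
qed

lemma dop_todd_trunc: "dop (todd_trunc M e w)"
proof -
  have eq: "todd_trunc M e w g = (\<lambda>x. \<Sum>a<M. todd1 a * e ^ a * (dird w ^^ a) g x)"
    for g :: "real^'a \<Rightarrow> real"
    by (simp add: fun_eq_iff todd_trunc_def)
  have 1: "dird v (todd_trunc M e w g) = todd_trunc M e w (dird v g)"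
    if "test_function g" for g :: "real^'a \<Rightarrow> real" and v
  proof
    fix x
    have "dird v (todd_trunc M e w g) x = (\<Sum>a<M. todd1 a * e ^ a * dird v ((dird w ^^ a) g) x)"
      unfolding eq using that
      by (intro dird_lincomb test_function_differentiable test_function_dird_funpow)
    also have "\<dots> = (\<Sum>a<M. todd1 a * e ^ a * (dird w ^^ a) (dird v g) x)"
      using dop_commute_funpow[OF dop_dird that] by simp
    finally show "dird v (todd_trunc M e w g) x = todd_trunc M e w (dird v g) x"
      by (simp add: eq)
  qed
  have "test_function (todd_trunc M e w g)" if "test_function g" for g :: "real^'a \<Rightarrow> real"
    unfolding eq using that by (intro test_function_sum test_function_cmult test_function_dird_funpow)
  with 1 show ?thesis by (simp add: dop_def)
qed

text \<open>Taylor's formula with a single term; its role is to gain one power of \<open>e\<close>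
  from a bound on the derivative.\<close>

lemma bdiff_bound:
  assumes "test_function g" "\<And>x. \<bar>dird w g x\<bar> \<le> B" "e \<ge> 0"
  shows "\<bar>bdiff e w g x\<bar> \<le> e * B"
  using taylor_line[OF assms(1), of 1 w B x e] assms
  by (simp add: bdiff_def abs_minus_commute mult.commute)

text \<open>By \<open>bdiff_todd_trunc\<close> an approximation of e D, accurate up to order
  e^(M+1).\<close>

definition todd_diff :: "nat \<Rightarrow> real \<Rightarrow> real^'n \<Rightarrow> (real^'n \<Rightarrow> real) \<Rightarrow> real^'n \<Rightarrow> real" where
  "todd_diff M e w g = bdiff e w (todd_trunc M e w g)"

lemma todd_diff_eq: "todd_diff M e w g x = (\<Sum>a<M. todd1 a * e ^ a * bdiff e w ((dird w ^^ a) g) x)"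
  by (simp add: todd_diff_def bdiff_def todd_trunc_def right_diff_distrib sum_subtractf)

lemma dop_todd_diff: "dop (todd_diff M e w)"
  using dop_bdiff[of e w] dop_todd_trunc[of M e w] by (simp add: dop_def todd_diff_def)

text \<open>Induction on the directions. The outermost operator acts on the error of the inner ones
  as a combination of differences, each of which gains a factor \<open>e\<close>; on the main term
  it is e D up to e^(M+1). The constant depends on \<open>g\<close> and the directions, but not on
  \<open>e\<close> or the point.\<close>

lemma foldr_todd_diff:
  assumes "test_function g" "M \<ge> 1"
  shows "\<exists>C\<ge>0. \<forall>e x. 0 < e \<longrightarrow> e \<le> 1 \<longrightarrow>
    \<bar>foldr (\<lambda>i. todd_diff M e (w i)) js g x - e ^ length js * foldr (\<lambda>i. dird (w i)) js g x\<bar>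
      \<le> C * e ^ (length js + M)"
  using assms(1)
proof (induction js arbitrary: g)
  case Nil
  then show ?case by (auto intro!: exI[of _ 0])
next
  case (Cons i js)
  let ?P = "\<lambda>e. foldr (\<lambda>i. todd_diff M e (w i)) js" and ?Q = "foldr (\<lambda>i. dird (w i)) js"
  let ?k = "length js" and ?D = "\<lambda>a. (dird (w i) ^^ a) g"
  have P: "dop (?P e)" for e by (intro dop_foldr dop_todd_diff)
  have Q: "dop ?Q" by (intro dop_foldr dop_dird)
  have D: "test_function (?D a)" for a using Cons.prems by (rule test_function_dird_funpow)
  \<comment> \<open>Gaining a factor \<open>e\<close> from a difference requires a bound on the
    derivative of the error. As all operators commute with derivatives, this is the induction
    hypothesis for one derivative more, hence \<open>Suc a\<close>.\<close>
  have "\<forall>a. \<exists>C\<ge>0. \<forall>e x. 0 < e \<longrightarrow> e \<le> 1 \<longrightarrow>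
      \<bar>?P e (?D (Suc a)) x - e ^ ?k * ?Q (?D (Suc a)) x\<bar> \<le> C * e ^ (?k + M)"
    using Cons.IH[OF D] by blast
  then obtain Ca where Ca: "\<And>a. Ca a \<ge> 0" "\<And>a e x. 0 < e \<Longrightarrow> e \<le> 1 \<Longrightarrow>
      \<bar>?P e (?D (Suc a)) x - e ^ ?k * ?Q (?D (Suc a)) x\<bar> \<le> Ca a * e ^ (?k + M)"
    by metis
  obtain C' where C': "C' \<ge> 0" "\<And>e x. 0 < e \<Longrightarrow>
      \<bar>todd_diff M e (w i) (?Q g) x - e * dird (w i) (?Q g) x\<bar> \<le> C' * e ^ (M + 1)"
    using bdiff_todd_trunc[OF dop_test[OF Q Cons.prems] assms(2), of "w i"]
    unfolding todd_diff_def by blast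
  define C where "C = (\<Sum>a<M. \<bar>todd1 a\<bar> * Ca a) + C'"
  have "\<bar>foldr (\<lambda>i. todd_diff M e (w i)) (i # js) g x -
         e ^ length (i # js) * foldr (\<lambda>i. dird (w i)) (i # js) g x\<bar> \<le> C * e ^ (length (i # js) + M)"
    if e: "0 < e" "e \<le> 1" for e x
  proof -
    define r where "r a x = ?P e (?D a) x - e ^ ?k * ?Q (?D a) x" for a x
    have r: "\<bar>bdiff e (w i) (r a) x\<bar> \<le> e * (Ca a * e ^ (?k + M))" for a
    proof (rule bdiff_bound)
      have tests: "test_function (?P e (?D a))" "test_function (?Q (?D a))"
        by (intro dop_test[OF P] dop_test[OF Q] D)+
      then show "test_function (r a)"
        unfolding r_def by (intro test_function_diff test_function_cmult)
      show "\<bar>dird (w i) (r a) y\<bar> \<le> Ca a * e ^ (?k + M)" for y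
      proof -
        have "dird (w i) (r a) y = dird (w i) (?P e (?D a)) y - e ^ ?k * dird (w i) (?Q (?D a)) y"
          unfolding r_def using tests
          by (simp add: dird_diff dird_cmult test_function_differentiable test_function_cmult)
        then show ?thesis
          using Ca(2)[OF e, of a y] by (simp add: dop_commute[OF P D] dop_commute[OF Q D])
      qed
    qed (use e in simp)
    have "todd_diff M e (w i) (?P e g) x - e ^ ?k * todd_diff M e (w i) (?Q g) x =
        (\<Sum>a<M. todd1 a * e ^ a * bdiff e (w i) (r a) x)"
      unfolding todd_diff_eq[of M e "w i" "?P e g"] todd_diff_eq[of M e "w i" "?Q g"]
        dop_commute_funpow[OF P Cons.prems] dop_commute_funpow[OF Q Cons.prems]
        sum_distrib_left sum_subtractf[symmetric]
      by (intro sum.cong) (auto simp: bdiff_def r_def algebra_simps)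
    \<comment> \<open>Here \<open>e \<le> 1\<close> absorbs the powers e^a of the Todd
      operator.\<close>
    also have "\<bar>\<dots>\<bar> \<le> (\<Sum>a<M. \<bar>todd1 a\<bar> * Ca a * e ^ (?k + M + 1))"
    proof (rule order_trans[OF sum_abs sum_mono])
      fix a
      have "e ^ a * \<bar>bdiff e (w i) (r a) x\<bar> \<le> 1 * (e * (Ca a * e ^ (?k + M)))"
        using e r by (intro mult_mono) (auto simp: power_le_one)
      then have "\<bar>todd1 a\<bar> * (e ^ a * \<bar>bdiff e (w i) (r a) x\<bar>) \<le> \<bar>todd1 a\<bar> * (1 * (e * (Ca a * e ^ (?k + M))))"
        by (rule mult_left_mono) simp
      then show "\<bar>todd1 a * e ^ a * bdiff e (w i) (r a) x\<bar> \<le> \<bar>todd1 a\<bar> * Ca a * e ^ (?k + M + 1)"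
        using e by (simp add: abs_mult mult_ac)
    qed
    also have "\<dots> = (\<Sum>a<M. \<bar>todd1 a\<bar> * Ca a) * e ^ (?k + M + 1)"
      by (simp add: sum_distrib_right)
    finally have 1: "\<bar>todd_diff M e (w i) (?P e g) x - e ^ ?k * todd_diff M e (w i) (?Q g) x\<bar>
       \<le> (\<Sum>a<M. \<bar>todd1 a\<bar> * Ca a) * e ^ (?k + M + 1)" .
    have 2: "e ^ ?k * \<bar>todd_diff M e (w i) (?Q g) x - e * dird (w i) (?Q g) x\<bar> \<le> e ^ ?k * (C' * e ^ (M + 1))"
      using C'(2)[OF e(1)] e by (intro mult_left_mono) auto
    have 3: "e ^ ?k * \<bar>a - e * b\<bar> = \<bar>e ^ ?k * a - e ^ ?k * e * b\<bar>" for a b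
    proof -
      have "e ^ ?k * a - e ^ ?k * e * b = e ^ ?k * (a - e * b)" by (simp add: algebra_simps)
      with e show ?thesis by (simp add: abs_mult)
    qed
    have 4: "e ^ ?k * (C' * e ^ (M + 1)) = C' * e ^ (?k + M + 1)"
      by (simp add: power_add)
    from 2 have 5: "\<bar>e ^ ?k * todd_diff M e (w i) (?Q g) x - e ^ ?k * e * dird (w i) (?Q g) x\<bar>
        \<le> C' * e ^ (?k + M + 1)"
      unfolding 3 4 .
    have "\<bar>todd_diff M e (w i) (?P e g) x - e ^ ?k * e * dird (w i) (?Q g) x\<bar> \<le> C * e ^ (?k + M + 1)"
      unfolding C_def distrib_right using 1 5 by linarith
    then show ?thesis by (simp add: mult_ac)
  qed
  moreover have "C \<ge> 0"
    using C'(1) Ca(1) by (auto simp: C_def intro!: add_nonneg_nonneg sum_nonneg mult_nonneg_nonneg)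
  ultimately show ?case by blast
qed

lemma todd_trunc_bdiff:
  assumes "test_function g"
  shows "todd_trunc M e w (bdiff e' w' g) = bdiff e' w' (todd_trunc M e w g)"
  by (simp add: fun_eq_iff todd_trunc_def dop_commute_funpow[OF dop_bdiff assms])
    (simp add: bdiff_def todd_trunc_def right_diff_distrib sum_subtractf)

text \<open>The error estimate treats one direction at a time, with Todd operator and difference
  paired; integration over a cone needs all differences outermost, where they turn the cone into a
  cell.\<close>

lemma foldr_todd_diff_split:
  assumes "test_function g"
  shows "foldr (\<lambda>i. todd_diff M e (w i)) js g =
    foldr (\<lambda>i. bdiff e (w i)) js (foldr (\<lambda>i. todd_trunc M e (w i)) js g)"
proof (induction js)
  case (Cons i js)
  have comm: "todd_trunc M e v (foldr (\<lambda>i. bdiff e (w i)) is h) =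
      foldr (\<lambda>i. bdiff e (w i)) is (todd_trunc M e v h)" if "test_function h" for v h "is"
    using that
  proof (induction "is")
    case (Cons j "is")
    have "test_function (foldr (\<lambda>i. bdiff e (w i)) is h)"
      using Cons.prems by (intro dop_test[OF dop_foldr] dop_bdiff)
    with Cons show ?case by (simp add: todd_trunc_bdiff)
  qed simp
  have "test_function (foldr (\<lambda>i. todd_trunc M e (w i)) js g)"
    using assms by (intro dop_test[OF dop_foldr] dop_todd_trunc)
  then show ?case
    unfolding foldr.simps o_apply Cons by (simp add: todd_diff_def comm)
qed simp

text \<open>Derivatives do not enlarge the support and a difference moves it by at most e |w i|.
  With \<open>e \<le> 1\<close> the resulting radius does not depend on \<open>e\<close>.\<close>

lemma foldr_todd_diff_support:
  assumes "\<And>x. norm x > R \<Longrightarrow> g x = 0" "0 < e" "e \<le> 1"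
    and "norm x > R + (\<Sum>i\<leftarrow>js. norm (w i))"
  shows "foldr (\<lambda>i. todd_diff M e (w i)) js g x = 0"
  using assms(4)
proof (induction js arbitrary: x)
  case Nil
  then show ?case using assms(1) by simp
next
  case (Cons i js)
  let ?G = "foldr (\<lambda>i. todd_diff M e (w i)) js g" and ?R = "R + (\<Sum>i\<leftarrow>js. norm (w i))"
  have D: "(dird (w i) ^^ a) ?G y = 0" if "norm y > ?R" for a y
    using that
  proof (induction a arbitrary: y)
    case 0
    then show ?case using Cons.IH by simp
  next
    case (Suc a)
    then show ?case using dird_eq_0_outside[of ?R "(dird (w i) ^^ a) ?G" y "w i"] by simp
  qed
  have "e * norm (w i) \<le> norm (w i)"
    using assms(2,3) by (intro mult_left_le_one_le) auto
  moreover have "norm x - e * norm (w i) \<le> norm (x - e *\<^sub>R w i)"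
    using norm_triangle_ineq2[of x "e *\<^sub>R w i"] assms(2) by simp
  moreover have "norm x > ?R + norm (w i)" using Cons.prems by simp
  ultimately have "norm (x - e *\<^sub>R w i) > ?R" "norm x > ?R"
    using norm_ge_zero[of "w i"] by linarith+
  then show ?case
    unfolding foldr.simps o_apply todd_diff_eq[of M e "w i" ?G] by (simp add: bdiff_def D)
qed

lemma dird_eq_0_outside_foldr:
  assumes "\<And>x. norm x > R \<Longrightarrow> g x = 0" "norm x > R"
  shows "foldr (\<lambda>i. dird (w i)) js g x = 0"
  using assms(2)
proof (induction js arbitrary: x)
  case Nil
  then show ?case by (simp add: assms(1))
next
  case (Cons i js)
  from dird_eq_0_outside[OF Cons.IH Cons.prems] show ?case by simp
qed

section \<open>Uniform bounds for test functions\<close>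

lemma test_function_dird_bound:
  assumes "test_function g"
  obtains K where "K \<ge> 0" "\<And>w x. \<bar>dird w g x\<bar> \<le> K * norm w"
proof -
  have "\<exists>B. B \<ge> 0 \<and> (\<forall>x. \<bar>partial_diff k g x\<bar> \<le> B)" for k
    using test_function_bounded[OF test_function_dird[OF assms]]
    unfolding partial_diff_eq_dird by metis
  then obtain B where B: "\<And>k. B k \<ge> 0" "\<And>k x. \<bar>partial_diff k g x\<bar> \<le> B k" by metis
  have "\<bar>dird w g x\<bar> \<le> (\<Sum>k\<in>UNIV. B k) * norm w" for w x
  proof -
    have "\<bar>dird w g x\<bar> \<le> (\<Sum>k\<in>UNIV. \<bar>w $ k * partial_diff k g x\<bar>)"
      by (simp add: dird_partial_diff test_function_differentiable[OF assms] sum_abs)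
    also have "\<dots> \<le> (\<Sum>k\<in>UNIV. B k * norm w)"
      using B component_le_norm_cart[of w]
      by (intro sum_mono) (auto simp: abs_mult mult.commute[of "B _"] intro!: mult_mono)
    finally show ?thesis by (simp add: sum_distrib_right)
  qed
  moreover have "(\<Sum>k\<in>UNIV. B k) \<ge> 0" using B(1) by (simp add: sum_nonneg)
  ultimately show ?thesis using that by blast
qed

lemma test_function_lipschitz:
  assumes "test_function g"
  obtains K where "K \<ge> 0" "\<And>x y. \<bar>g x - g y\<bar> \<le> K * norm (x - y)"
proof -
  obtain K where K: "K \<ge> 0" "\<And>w x. \<bar>dird w g x\<bar> \<le> K * norm w"
    using test_function_dird_bound[OF assms] by blast
  have "\<bar>g x - g y\<bar> \<le> K * norm (x - y)" for x y
    using bdiff_bound[OF assms K(2)[of "x - y"], of 1 x] by (simp add: bdiff_def)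
  with K(1) show ?thesis using that by blast
qed

section \<open>Fundamental domains\<close>

lemma inner_int_lattice:
  fixes a b :: "real^'n"
  assumes "a \<in> int_lattice" "b \<in> int_lattice"
  shows "a \<bullet> b \<in> \<int>"
  using assms by (auto simp: int_lattice_def inner_vec_def intro!: Ints_sum Ints_mult)

lemma int_lattice_sum:
  fixes w :: "'d \<Rightarrow> real^'n"
  assumes "\<And>j. j \<in> J \<Longrightarrow> r j \<in> \<int>" "\<And>j. j \<in> J \<Longrightarrow> w j \<in> int_lattice"
  shows "(\<Sum>j\<in>J. r j *\<^sub>R w j) \<in> int_lattice"
  using assms by (auto simp: int_lattice_def intro!: Ints_sum Ints_mult)

lemma int_lattice_minus: "x \<in> int_lattice \<Longrightarrow> - x \<in> int_lattice"
  by (simp add: int_lattice_def)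

lemma countable_int_lattice: "countable (int_lattice :: (real^'n) set)"
proof -
  have "int_lattice \<subseteq> range (\<lambda>f :: 'n \<Rightarrow> int. \<chi> i. (of_int (f i) :: real))"
  proof
    fix x :: "real^'n" assume "x \<in> int_lattice"
    then have "x = (\<chi> i. of_int \<lfloor>x $ i\<rfloor>)"
      by (simp add: int_lattice_def vec_eq_iff)
    then show "x \<in> range (\<lambda>f :: 'n \<Rightarrow> int. \<chi> i. (of_int (f i) :: real))"
      by (rule range_eqI[where x = "\<lambda>i. \<lfloor>x $ i\<rfloor>"])
  qed
  then show ?thesis by (rule countable_subset) simp
qed

lemma emeasure_lborel_translate:
  fixes A :: "'a::euclidean_space set"
  assumes "A \<in> sets borel"
  shows "emeasure lborel {x. x + a \<in> A} = emeasure lborel A"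
proof -
  have "emeasure lborel A = emeasure (distr lborel borel ((+) a)) A"
    by (simp add: lborel_distr_plus)
  also have "\<dots> = emeasure lborel ((+) a -` A \<inter> space lborel)"
    using assms by (intro emeasure_distr) auto
  also have "(+) a -` A \<inter> space lborel = {x. x + a \<in> A}"
    by (auto simp: add.commute)
  finally show ?thesis by simp
qed

text \<open>Used instead of a determinant to see that unimodular cells have the volume of a cube.\<close>

lemma emeasure_fundamental_domains:
  fixes A B :: "'a::euclidean_space set"
  assumes "countable L" "\<And>k. k \<in> L \<Longrightarrow> - k \<in> L"
    and [measurable]: "A \<in> sets borel" "B \<in> sets borel"
    and A: "\<And>x. \<exists>!k. k \<in> L \<and> x + k \<in> A" and B: "\<And>x. \<exists>!k. k \<in> L \<and> x + k \<in> B"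
  shows "emeasure lborel A = emeasure lborel B"
proof -
  \<comment> \<open>\<open>B\<close> being a fundamental domain, each point of \<open>A\<close> is
    moved into \<open>B\<close> by exactly one lattice vector, which sorts \<open>A\<close> into
    countably many disjoint pieces.\<close>
  have split: "emeasure lborel A = (\<integral>\<^sup>+k. emeasure lborel (A \<inter> {x. x + k \<in> B}) \<partial>count_space L)"
    if B: "\<And>x. \<exists>!k. k \<in> L \<and> x + k \<in> B" and [measurable]: "A \<in> sets borel" "B \<in> sets borel"
    for A B :: "'a set"
  proof -
    have "A = (\<Union>k\<in>L. A \<inter> {x. x + k \<in> B})"
      using B by blast
    also have "emeasure lborel \<dots> = (\<integral>\<^sup>+k. emeasure lborel (A \<inter> {x. x + k \<in> B}) \<partial>count_space L)"
    proof (rule emeasure_UN_countable)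
      show "disjoint_family_on (\<lambda>k. A \<inter> {x. x + k \<in> B}) L"
        unfolding disjoint_family_on_def using B by blast
    qed (use assms(1) in auto)
    finally show ?thesis .
  qed
  \<comment> \<open>Translation by \<open>k\<close> carries the piece of \<open>A\<close> that lands
    in \<open>B\<close> onto the piece of \<open>B\<close> that came from \<open>A\<close>.\<close>
  have "emeasure lborel (A \<inter> {x. x + k \<in> B}) = emeasure lborel (B \<inter> {x. x + (- k) \<in> A})" for k
  proof -
    have "emeasure lborel (A \<inter> {x. x + k \<in> B}) = emeasure lborel {x. x + k \<in> B \<inter> {x. x + (- k) \<in> A}}"
      by (rule arg_cong[where f = "emeasure lborel"]) auto
    also have "\<dots> = emeasure lborel (B \<inter> {x. x + (- k) \<in> A})"
      by (rule emeasure_lborel_translate) measurable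
    finally show ?thesis .
  qed
  note swap = this
  have "emeasure lborel A = (\<integral>\<^sup>+k. emeasure lborel (A \<inter> {x. x + k \<in> B}) \<partial>count_space L)"
    by (rule split[OF B assms(3,4)])
  also have "\<dots> = (\<integral>\<^sup>+k. emeasure lborel (B \<inter> {x. x + (- k) \<in> A}) \<partial>count_space L)"
    by (simp only: swap)
  \<comment> \<open>Replacing \<open>k\<close> by its negative gives the decomposition of
    \<open>B\<close> along the translates of \<open>A\<close>.\<close>
  also have "\<dots> = (\<integral>\<^sup>+k. emeasure lborel (B \<inter> {x. x + k \<in> A}) \<partial>count_space L)"
  proof (rule nn_integral_bij_count_space[where g = uminus])
    show "bij_betw uminus L L"
      using assms(2) by (intro bij_betwI[of _ _ _ uminus]) auto
  qed
  also have "\<dots> = emeasure lborel B"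
    by (rule split[OF A assms(4,3), symmetric])
  finally show ?thesis .
qed

text \<open>The reference domain: half-open so that its translates tile exactly, and squeezed
  between an open and a closed box of known volume.\<close>

definition half_open_cube :: "real \<Rightarrow> (real^'n) set" where
  "half_open_cube e = {x. \<forall>i. 0 \<le> x $ i \<and> x $ i < e}"

lemma borel_half_open_cube [measurable]: "half_open_cube e \<in> sets borel"
proof -
  have "Measurable.pred borel (\<lambda>x::real^'n. \<forall>i. 0 \<le> x $ i \<and> x $ i < e)" by measurable
  then show ?thesis by (simp add: half_open_cube_def pred_def)
qed

lemma emeasure_half_open_cube:
  assumes "e > 0"
  shows "emeasure lborel (half_open_cube e :: (real^'n) set) = ennreal (e ^ CARD('n))"
proof (rule antisym)
  let ?u = "(\<chi> i. e) :: real^'n"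
  have u: "?u \<bullet> b = e" if "b \<in> Basis" for b
    using that by (auto simp: Basis_vec_def inner_axis)
  have vol: "(\<Prod>b\<in>Basis. (?u - 0) \<bullet> b) = e ^ CARD('n)"
    by (simp add: u)
  have "half_open_cube e \<subseteq> cbox 0 ?u"
    by (auto simp: half_open_cube_def mem_box_cart less_imp_le)
  then have "emeasure lborel (half_open_cube e :: (real^'n) set) \<le> emeasure lborel (cbox 0 ?u)"
    by (rule emeasure_mono) simp
  also have "\<dots> = ennreal (e ^ CARD('n))"
    using assms by (subst emeasure_lborel_cbox) (simp_all only: u vol inner_zero_left less_imp_le)
  finally show "emeasure lborel (half_open_cube e :: (real^'n) set) \<le> ennreal (e ^ CARD('n))" .
  have "ennreal (e ^ CARD('n)) = emeasure lborel (box 0 ?u)"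
    using assms by (subst emeasure_lborel_box) (simp_all only: u vol inner_zero_left less_imp_le)
  also have "\<dots> \<le> emeasure lborel (half_open_cube e :: (real^'n) set)"
    by (rule emeasure_mono) (auto simp: half_open_cube_def mem_box_cart less_imp_le)
  finally show "ennreal (e ^ CARD('n)) \<le> emeasure lborel (half_open_cube e :: (real^'n) set)" .
qed

lemma half_open_cube_fundamental:
  fixes x :: "real^'n"
  assumes "e > 0"
  shows "\<exists>!k. k \<in> (*\<^sub>R) e ` int_lattice \<and> x + k \<in> half_open_cube e"
proof -
  define z :: "real^'n" where "z = (\<chi> i. - of_int \<lfloor>x $ i / e\<rfloor>)"
  have "z \<in> int_lattice" by (simp add: z_def int_lattice_def)
  moreover have "x + e *\<^sub>R z \<in> half_open_cube e"
  proof -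
    have "0 \<le> x $ i - e * of_int \<lfloor>x $ i / e\<rfloor> \<and> x $ i - e * of_int \<lfloor>x $ i / e\<rfloor> < e" for i
    proof -
      have "of_int \<lfloor>x $ i / e\<rfloor> * e \<le> x $ i"
        by (simp only: pos_le_divide_eq[OF assms, symmetric] of_int_floor_le)
      moreover have "x $ i < (of_int \<lfloor>x $ i / e\<rfloor> + 1) * e"
        by (simp only: pos_divide_less_eq[OF assms, symmetric] floor_less_iff[symmetric]) linarith
      ultimately show ?thesis by (simp add: algebra_simps)
    qed
    then show ?thesis by (simp add: half_open_cube_def z_def)
  qed
  moreover have "y = z" if y: "y \<in> int_lattice" "x + e *\<^sub>R y \<in> half_open_cube e" for y
  proof -
    have "y $ i = z $ i" for i
    proof -
      obtain m where m: "y $ i = of_int m"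
        using y(1) by (auto simp: int_lattice_def elim: Ints_cases)
      have "0 \<le> x $ i + e * of_int m" "x $ i + e * of_int m < e"
        using y(2) unfolding half_open_cube_def by (auto simp flip: m)
      then have "of_int (- m) \<le> x $ i / e" "x $ i / e < of_int (- m) + 1"
        using assms by (auto simp: field_simps)
      then have "\<lfloor>x $ i / e\<rfloor> = - m" by (simp add: floor_eq_iff)
      then show ?thesis by (simp add: m z_def)
    qed
    then show ?thesis by (simp add: vec_eq_iff)
  qed
  ultimately show ?thesis by blast
qed

section \<open>Unimodular cones\<close>

lemma set_integral_translate:
  fixes f :: "'a::euclidean_space \<Rightarrow> real"
  assumes [measurable]: "f \<in> borel_measurable borel" "A \<in> sets borel"
  shows "set_lebesgue_integral lborel A (\<lambda>x. f (x - a)) = set_lebesgue_integral lborel {x. x + a \<in> A} f"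
proof -
  have "set_lebesgue_integral lborel A (\<lambda>x. f (x - a)) =
      (\<integral>x. indicator A x *\<^sub>R f (x - a) \<partial>distr lborel borel ((+) a))"
    by (simp add: set_lebesgue_integral_def lborel_distr_plus)
  also have "\<dots> = (\<integral>x. indicator A (a + x) *\<^sub>R f (a + x - a) \<partial>lborel)"
    by (rule integral_distr) measurable
  also have "\<dots> = set_lebesgue_integral lborel {x. x + a \<in> A} f"
    by (auto simp: set_lebesgue_integral_def indicator_def add.commute intro!: Bochner_Integration.integral_cong)
  finally show ?thesis .
qed

lemma set_integral_ball_bound:
  fixes h :: "'a::euclidean_space \<Rightarrow> real"
  assumes "set_integrable lborel A h" "\<And>x. \<bar>h x\<bar> \<le> B" "\<And>x. norm x > R \<Longrightarrow> h x = 0"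
  shows "\<bar>set_lebesgue_integral lborel A h\<bar> \<le> B * measure lborel (cball (0::'a) R)"
proof -
  have "B \<ge> 0" using assms(2) abs_ge_zero order_trans by blast
  have "\<bar>set_lebesgue_integral lborel A h\<bar> \<le> (\<integral>x. \<bar>indicator A x *\<^sub>R h x\<bar> \<partial>lborel)"
    unfolding set_lebesgue_integral_def using integral_norm_bound[of lborel "\<lambda>x. indicator A x *\<^sub>R h x"]
    by simp
  also have "\<dots> \<le> (\<integral>x. B * indicator (cball (0::'a) R) x \<partial>lborel)"
  proof (rule integral_mono)
    show "integrable lborel (\<lambda>x. \<bar>indicator A x *\<^sub>R h x\<bar>)"
      using assms(1) unfolding set_integrable_def by (rule integrable_abs)
    show "integrable lborel (\<lambda>x. B * indicator (cball (0::'a) R) x)"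
      by (intro integrable_mult_right integrable_real_indicator emeasure_bounded_finite) auto
    show "\<bar>indicator A x *\<^sub>R h x\<bar> \<le> B * indicator (cball 0 R) x" for x
      using assms(2)[of x] assms(3)[of x] \<open>B \<ge> 0\<close> by (auto simp: indicator_def not_le)
  qed
  also have "\<dots> = B * measure lborel (cball (0::'a) R)" by simp
  finally show ?thesis .
qed

text \<open>The situation at a vertex: \<open>J\<close> indexes the facets through it and
  \<open>w\<close> is the basis dual to their normals, both bases integral. Setting \<open>w\<close>
  to zero off \<open>J\<close> expresses that shifting a facet away from the vertex does not move
  the cone, and lets operators run over all indices.\<close>

locale dual_cone =
  fixes u w :: "'d::{finite,linorder} \<Rightarrow> real^'n" and J :: "'d set"
  assumes card_J: "card J = CARD('n)"
    and u_lattice: "j \<in> J \<Longrightarrow> u j \<in> int_lattice"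
    and w_lattice: "j \<in> J \<Longrightarrow> w j \<in> int_lattice"
    and dual: "i \<in> J \<Longrightarrow> j \<in> J \<Longrightarrow> u i \<bullet> w j = (if i = j then 1 else 0)"
    and expand: "(\<Sum>j\<in>J. (u j \<bullet> x) *\<^sub>R w j) = x"
    and w_outside: "j \<notin> J \<Longrightarrow> w j = 0"
begin

definition cone :: "('d \<Rightarrow> real) \<Rightarrow> (real^'n) set" where
  "cone b = {x. \<forall>j\<in>J. u j \<bullet> x \<le> b j}"

text \<open>The boundary kept is the one containing the corner \<open>vertex b\<close>; the opposite
  faces are left to the neighbouring cells.\<close>

definition cell :: "real \<Rightarrow> ('d \<Rightarrow> real) \<Rightarrow> (real^'n) set" where
  "cell e b = {x. \<forall>j\<in>J. b j - e < u j \<bullet> x \<and> u j \<bullet> x \<le> b j}"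

definition vertex :: "('d \<Rightarrow> real) \<Rightarrow> real^'n" where
  "vertex b = (\<Sum>j\<in>J. b j *\<^sub>R w j)"

text \<open>Listed in the order in which \<open>multi_diff\<close> runs through the indices, so that
  operators over \<open>J\<close> and over all indices can be compared term by term.\<close>

definition js :: "'d list" where
  "js = filter (\<lambda>j. j \<in> J) (sorted_list_of_set UNIV)"

lemma js: "set js = J" "distinct js" "length js = CARD('n)"
proof -
  show "set js = J" "distinct js" by (auto simp: js_def)
  then show "length js = CARD('n)" using distinct_card[of js] card_J by simp
qed

lemma borel_cone [measurable]: "cone b \<in> sets borel"
proof -
  have "Measurable.pred borel (\<lambda>x. \<forall>j\<in>J. u j \<bullet> x \<le> b j)" by measurable
  then show ?thesis by (simp add: cone_def pred_def)
qed

lemma borel_slab [measurable]: "{x. \<forall>j\<in>I. b j - e < u j \<bullet> x} \<in> sets borel"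
proof -
  have "Measurable.pred borel (\<lambda>x. \<forall>j\<in>I. b j - e < u j \<bullet> x)" by measurable
  then show ?thesis by (simp add: pred_def)
qed

lemma cell_eq: "cell e b = cone b \<inter> {x. \<forall>j\<in>J. b j - e < u j \<bullet> x}"
  by (auto simp: cell_def cone_def)

lemma borel_cell [measurable]: "cell e b \<in> sets borel"
  unfolding cell_eq by measurable

lemma u_vertex: "i \<in> J \<Longrightarrow> u i \<bullet> vertex b = b i"
  by (simp add: vertex_def inner_sum_right dual if_distrib cong: if_cong)

lemma vertex_inner: "vertex (\<lambda>j. u j \<bullet> x) = x"
  by (simp add: vertex_def expand)

lemma vertex_unique: "(\<And>j. j \<in> J \<Longrightarrow> u j \<bullet> x = b j) \<Longrightarrow> x = vertex b"
  by (subst vertex_inner[symmetric]) (simp add: vertex_def)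

text \<open>Unimodularity enters here: integral \<open>w\<close> makes the translation vector with
  prescribed integer pairings a lattice vector, and integral \<open>u\<close> makes the pairings of
  any competing lattice vector integers, hence equal to the floors.\<close>

lemma cell_fundamental:
  assumes "e > 0"
  shows "\<exists>!k. k \<in> (*\<^sub>R) e ` int_lattice \<and> x + k \<in> cell e b"
proof -
  define m where "m j = \<lfloor>(b j - u j \<bullet> x) / e\<rfloor>" for j
  define z where "z = vertex (\<lambda>j. of_int (m j))"
  have "z \<in> int_lattice"
    unfolding z_def vertex_def by (rule int_lattice_sum) (auto simp: w_lattice)
  moreover have "x + e *\<^sub>R z \<in> cell e b"
  proof -
    have "b j - e < u j \<bullet> x + e * of_int (m j) \<and> u j \<bullet> x + e * of_int (m j) \<le> b j" for j
    proof -
      have "of_int (m j) \<le> (b j - u j \<bullet> x) / e" "(b j - u j \<bullet> x) / e < of_int (m j) + 1"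
        unfolding m_def by linarith+
      with assms show ?thesis by (simp add: field_simps)
    qed
    then show ?thesis by (simp add: cell_def z_def u_vertex inner_add_right)
  qed
  moreover have "y = z" if y: "y \<in> int_lattice" "x + e *\<^sub>R y \<in> cell e b" for y
    unfolding z_def
  proof (rule vertex_unique)
    fix j assume j: "j \<in> J"
    obtain m' where m': "u j \<bullet> y = of_int m'"
      using inner_int_lattice[OF u_lattice[OF j] y(1)] by (auto elim: Ints_cases)
    have "b j - e < u j \<bullet> x + e * of_int m'" "u j \<bullet> x + e * of_int m' \<le> b j"
      using y(2) j by (auto simp: cell_def inner_add_right m')
    then have "of_int m' \<le> (b j - u j \<bullet> x) / e" "(b j - u j \<bullet> x) / e < of_int m' + 1"
      using assms by (auto simp: field_simps)
    then have "m j = m'" unfolding m_def by (simp add: floor_eq_iff)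
    then show "u j \<bullet> y = of_int (m j)" by (simp add: m')
  qed
  ultimately show ?thesis by blast
qed

text \<open>The cell and the cube of side \<open>e\<close> are fundamental domains of the same
  scaled lattice.\<close>

lemma emeasure_cell:
  assumes "e > 0"
  shows "emeasure lborel (cell e b) = ennreal (e ^ CARD('n))"
proof -
  have "emeasure lborel (cell e b) = emeasure lborel (half_open_cube e :: (real^'n) set)"
  proof (rule emeasure_fundamental_domains)
    show "countable ((*\<^sub>R) e ` int_lattice :: (real^'n) set)"
      by (intro countable_image countable_int_lattice)
    show "- k \<in> (*\<^sub>R) e ` int_lattice" if "k \<in> (*\<^sub>R) e ` int_lattice" for k :: "real^'n"
      using that int_lattice_minus by (force simp: image_iff)
    show "\<exists>!k. k \<in> (*\<^sub>R) e ` int_lattice \<and> x + k \<in> cell e b" for x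
      by (rule cell_fundamental[OF assms])
    show "\<exists>!k. k \<in> (*\<^sub>R) e ` int_lattice \<and> x + k \<in> half_open_cube e" for x :: "real^'n"
      by (rule half_open_cube_fundamental[OF assms])
  qed measurable
  then show ?thesis by (simp add: emeasure_half_open_cube[OF assms])
qed

lemma measure_cell: "e > 0 \<Longrightarrow> measure lborel (cell e b) = e ^ CARD('n)"
  by (simp add: measure_def emeasure_cell)

text \<open>A difference along \<open>w i\<close> subtracts the integral over the cone with its
  \<open>i\<close>-th bound lowered by \<open>e\<close>, leaving a slab of thickness
  \<open>e\<close>. The bounds \<open>b\<close> stay arbitrary in the induction because its
  hypothesis is used for both cones.\<close>

lemma integral_bdiff_foldr:
  assumes "test_function g" "distinct is" "set is \<subseteq> J" "e > 0"
  shows "(LINT x:cone b|lborel. foldr (\<lambda>i. bdiff e (w i)) is g x) =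
    (LINT x:cone b \<inter> {x. \<forall>i\<in>set is. b i - e < u i \<bullet> x}|lborel. g x)"
  using assms(2,3)
proof (induction "is" arbitrary: b)
  case Nil
  then show ?case by simp
next
  case (Cons i "is")
  let ?G = "foldr (\<lambda>i. bdiff e (w i)) is g" and ?b' = "b(i := b i - e)"
  let ?S = "{x. \<forall>i\<in>set is. b i - e < u i \<bullet> x}"
  have i: "i \<in> J" "i \<notin> set is" using Cons.prems by auto
  have G: "test_function ?G"
    using assms(1) by (intro dop_test[OF dop_foldr] dop_bdiff)
  have [measurable]: "?G \<in> borel_measurable borel"
    using test_function_integrable[OF G] by (simp add: borel_measurable_integrable measurable_lborel1)
  have "(LINT x:cone b|lborel. foldr (\<lambda>i. bdiff e (w i)) (i # is) g x) =
     (LINT x:cone b|lborel. ?G x) - (LINT x:cone b|lborel. ?G (x - e *\<^sub>R w i))"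
    using G by (simp add: bdiff_def set_integral_diff test_function_set_integrable test_function_translate)
  also have "(LINT x:cone b|lborel. ?G (x - e *\<^sub>R w i)) = (LINT x:{x. x + e *\<^sub>R w i \<in> cone b}|lborel. ?G x)"
    by (rule set_integral_translate) measurable
  \<comment> \<open>By duality, translation along \<open>w i\<close> changes the pairing with
    \<open>u i\<close> only, so a single bound moves.\<close>
  also have "{x. x + e *\<^sub>R w i \<in> cone b} = cone ?b'"
    using i(1) by (auto simp: cone_def inner_add_right dual split: if_splits)
  also have "(LINT x:cone ?b'|lborel. ?G x) =
      (LINT x:cone ?b' \<inter> {x. \<forall>i\<in>set is. ?b' i - e < u i \<bullet> x}|lborel. g x)"
    using Cons.prems by (intro Cons.IH) auto
  also have "{x. \<forall>i\<in>set is. ?b' i - e < u i \<bullet> x} = ?S"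
    using i(2) by auto
  also have "(LINT x:cone b|lborel. ?G x) = (LINT x:cone b \<inter> ?S|lborel. g x)"
    using Cons.prems by (intro Cons.IH) auto
  also have "cone b \<inter> ?S = (cone b \<inter> {x. \<forall>i\<in>set (i # is). b i - e < u i \<bullet> x}) \<union> (cone ?b' \<inter> ?S)"
    using i(1) assms(4) by (auto simp: cone_def split: if_splits)
  also have "(LINT x:\<dots>|lborel. g x) =
      (LINT x:cone b \<inter> {x. \<forall>i\<in>set (i # is). b i - e < u i \<bullet> x}|lborel. g x) + (LINT x:cone ?b' \<inter> ?S|lborel. g x)"
  proof (rule set_integral_Un)
    show "(cone b \<inter> {x. \<forall>i\<in>set (i # is). b i - e < u i \<bullet> x}) \<inter> (cone ?b' \<inter> ?S) = {}"
      using i(1) by (auto simp: cone_def)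
  qed (intro test_function_set_integrable assms(1); measurable)+
  finally show ?case by (simp only: add_diff_cancel_right')
qed

end

lemma todd_trunc_1: "todd_trunc (Suc 0) e w = (\<lambda>g. g)"
  by (simp add: todd_trunc_def fun_eq_iff)

lemma todd_trunc_support:
  assumes "\<And>x. norm x > R \<Longrightarrow> g x = 0" "norm x > R"
  shows "foldr (\<lambda>i. todd_trunc M e (w i)) is g x = 0"
  using assms(2)
proof (induction "is" arbitrary: x)
  case Nil
  then show ?case by (simp add: assms(1))
next
  case (Cons i "is")
  let ?G = "foldr (\<lambda>i. todd_trunc M e (w i)) is g"
  have "(dird (w i) ^^ a) ?G y = 0" if "norm y > R" for a y
    using that
  proof (induction a arbitrary: y)
    case 0
    then show ?case using Cons.IH by simp
  next
    case (Suc a)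
    then show ?case using dird_eq_0_outside[of R "(dird (w i) ^^ a) ?G" y "w i"] by simp
  qed
  with Cons.prems show ?case
    unfolding foldr.simps o_apply todd_trunc_def[of M e "w i" ?G] by simp
qed

section \<open>Cell integrals and lattice sums over a unimodular cone\<close>

context dual_cone
begin

text \<open>With all differences moved outermost, integrating them over the cone amounts to
  integrating the Todd part over one cell.\<close>

lemma cell_todd_trunc_integral:
  assumes "test_function g" "e > 0"
  shows "(LINT x:cell e b|lborel. foldr (\<lambda>i. todd_trunc M e (w i)) js g x) =
    (LINT x:cone b|lborel. foldr (\<lambda>i. todd_diff M e (w i)) js g x)"
proof -
  have "test_function (foldr (\<lambda>i. todd_trunc M e (w i)) js g)"
    using assms(1) by (intro dop_test[OF dop_foldr] dop_todd_trunc)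
  from integral_bdiff_foldr[OF this js(2) _ assms(2), of b] show ?thesis
    unfolding cell_eq foldr_todd_diff_split[OF assms(1)] js(1) by simp
qed

text \<open>The pointwise bound of \<open>foldr_todd_diff\<close> is integrated over the cone.
  Independence of the constant from \<open>b\<close> is essential, since the estimate is summed over
  cells with varying corners.\<close>

lemma cone_estimate:
  assumes "test_function g" "M \<ge> 1"
  obtains C where "C \<ge> 0" "\<And>e b. 0 < e \<Longrightarrow> e \<le> 1 \<Longrightarrow>
    \<bar>(LINT x:cell e b|lborel. foldr (\<lambda>i. todd_trunc M e (w i)) js g x) -
      e ^ CARD('n) * (LINT x:cone b|lborel. foldr (\<lambda>i. dird (w i)) js g x)\<bar> \<le> C * e ^ (CARD('n) + M)"
proof -
  let ?A = "\<lambda>e. foldr (\<lambda>i. todd_diff M e (w i)) js g" and ?Q = "foldr (\<lambda>i. dird (w i)) js g"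
  obtain C where C: "C \<ge> 0" "\<And>e x. 0 < e \<Longrightarrow> e \<le> 1 \<Longrightarrow>
      \<bar>?A e x - e ^ CARD('n) * ?Q x\<bar> \<le> C * e ^ (CARD('n) + M)"
    using foldr_todd_diff[OF assms, of w js] unfolding js(3) by blast
  obtain R where R: "\<And>x. norm x > R \<Longrightarrow> g x = 0"
    using assms(1) test_function_iff by metis
  \<comment> \<open>A radius that contains the supports of both integrands for every
    \<open>e \<le> 1\<close>.\<close>
  define R' where "R' = R + (\<Sum>i\<leftarrow>js. norm (w i))"
  have "(\<Sum>i\<leftarrow>js. norm (w i)) \<ge> 0" by (intro sum_list_nonneg) auto
  then have "R' \<ge> R" by (simp add: R'_def)
  define K where "K = measure lborel (cball (0::real^'n) R')"
  have "\<bar>(LINT x:cell e b|lborel. foldr (\<lambda>i. todd_trunc M e (w i)) js g x) -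
      e ^ CARD('n) * (LINT x:cone b|lborel. ?Q x)\<bar> \<le> (C * K) * e ^ (CARD('n) + M)"
    if e: "0 < e" "e \<le> 1" for e b
  proof -
    have A: "test_function (?A e)"
      using assms(1) by (intro dop_test[OF dop_foldr] dop_todd_diff)
    have Q: "test_function (\<lambda>x. e ^ CARD('n) * ?Q x)"
      using assms(1) by (intro test_function_cmult dop_test[OF dop_foldr] dop_dird)
    have "(LINT x:cell e b|lborel. foldr (\<lambda>i. todd_trunc M e (w i)) js g x) -
      e ^ CARD('n) * (LINT x:cone b|lborel. ?Q x) =
      (LINT x:cone b|lborel. ?A e x) - (LINT x:cone b|lborel. e ^ CARD('n) * ?Q x)"
      by (simp add: cell_todd_trunc_integral[OF assms(1) e(1)])
    also have "\<dots> = (LINT x:cone b|lborel. ?A e x - e ^ CARD('n) * ?Q x)"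
      by (intro set_integral_diff(2)[symmetric] test_function_set_integrable A Q borel_cone)
    also have "\<bar>\<dots>\<bar> \<le> (C * e ^ (CARD('n) + M)) * measure lborel (cball (0::real^'n) R')"
    proof (rule set_integral_ball_bound)
      show "set_integrable lborel (cone b) (\<lambda>x. ?A e x - e ^ CARD('n) * ?Q x)"
        by (intro test_function_set_integrable test_function_diff A Q borel_cone)
      show "?A e x - e ^ CARD('n) * ?Q x = 0" if "norm x > R'" for x
        using foldr_todd_diff_support[where R = R and g = g and e = e and x = x and js = js and w = w and M = M]
            dird_eq_0_outside_foldr[where R = R and g = g and x = x and js = js and w = w]
          R e that \<open>R' \<ge> R\<close> by (simp add: R'_def)
    qed (use C(2) e in blast)
    finally show ?thesis by (simp add: K_def mult_ac)
  qed
  moreover have "C * K \<ge> 0" using C(1) by (simp add: K_def)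
  ultimately show ?thesis using that by blast
qed

text \<open>The cell has volume e^n and its points are within O(e) of the corner. This crude
  estimate serves to identify the cone integral in \<open>integral_cone_corner\<close>.\<close>

lemma cell_lipschitz:
  assumes "test_function g"
  obtains K where "K \<ge> 0" "\<And>e b. 0 < e \<Longrightarrow>
    \<bar>(LINT x:cell e b|lborel. g x) - e ^ CARD('n) * g (vertex b)\<bar> \<le> K * e ^ (CARD('n) + 1)"
proof -
  obtain K where K: "K \<ge> 0" "\<And>x y. \<bar>g x - g y\<bar> \<le> K * norm (x - y)"
    using test_function_lipschitz[OF assms] by blast
  define L where "L = K * (\<Sum>j\<in>J. norm (w j))"
  have "\<bar>(LINT x:cell e b|lborel. g x) - e ^ CARD('n) * g (vertex b)\<bar> \<le> L * e ^ (CARD('n) + 1)"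
    if e: "0 < e" for e b
  proof -
    have near: "\<bar>g x - g (vertex b)\<bar> \<le> L * e" if "x \<in> cell e b" for x
    proof -
      have "x - vertex b = (\<Sum>j\<in>J. (u j \<bullet> x - b j) *\<^sub>R w j)"
        by (subst expand[of x, symmetric]) (simp add: vertex_def sum_subtractf scaleR_diff_left)
      also have "norm \<dots> \<le> (\<Sum>j\<in>J. e * norm (w j))"
      proof (rule order_trans[OF norm_sum sum_mono])
        fix j assume "j \<in> J"
        then have "\<bar>u j \<bullet> x - b j\<bar> \<le> e" using that by (auto simp: cell_def)
        then show "norm ((u j \<bullet> x - b j) *\<^sub>R w j) \<le> e * norm (w j)"
          by (simp add: mult_right_mono)
      qed
      finally have "K * norm (x - vertex b) \<le> K * (\<Sum>j\<in>J. e * norm (w j))"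
        using K(1) by (rule mult_left_mono)
      then show ?thesis
        using K(2)[of x "vertex b"] by (simp add: L_def sum_distrib_left[symmetric] mult_ac)
    qed
    have fin: "emeasure lborel (cell e b) < \<infinity>"
      by (simp add: emeasure_cell[OF e])
    have const: "set_integrable lborel (cell e b) (\<lambda>x. c)" for c :: real
      unfolding set_integrable_def using fin
      by (intro integrable_scaleR_left integrable_real_indicator) auto
    have cint: "(LINT x:cell e b|lborel. c) = e ^ CARD('n) * c" for c :: real
      using fin by (simp add: set_integral_const measure_cell[OF e])
    have "(LINT x:cell e b|lborel. g x) - e ^ CARD('n) * g (vertex b) =
        (LINT x:cell e b|lborel. g x - g (vertex b))"
      by (simp add: set_integral_diff(2) test_function_set_integrable[OF assms] const cint)
    also have "\<bar>\<dots>\<bar> \<le> (LINT x:cell e b|lborel. \<bar>g x - g (vertex b)\<bar>)"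
      unfolding set_lebesgue_integral_def
      using integral_norm_bound[of lborel "\<lambda>x. indicator (cell e b) x *\<^sub>R (g x - g (vertex b))"]
      by (simp add: abs_mult)
    also have "\<dots> \<le> (LINT x:cell e b|lborel. L * e)"
    proof (rule set_integral_mono)
      show "set_integrable lborel (cell e b) (\<lambda>x. \<bar>g x - g (vertex b)\<bar>)"
        by (intro set_integrable_abs set_integral_diff(1) test_function_set_integrable assms const borel_cell)
    qed (use near const in auto)
    also have "\<dots> = L * e ^ (CARD('n) + 1)" by (simp add: cint)
    finally show ?thesis .
  qed
  moreover have "L \<ge> 0" using K(1) by (auto simp: L_def intro!: mult_nonneg_nonneg sum_nonneg)
  ultimately show ?thesis using that by blast
qed

text \<open>This is the limit \<open>e \<rightarrow> 0\<close> of the cell estimate for \<open>M = 1\<close>, divided by \<open>e\<^sup>n\<close>.\<close>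

lemma integral_cone_corner:
  assumes "test_function g"
  shows "(LINT x:cone b|lborel. foldr (\<lambda>i. dird (w i)) js g x) = g (vertex b)"
proof -
  let ?I = "LINT x:cone b|lborel. foldr (\<lambda>i. dird (w i)) js g x"
  \<comment> \<open>For M = 1 the truncated Todd operator is just its constant term, the identity,
    so the cell integral is that of \<open>g\<close> itself.\<close>
  have triv: "foldr (\<lambda>i. todd_trunc 1 e (w i)) is h = h" for e "is" h
    by (induction "is") (simp_all add: todd_trunc_1)
  obtain C where C: "C \<ge> 0" "\<And>e b. 0 < e \<Longrightarrow> e \<le> 1 \<Longrightarrow>
    \<bar>(LINT x:cell e b|lborel. g x) -
      e ^ CARD('n) * (LINT x:cone b|lborel. foldr (\<lambda>i. dird (w i)) js g x)\<bar> \<le> C * e ^ (CARD('n) + 1)"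
    using cone_estimate[OF assms order_refl] unfolding triv by blast
  obtain K where K: "K \<ge> 0" "\<And>e b. 0 < e \<Longrightarrow>
    \<bar>(LINT x:cell e b|lborel. g x) - e ^ CARD('n) * g (vertex b)\<bar> \<le> K * e ^ (CARD('n) + 1)"
    using cell_lipschitz[OF assms] by blast
  have bound: "\<bar>?I - g (vertex b)\<bar> \<le> (C + K) * e" if e: "0 < e" "e \<le> 1" for e
  proof -
    have "e ^ CARD('n) * \<bar>?I - g (vertex b)\<bar> = \<bar>e ^ CARD('n) * ?I - e ^ CARD('n) * g (vertex b)\<bar>"
      using e(1) by (simp add: abs_mult right_diff_distrib[symmetric])
    also have "\<dots> \<le> (C + K) * e ^ (CARD('n) + 1)"
      using C(2)[OF e, of b] K(2)[OF e(1), of b] unfolding distrib_right by linarith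
    also have "\<dots> = e ^ CARD('n) * ((C + K) * e)" by simp
    finally show ?thesis using e(1) by (simp add: mult_le_cancel_left_pos)
  qed
  have "\<bar>?I - g (vertex b)\<bar> \<le> 0 + d" if "d > 0" for d
  proof -
    \<comment> \<open>The summand 1 covers the case C = K = 0.\<close>
    let ?e = "min 1 (d / (C + K + 1))"
    have pos: "C + K + 1 > 0" using C(1) K(1) by simp
    have "(C + K) * ?e \<le> (C + K + 1) * ?e"
      using that pos by (intro mult_right_mono) auto
    also have "\<dots> \<le> (C + K + 1) * (d / (C + K + 1))"
      using pos by (intro mult_left_mono) auto
    finally show ?thesis
      using bound[of ?e] that pos by simp
  qed
  from field_le_epsilon[OF this] show ?thesis by simp
qed

lemma cell_estimate:
  assumes "test_function g" "M \<ge> 1"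
  obtains C where "C \<ge> 0" "\<And>e b. 0 < e \<Longrightarrow> e \<le> 1 \<Longrightarrow>
    \<bar>(LINT x:cell e b|lborel. foldr (\<lambda>i. todd_trunc M e (w i)) js g x) -
      e ^ CARD('n) * g (vertex b)\<bar> \<le> C * e ^ (CARD('n) + M)"
proof -
  obtain C where C: "C \<ge> 0" "\<And>e b. 0 < e \<Longrightarrow> e \<le> 1 \<Longrightarrow>
    \<bar>(LINT x:cell e b|lborel. foldr (\<lambda>i. todd_trunc M e (w i)) js g x) -
      e ^ CARD('n) * g (vertex b)\<bar> \<le> C * e ^ (CARD('n) + M)"
    using cone_estimate[OF assms] unfolding integral_cone_corner[OF assms(1)] by blast
  then show ?thesis by (rule that)
qed

text \<open>The part of the cone that can meet the support is tiled by (R N)^n cells of size 1/N,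
  and integral bounds make their corners exactly the scaled lattice points. The sum is restricted to
  nonzero values because a cone contains infinitely many lattice points.\<close>

lemma cone_lattice_sum:
  assumes g: "test_function g" and M: "M \<ge> 1" and b: "\<And>j. j \<in> J \<Longrightarrow> b j \<in> \<int>"
  obtains C where "\<And>N::nat. N \<ge> 1 \<Longrightarrow>
    \<bar>(LINT x:cone b|lborel. foldr (\<lambda>i. todd_trunc M (1 / real N) (w i)) js g x) -
      1 / real N ^ CARD('n) * (\<Sum>k | k \<in> int_lattice \<and> k /\<^sub>R real N \<in> cone b \<and> g (k /\<^sub>R real N) \<noteq> 0. g (k /\<^sub>R real N))\<bar>
      \<le> C * (1 / real N ^ M)"
proof -
  obtain C where C: "C \<ge> 0" "\<And>e b. 0 < e \<Longrightarrow> e \<le> 1 \<Longrightarrow>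
    \<bar>(LINT x:cell e b|lborel. foldr (\<lambda>i. todd_trunc M e (w i)) js g x) -
      e ^ CARD('n) * g (vertex b)\<bar> \<le> C * e ^ (CARD('n) + M)"
    using cell_estimate[OF g M] by blast
  obtain R0 where R0: "\<And>x. norm x > R0 \<Longrightarrow> g x = 0"
    using g test_function_iff by metis
  \<comment> \<open>By Cauchy-Schwarz, a point at depth \<open>R\<close> or more below some facet
    lies outside the support of \<open>g\<close>. Taking \<open>R\<close> a natural number gives
    exactly \<open>R * N\<close> layers of cells in each direction.\<close>
  obtain R :: nat where R: "R > (\<Sum>j\<in>J. \<bar>b j\<bar> + norm (u j) * \<bar>R0\<bar>)"
    using reals_Archimedean2 by blast
  have "(\<Sum>j\<in>J. \<bar>b j\<bar> + norm (u j) * \<bar>R0\<bar>) \<ge> 0" by (intro sum_nonneg) auto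
  with R have "R > 0" by linarith
  have far: "norm x > R0" if "j \<in> J" "u j \<bullet> x \<le> b j - R" for x j
  proof (rule ccontr)
    assume "\<not> norm x > R0"
    then have "norm (u j) * norm x \<le> norm (u j) * \<bar>R0\<bar>"
      by (intro mult_left_mono) auto
    moreover have "\<bar>u j \<bullet> x\<bar> \<le> norm (u j) * norm x"
      by (rule Cauchy_Schwarz_ineq2)
    moreover have "\<bar>b j\<bar> + norm (u j) * \<bar>R0\<bar> \<le> (\<Sum>j\<in>J. \<bar>b j\<bar> + norm (u j) * \<bar>R0\<bar>)"
      using that(1) by (intro member_le_sum) auto
    ultimately show False using R that(2) by linarith
  qed
  define L where "L = real R ^ CARD('n) * C"
  have "\<bar>(LINT x:cone b|lborel. foldr (\<lambda>i. todd_trunc M (1 / real N) (w i)) js g x) -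
      1 / real N ^ CARD('n) * (\<Sum>k | k \<in> int_lattice \<and> k /\<^sub>R real N \<in> cone b \<and> g (k /\<^sub>R real N) \<noteq> 0. g (k /\<^sub>R real N))\<bar>
      \<le> L * (1 / real N ^ M)" if N: "N \<ge> 1" for N :: nat
  proof -
    define e where "e = 1 / real N"
    have e: "0 < e" "e \<le> 1" using N by (auto simp: e_def)
    let ?T = "foldr (\<lambda>i. todd_trunc M e (w i)) js g"
    have T: "test_function ?T"
      using g by (intro dop_test[OF dop_foldr] dop_todd_trunc)
    define I where "I = PiE J (\<lambda>_. {..<R * N})"
    have finI: "finite I" unfolding I_def by (intro finite_PiE) auto
    have cardI: "card I = (R * N) ^ CARD('n)"
      by (simp add: I_def card_PiE card_J)
    \<comment> \<open>\<open>m j\<close> counts the layers between the cell and facet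
      \<open>j\<close>, so these are the upper bounds of the cell with index
      \<open>m\<close>.\<close>
    define B where "B m j = b j - e * real (m j)" for m :: "'d \<Rightarrow> nat" and j
    have floor: "of_nat (nat \<lfloor>(b j - u j \<bullet> x) / e\<rfloor>) = of_int \<lfloor>(b j - u j \<bullet> x) / e\<rfloor>"
      if "u j \<bullet> x \<le> b j" for j x
      using that e(1) by (simp add: of_nat_nat)
    \<comment> \<open>Membership means that the depths in units of \<open>e\<close> have the floors
      \<open>m j\<close>; disjointness and covering are then properties of the floor.\<close>
    have in_cell: "x \<in> cell e (B m) \<longleftrightarrow> (\<forall>j\<in>J. \<lfloor>(b j - u j \<bullet> x) / e\<rfloor> = int (m j))" for x m
    proof -
      have "B m j - e < u j \<bullet> x \<and> u j \<bullet> x \<le> B m j \<longleftrightarrow> \<lfloor>(b j - u j \<bullet> x) / e\<rfloor> = int (m j)" for j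
        using e(1) by (auto simp: B_def floor_eq_iff pos_le_divide_eq pos_divide_less_eq algebra_simps)
      then show ?thesis by (simp add: cell_def)
    qed
    have disj: "disjoint_family_on (\<lambda>m. cell e (B m)) I"
      unfolding disjoint_family_on_def
    proof (intro ballI impI equals0I)
      fix m m' x assume m: "m \<in> I" "m' \<in> I" "m \<noteq> m'" "x \<in> cell e (B m) \<inter> cell e (B m')"
      then have "m j = m' j" if "j \<in> J" for j
        using that unfolding Int_iff in_cell by (metis of_nat_eq_iff)
      with m(1,2) have "m = m'" unfolding I_def by (rule PiE_ext)
      with m(3) show False by simp
    qed
    \<comment> \<open>The cut at depth \<open>R\<close> falls on cell walls, so the truncated cone
      is an exact union of cells.\<close>
    have cover: "cone b \<inter> {x. \<forall>j\<in>J. b j - R < u j \<bullet> x} = (\<Union>m\<in>I. cell e (B m))"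
    proof (intro equalityI subsetI)
      fix x assume x: "x \<in> cone b \<inter> {x. \<forall>j\<in>J. b j - R < u j \<bullet> x}"
      define m where "m = restrict (\<lambda>j. nat \<lfloor>(b j - u j \<bullet> x) / e\<rfloor>) J"
      have "x \<in> cell e (B m)"
        using x e(1) by (auto simp: in_cell m_def cone_def)
      moreover have "m \<in> I"
        unfolding I_def m_def restrict_PiE_iff
      proof
        fix j assume "j \<in> J"
        then have "real N * (b j - u j \<bullet> x) < real N * R"
          using x N by (intro mult_strict_left_mono) (auto simp: algebra_simps)
        then have "(b j - u j \<bullet> x) / e < real (R * N)"
          by (simp add: e_def mult.commute)
        then have "\<lfloor>(b j - u j \<bullet> x) / e\<rfloor> < int (R * N)"
          by (simp add: floor_less_iff)
        moreover have "0 < int (R * N)" using N \<open>R > 0\<close> by simp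
        ultimately have "nat \<lfloor>(b j - u j \<bullet> x) / e\<rfloor> < nat (int (R * N))"
          by (simp only: zless_nat_conj)
        then show "nat \<lfloor>(b j - u j \<bullet> x) / e\<rfloor> \<in> {..<R * N}"
          by (simp only: nat_int lessThan_iff)
      qed
      ultimately show "x \<in> (\<Union>m\<in>I. cell e (B m))" by blast
    next
      fix x assume "x \<in> (\<Union>m\<in>I. cell e (B m))"
      then obtain m where m: "m \<in> I" "x \<in> cell e (B m)" by blast
      have "u j \<bullet> x \<le> b j \<and> b j - R < u j \<bullet> x" if j: "j \<in> J" for j
      proof -
        have "m j + 1 \<le> R * N" using PiE_mem[OF m(1)[unfolded I_def] j] by simp
        then have "e * (real (m j) + 1) \<le> e * real (R * N)"
          using e(1) by (intro mult_left_mono) (auto simp flip: of_nat_Suc simp del: of_nat_mult)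
        also have "\<dots> = R" using N by (simp add: e_def)
        finally have "e * real (m j) + e \<le> R" by (simp add: algebra_simps)
        moreover have "e * real (m j) \<ge> 0" using e(1) by simp
        moreover have "B m j - e < u j \<bullet> x" "u j \<bullet> x \<le> B m j"
          using m(2) j by (auto simp: cell_def)
        ultimately show ?thesis unfolding B_def by linarith
      qed
      then show "x \<in> cone b \<inter> {x. \<forall>j\<in>J. b j - R < u j \<bullet> x}" by (auto simp: cone_def)
    qed
    have "(LINT x:cone b|lborel. ?T x) = (LINT x:cone b \<inter> {x. \<forall>j\<in>J. b j - R < u j \<bullet> x}|lborel. ?T x)"
      unfolding set_lebesgue_integral_def
    proof (rule Bochner_Integration.integral_cong[OF refl])
      fix x
      have "?T x = 0" if "j \<in> J" "\<not> b j - R < u j \<bullet> x" for j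
        using that(2)
        by (intro todd_trunc_support[where g = g and R = R0, OF R0 far[OF that(1)]]) auto
      then show "indicator (cone b) x *\<^sub>R ?T x =
          indicator (cone b \<inter> {x. \<forall>j\<in>J. b j - R < u j \<bullet> x}) x *\<^sub>R ?T x"
        by (auto simp: indicator_def)
    qed
    also have "\<dots> = (\<Sum>m\<in>I. LINT x:cell e (B m)|lborel. ?T x)"
      unfolding cover
      by (intro set_integral_finite_Union finI disj test_function_set_integrable T) auto
    finally have 1: "(LINT x:cone b|lborel. ?T x) = (\<Sum>m\<in>I. LINT x:cell e (B m)|lborel. ?T x)" .
    let ?S = "{k. k \<in> int_lattice \<and> k /\<^sub>R real N \<in> cone b \<and> g (k /\<^sub>R real N) \<noteq> 0}"
    \<comment> \<open>The inverse of the map from cells to corners: the depths of a lattice point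
      below the scaled facets. \<open>restrict\<close> supplies the value off \<open>J\<close> that
      membership in \<open>I\<close> requires.\<close>
    define mk where "mk k = restrict (\<lambda>j. nat \<lfloor>N * b j - u j \<bullet> k\<rfloor>) J" for k
    have u_scaled: "u j \<bullet> (real N *\<^sub>R vertex (B m)) = N * b j - m j" if "j \<in> J" for m j
      using that N by (simp add: u_vertex B_def e_def algebra_simps)
    have "(\<Sum>m\<in>I. g (vertex (B m))) = (\<Sum>m\<in>{m\<in>I. g (vertex (B m)) \<noteq> 0}. g (vertex (B m)))"
      proof (rule sum.mono_neutral_right)
      show "finite I" by (rule finI)
      show "{m \<in> I. g (vertex (B m)) \<noteq> 0} \<subseteq> I" by blast
      show "\<forall>m\<in>I - {m \<in> I. g (vertex (B m)) \<noteq> 0}. g (vertex (B m)) = 0" by blast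
    qed
    also have "\<dots> = (\<Sum>k\<in>?S. g (k /\<^sub>R real N))"
    proof (rule sum.reindex_bij_witness[of _ mk "\<lambda>m. real N *\<^sub>R vertex (B m)"])
      fix m assume m: "m \<in> {m \<in> I. g (vertex (B m)) \<noteq> 0}"
      have "mk (real N *\<^sub>R vertex (B m)) j = m j" for j
      proof (cases "j \<in> J")
        case True
        show ?thesis unfolding mk_def restrict_apply u_scaled[OF True] using True by simp
      next
        case False
        have "m \<in> PiE J (\<lambda>_. {..<R * N})" using m by (simp add: I_def)
        with False show ?thesis by (simp add: mk_def PiE_arb[of m])
      qed
      then show "mk (real N *\<^sub>R vertex (B m)) = m" by blast
      have scaled: "(real N *\<^sub>R vertex (B m)) /\<^sub>R real N = vertex (B m)" using N by simp
      have "vertex (B m) \<in> cone b"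
        using e(1) by (simp add: cone_def u_vertex B_def)
      have "real N *\<^sub>R vertex (B m) = vertex (\<lambda>j. N * b j - m j)"
        by (rule vertex_unique) (rule u_scaled)
      also have "\<dots> \<in> int_lattice"
        unfolding vertex_def by (intro int_lattice_sum w_lattice) (auto intro!: Ints_diff Ints_mult b)
      finally show "real N *\<^sub>R vertex (B m) \<in> ?S"
        using m \<open>vertex (B m) \<in> cone b\<close> by (simp only: mem_Collect_eq scaled) blast
      show "g ((real N *\<^sub>R vertex (B m)) /\<^sub>R real N) = g (vertex (B m))" by (simp only: scaled)
    next
      fix k assume k: "k \<in> ?S"
      have mkj: "real (mk k j) = N * b j - u j \<bullet> k \<and> mk k j < R * N" if j: "j \<in> J" for j
      proof -
        have "N * b j - u j \<bullet> k \<in> \<int>"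
          using k j by (intro Ints_diff Ints_mult b inner_int_lattice u_lattice) auto
        then obtain z where z: "N * b j - u j \<bullet> k = of_int z" by (auto elim: Ints_cases)
        have uk: "u j \<bullet> (k /\<^sub>R real N) = (u j \<bullet> k) / N" by (simp add: field_simps)
        have "(u j \<bullet> k) / N \<le> b j"
          using k j unfolding uk[symmetric] by (auto simp: cone_def)
        then have "u j \<bullet> k \<le> N * b j"
          using N by (simp add: pos_divide_le_eq mult.commute)
        then have "real_of_int z \<ge> 0" unfolding z[symmetric] by simp
        then have "z \<ge> 0" by simp
        moreover have "\<not> u j \<bullet> (k /\<^sub>R real N) \<le> b j - R"
          using far[OF j] R0 k by blast
        then have "real N * (b j - (u j \<bullet> k) / N) < real N * R"
          using N unfolding uk by (intro mult_strict_left_mono) auto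
        then have "N * b j - u j \<bullet> k < R * N"
          using N by (simp add: right_diff_distrib mult.commute)
        then have "z < int (R * N)"
          unfolding z by (metis of_int_less_iff of_int_of_nat_eq of_nat_mult)
        ultimately show ?thesis using j by (simp add: mk_def z nat_less_iff)
      qed
      have "k /\<^sub>R real N = vertex (B (mk k))"
      proof (rule vertex_unique)
        fix j assume j: "j \<in> J"
        show "u j \<bullet> (k /\<^sub>R real N) = B (mk k) j"
          unfolding B_def e_def mkj[OF j, THEN conjunct1] using N by (simp add: field_simps)
      qed
      note eq = this
      have "mk k \<in> I" unfolding I_def using mkj by (auto simp: mk_def)
      then show "mk k \<in> {m \<in> I. g (vertex (B m)) \<noteq> 0}"
        using k unfolding mem_Collect_eq eq by blast
      show "real N *\<^sub>R vertex (B (mk k)) = k"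
        unfolding eq[symmetric] using N by simp
    qed
    finally have 2: "(\<Sum>m\<in>I. g (vertex (B m))) = (\<Sum>k\<in>?S. g (k /\<^sub>R real N))" .
    \<comment> \<open>There are (R N)^n cells, each with an error of order e^(n+M); since e = 1/N,
      the factors N^n and e^n cancel.\<close>
    have "\<bar>(\<Sum>m\<in>I. LINT x:cell e (B m)|lborel. ?T x) - e ^ CARD('n) * (\<Sum>m\<in>I. g (vertex (B m)))\<bar>
       \<le> (\<Sum>m\<in>I. \<bar>(LINT x:cell e (B m)|lborel. ?T x) - e ^ CARD('n) * g (vertex (B m))\<bar>)"
      unfolding sum_distrib_left sum_subtractf[symmetric] by (rule sum_abs)
    also have "\<dots> \<le> (\<Sum>m\<in>I. C * e ^ (CARD('n) + M))"
      by (intro sum_mono C(2) e)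
    also have "\<dots> = real R ^ CARD('n) * (real N ^ CARD('n) * e ^ CARD('n)) * C * e ^ M"
      by (simp add: cardI power_add power_mult_distrib)
    also have "real N ^ CARD('n) * e ^ CARD('n) = 1"
      using N by (simp add: e_def power_mult_distrib[symmetric])
    also have "real R ^ CARD('n) * 1 * C * e ^ M = L * (1 / real N ^ M)"
      by (simp add: L_def e_def power_one_over)
    finally show ?thesis
      using 1 2 by (simp add: e_def power_one_over)
  qed
  then show ?thesis using that by blast
qed

end

section \<open>The asymptotic expansion at a vertex\<close>

text \<open>Second-order Taylor expansion along \<open>v\<close>, obtained from
  \<open>taylor_line\<close> with step -1. Being uniform in \<open>x\<close>, the remainder can be
  integrated, which yields differentiation under the integral sign.\<close>

lemma test_function_quadratic_remainder:
  assumes "test_function g"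
  obtains K where "K \<ge> 0" "\<And>x v. \<bar>g (x + v) - g x - dird v g x\<bar> \<le> K * (norm v)\<^sup>2"
proof -
  have "\<exists>K. K \<ge> 0 \<and> (\<forall>w x. \<bar>dird w (partial_diff k g) x\<bar> \<le> K * norm w)" for k
    using test_function_dird_bound[OF test_function_dird[OF assms]]
    unfolding partial_diff_eq_dird by metis
  then obtain K where K: "\<And>k. K k \<ge> 0" "\<And>k w x. \<bar>dird w (partial_diff k g) x\<bar> \<le> K k * norm w" by metis
  have second: "\<bar>(dird w ^^ 2) g x\<bar> \<le> (\<Sum>k\<in>UNIV. K k) * (norm w)\<^sup>2" for w x
  proof -
    have eq: "dird w g = (\<lambda>x. \<Sum>k\<in>UNIV. w $ k * partial_diff k g x)"
      by (simp add: fun_eq_iff dird_partial_diff test_function_differentiable[OF assms])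
    have "(dird w ^^ 2) g x = dird w (\<lambda>x. \<Sum>k\<in>UNIV. w $ k * partial_diff k g x) x"
      by (simp add: numeral_2_eq_2 flip: eq)
    also have "\<dots> = (\<Sum>k\<in>UNIV. w $ k * dird w (partial_diff k g) x)"
      by (intro dird_lincomb smooth_on_differentiable[where U = UNIV] smooth_on_partial_diff
          test_function_smooth[OF assms] UNIV_I)
    also have "\<bar>\<dots>\<bar> \<le> (\<Sum>k\<in>UNIV. norm w * (K k * norm w))"
      by (rule order_trans[OF sum_abs sum_mono])
        (auto simp: abs_mult intro!: mult_mono component_le_norm_cart K)
    also have "\<dots> = (\<Sum>k\<in>UNIV. K k) * (norm w)\<^sup>2"
      unfolding sum_distrib_right by (intro sum.cong) (simp_all add: power2_eq_square)
    finally show ?thesis .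
  qed
  have "\<bar>g (x + v) - g x - dird v g x\<bar> \<le> (\<Sum>k\<in>UNIV. K k) * (norm v)\<^sup>2" for x v
    using taylor_line[OF assms second[of v], of x "- 1"]
    by (simp add: numeral_2_eq_2 algebra_simps)
  moreover have "(\<Sum>k\<in>UNIV. K k) \<ge> 0" using K(1) by (simp add: sum_nonneg)
  ultimately show ?thesis using that by blast
qed

lemma set_integral_lincomb:
  fixes f :: "'i \<Rightarrow> real^'n \<Rightarrow> real"
  assumes "\<And>i. i \<in> I \<Longrightarrow> test_function (f i)" "A \<in> sets borel"
  shows "(LINT x:A|lborel. (\<Sum>i\<in>I. c i * f i x)) = (\<Sum>i\<in>I. c i * (LINT x:A|lborel. f i x))"
proof -
  have "(LINT x:A|lborel. (\<Sum>i\<in>I. c i * f i x)) = (\<integral>x. (\<Sum>i\<in>I. c i * (indicator A x *\<^sub>R f i x)) \<partial>lborel)"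
    unfolding set_lebesgue_integral_def
    by (simp add: sum_distrib_left mult_ac)
  also have "\<dots> = (\<Sum>i\<in>I. \<integral>x. c i * (indicator A x *\<^sub>R f i x) \<partial>lborel)"
    using assms test_function_set_integrable
    by (intro Bochner_Integration.integral_sum integrable_mult_right) (auto simp: set_integrable_def)
  finally show ?thesis
    by (simp add: set_lebesgue_integral_def)
qed

lemma dird_funpow_lincomb:
  assumes "\<And>i. i \<in> I \<Longrightarrow> test_function (f i)"
  shows "(dird w ^^ a) (\<lambda>x. \<Sum>i\<in>I. c i * f i x) = (\<lambda>x. \<Sum>i\<in>I. c i * (dird w ^^ a) (f i) x)"
proof (induction a)
  case (Suc a)
  show ?case
    unfolding funpow.simps o_apply Suc
    by (intro ext dird_lincomb test_function_differentiable test_function_dird_funpow assms)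
qed simp

text \<open>The product of the truncated sums is multiplied out: choosing one exponent per direction
  is a function in the extensional product \<open>PiE\<close>.\<close>

lemma foldr_todd_trunc_expand:
  assumes "test_function g" "distinct is"
  shows "foldr (\<lambda>i. todd_trunc M e (w i)) is g = (\<lambda>x. \<Sum>\<alpha>\<in>PiE (set is) (\<lambda>_. {..<M}).
    (\<Prod>i\<in>set is. todd1 (\<alpha> i) * e ^ \<alpha> i) * foldr (\<lambda>i. dird (w i) ^^ \<alpha> i) is g x)"
  using assms(2)
proof (induction "is")
  case Nil
  then show ?case by simp
next
  case (Cons i "is")
  let ?c = "\<lambda>\<alpha>. \<Prod>i\<in>set is. todd1 (\<alpha> i) * e ^ \<alpha> i"
  let ?D = "\<lambda>\<alpha>. foldr (\<lambda>i. dird (w i) ^^ \<alpha> i) is g"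
  let ?A = "PiE (set is) (\<lambda>_. {..<M})"
  have i: "i \<notin> set is" using Cons.prems by simp
  have D: "test_function (?D \<alpha>)" for \<alpha>
    using assms(1) by (induction "is") (auto intro: test_function_dird_funpow)
  have ne: "j \<noteq> i" if "j \<in> set is" for j
    using i that by blast
  \<comment> \<open>The exponent at the new index \<open>i\<close> does not occur in the factors for
    the other directions.\<close>
  have upd: "?D (\<alpha>(i := a)) = ?D \<alpha>" "?c (\<alpha>(i := a)) = ?c \<alpha>" for \<alpha> a
    by (rule foldr_cong[OF refl refl]; simp add: ne) (rule prod.cong[OF refl]; simp add: ne)
  show ?case
  proof
    fix x
    have "foldr (\<lambda>i. todd_trunc M e (w i)) (i # is) g x =
        todd_trunc M e (w i) (\<lambda>x. \<Sum>\<alpha>\<in>?A. ?c \<alpha> * ?D \<alpha> x) x"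
      using Cons by simp
    also have "\<dots> = (\<Sum>a<M. \<Sum>\<alpha>\<in>?A. (todd1 a * e ^ a) * ?c \<alpha> * (dird (w i) ^^ a) (?D \<alpha>) x)"
      by (simp add: todd_trunc_def dird_funpow_lincomb[OF D] sum_distrib_left mult.assoc)
    also have "\<dots> = (\<Sum>(a, \<alpha>)\<in>{..<M} \<times> ?A. (todd1 a * e ^ a) * ?c \<alpha> * (dird (w i) ^^ a) (?D \<alpha>) x)"
      by (simp add: sum.cartesian_product)
    also have "\<dots> = (\<Sum>\<alpha>\<in>(\<lambda>(a, \<alpha>). \<alpha>(i := a)) ` ({..<M} \<times> ?A).
        (todd1 (\<alpha> i) * e ^ \<alpha> i) * ?c \<alpha> * (dird (w i) ^^ \<alpha> i) (?D \<alpha>) x)"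
      by (subst sum.reindex[OF inj_combinator[OF i]])
        (auto simp: upd simp del: fun_upd_apply intro!: sum.cong simp: fun_upd_same)
    also have "(\<lambda>(a, \<alpha>). \<alpha>(i := a)) ` ({..<M} \<times> ?A) = PiE (set (i # is)) (\<lambda>_. {..<M})"
      by (simp add: PiE_insert_eq)
    finally show "foldr (\<lambda>i. todd_trunc M e (w i)) (i # is) g x =
       (\<Sum>\<alpha>\<in>PiE (set (i # is)) (\<lambda>_. {..<M}). (\<Prod>i\<in>set (i # is). todd1 (\<alpha> i) * e ^ \<alpha> i) *
          foldr (\<lambda>i. dird (w i) ^^ \<alpha> i) (i # is) g x)"
      using i by simp
  qed
qed

text \<open>Derivatives along 0 vanish, so only the constant term 1 of the Todd series acts; thus
  indices off \<open>J\<close> can be added to or removed from a product freely.\<close>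

lemma todd_trunc_0: "M \<ge> 1 \<Longrightarrow> todd_trunc M e 0 g = g"
proof -
  assume M: "M \<ge> 1"
  have "todd1 a * e ^ a * (dird 0 ^^ a) g x = (if a = 0 then g x else 0)" for a x
    by (cases a) simp_all
  with M show ?thesis
    by (simp only: todd_trunc_def fun_eq_iff) simp
qed

section \<open>Integrals over the shifted vertex cone as functions of the shifts\<close>

context dual_cone
begin

text \<open>The translation that raises each active bound by its component of \<open>h\<close>;
  components off \<open>J\<close> have no effect because \<open>w\<close> vanishes there.\<close>

definition shift_map :: "(real, 'd) vec \<Rightarrow> real^'n" where
  "shift_map h = (\<Sum>j\<in>UNIV. (h $ j) *\<^sub>R w j)"

text \<open>The cone is held fixed and the integrand is translated, so that derivatives in
  \<open>h\<close> fall on the smooth function \<open>g\<close> instead of the domain.\<close>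

definition cone_integral :: "('d \<Rightarrow> int) \<Rightarrow> (real^'n \<Rightarrow> real) \<Rightarrow> (real, 'd) vec \<Rightarrow> real" where
  "cone_integral c g h = (LINT x:cone (\<lambda>j. of_int (c j))|lborel. g (x + shift_map h))"

lemma shift_map_linear: "linear shift_map"
  by (rule linearI) (simp_all add: shift_map_def scaleR_add_left sum.distrib scaleR_sum_right)

lemma u_shift_map: "j \<in> J \<Longrightarrow> u j \<bullet> shift_map h = h $ j"
proof -
  assume j: "j \<in> J"
  have "u j \<bullet> ((h $ i) *\<^sub>R w i) = (if i = j then h $ j else 0)" for i
    using j dual[of j i] w_outside[of i] by (cases "i \<in> J") auto
  then show ?thesis by (simp add: shift_map_def inner_sum_right)
qed

lemma cone_integral_eq:
  assumes "test_function g"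
  shows "cone_integral c g h = (LINT x:cone (\<lambda>j. of_int (c j) + h $ j)|lborel. g x)"
proof -
  have [measurable]: "g \<in> borel_measurable borel"
    using test_function_integrable[OF assms] by (simp add: borel_measurable_integrable measurable_lborel1)
  have "cone_integral c g h = (LINT x:cone (\<lambda>j. of_int (c j))|lborel. g (x - (- shift_map h)))"
    by (simp add: cone_integral_def)
  also have "\<dots> = (LINT x:{x. x + (- shift_map h) \<in> cone (\<lambda>j. of_int (c j))}|lborel. g x)"
    by (rule set_integral_translate) measurable
  also have "{x. x + (- shift_map h) \<in> cone (\<lambda>j. of_int (c j))} = cone (\<lambda>j. of_int (c j) + h $ j)"
    by (auto simp: cone_def inner_diff_right u_shift_map algebra_simps)
  finally show ?thesis .
qed

text \<open>The quadratic Taylor remainder of \<open>g\<close> is integrated; for shifts within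
  distance 1 of \<open>h\<close> it is supported in one common ball, so the total remainder is
  quadratic in the change of \<open>h\<close>.\<close>

lemma cone_integral_has_derivative:
  assumes g: "test_function g"
  shows "(cone_integral c g has_derivative (\<lambda>k. \<Sum>j\<in>UNIV. k $ j * cone_integral c (dird (w j) g) h)) (at h)"
proof -
  interpret W: bounded_linear shift_map
    using shift_map_linear by (rule linear_conv_bounded_linear[THEN iffD1])
  obtain B where B: "B > 0" "\<And>k. norm (shift_map k) \<le> norm k * B"
    using W.pos_bounded by blast
  obtain K where K: "K \<ge> 0" "\<And>x v. \<bar>g (x + v) - g x - dird v g x\<bar> \<le> K * (norm v)\<^sup>2"
    using test_function_quadratic_remainder[OF g] by blast
  obtain R where R: "\<And>x. norm x > R \<Longrightarrow> g x = 0"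
    using g test_function_iff by metis
  \<comment> \<open>\<open>B\<close> bounds the operator norm of \<open>shift_map\<close>, and every
    shift involved has norm at most \<open>norm h + 1\<close>.\<close>
  define R' where "R' = R + (norm h + 1) * B"
  define C where "C = K * B\<^sup>2 * measure lborel (cball (0::real^'n) R')"
  let ?D = "\<lambda>k. \<Sum>j\<in>UNIV. k $ j * cone_integral c (dird (w j) g) h"
  let ?A = "cone (\<lambda>j. of_int (c j))"
  have tr: "test_function (\<lambda>x. f (x + a))" if "test_function f" for f :: "real^'n \<Rightarrow> real" and a
    using test_function_translate[OF that, of "- a"] by simp
  have main: "\<bar>cone_integral c g y - cone_integral c g h - ?D (y - h)\<bar> \<le> C * (norm (y - h))\<^sup>2"
    if "dist y h < 1" for y
  proof -
    let ?v = "shift_map (y - h)"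
    have v: "shift_map y = shift_map h + ?v" by (simp add: W.diff)
    have n: "norm (y - h) < 1" using that by (simp add: dist_norm)
    let ?r = "\<lambda>x. g (x + shift_map y) - g (x + shift_map h) - dird ?v g (x + shift_map h)"
    have dv: "dird ?v g x = (\<Sum>j\<in>UNIV. (y - h) $ j * dird (w j) g x)" for x
    proof -
      interpret linear "\<lambda>v. dird v g x"
        by (rule linear_dird[OF test_function_differentiable[OF g]])
      show ?thesis by (simp add: shift_map_def sum scale)
    qed
    have "?D (y - h) = (LINT x:?A|lborel. dird ?v g (x + shift_map h))"
      unfolding dv cone_integral_def
      by (rule set_integral_lincomb[symmetric]) (auto intro!: tr test_function_dird g)
    then have "cone_integral c g y - cone_integral c g h - ?D (y - h) = (LINT x:?A|lborel. ?r x)"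
      by (simp add: cone_integral_def set_integral_diff test_function_set_integrable tr g
          test_function_dird test_function_diff)
    also have "\<bar>\<dots>\<bar> \<le> (K * (B * norm (y - h))\<^sup>2) * measure lborel (cball (0::real^'n) R')"
    proof (rule set_integral_ball_bound)
      show "set_integrable lborel ?A ?r"
        by (intro test_function_set_integrable test_function_diff tr test_function_dird g borel_cone)
      show "\<bar>?r x\<bar> \<le> K * (B * norm (y - h))\<^sup>2" for x
      proof -
        have "\<bar>?r x\<bar> \<le> K * (norm ?v)\<^sup>2"
          using K(2)[of "x + shift_map h" ?v] by (simp add: v add.assoc)
        also have "\<dots> \<le> K * (B * norm (y - h))\<^sup>2"
          using B(2)[of "y - h"] K(1) by (intro mult_left_mono power_mono) (auto simp: mult.commute)
        finally show ?thesis .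
      qed
      show "?r x = 0" if x: "norm x > R'" for x
      proof -
        have far: "norm (x + shift_map z) > R" if "norm z \<le> norm h + 1" for z
        proof -
          have "norm (shift_map z) \<le> (norm h + 1) * B"
            using B that by (meson mult_right_mono order_trans less_imp_le)
          then show ?thesis
            using x norm_triangle_ineq4[of "x + shift_map z" "shift_map z"] unfolding R'_def
            by simp
        qed
        have "norm y \<le> norm h + 1" using n norm_triangle_ineq2[of y h] by simp
        then show ?thesis
          using far[of y] far[of h] by (simp add: R dird_eq_0_outside[of R g])
      qed
    qed
    finally show ?thesis by (simp add: C_def power_mult_distrib mult_ac)
  qed
  show ?thesis
  proof (rule has_derivativeI_sandwich[where e = 1 and H = "\<lambda>y. C * norm (y - h)"])
    show "bounded_linear ?D"
      unfolding linear_conv_bounded_linear[symmetric]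
      by (rule linearI) (simp_all add: distrib_right sum.distrib sum_distrib_left mult.assoc)
    show "norm (cone_integral c g y - cone_integral c g h - ?D (y - h)) / norm (y - h) \<le> C * norm (y - h)"
      if "y \<noteq> h" "dist y h < 1" for y
      using main[OF that(2)] that(1)
      by (simp add: pos_divide_le_eq power2_eq_square mult.assoc)
    show "((\<lambda>y. C * norm (y - h)) \<longlongrightarrow> 0) (at h)"
      by (auto intro!: tendsto_eq_intros)
  qed simp
qed

lemma partial_diff_cone_integral:
  assumes "test_function g"
  shows "partial_diff i (cone_integral c g) = cone_integral c (dird (w i) g)"
  by (rule ext) (simp add: partial_diff_eq_dird dird_eq[OF cone_integral_has_derivative[OF assms]]
    axis_def if_distrib[of "\<lambda>x. x * _"] cong: if_cong)

text \<open>Partial derivatives of cone integrals are cone integrals of derivatives of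
  \<open>g\<close>, so these functions form a class closed under differentiation.\<close>

lemma smooth_cone_integral:
  assumes "test_function g"
  shows "smooth_on UNIV (cone_integral c g)"
proof (rule smooth_on_coinduct[where P = "\<lambda>F. \<exists>g. test_function g \<and> F = cone_integral c g"])
  fix F assume "\<exists>g. test_function g \<and> F = cone_integral c g"
  then obtain g where g: "test_function g" "F = cone_integral c g" by blast
  have "F differentiable_on UNIV"
    using cone_integral_has_derivative[OF g(1)]
    by (auto simp: g(2) differentiable_on_def differentiable_def)
  moreover have "\<exists>F'. (\<exists>g. test_function g \<and> F' = cone_integral c g) \<and> (\<forall>x\<in>UNIV. partial_diff i F x = F' x)" for i
    by (intro exI[of _ "partial_diff i F"] conjI exI[of _ "dird (w i) g"])
      (simp_all add: g test_function_dird partial_diff_cone_integral)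
  ultimately show "F differentiable_on UNIV \<and>
      (\<forall>i. \<exists>F'. (\<exists>g. test_function g \<and> F' = cone_integral c g) \<and> (\<forall>x\<in>UNIV. partial_diff i F x = F' x))"
    by blast
qed (use assms in auto)

lemma multi_diff_cone_integral:
  assumes "test_function g"
  shows "multi_diff \<alpha> (cone_integral c g) =
    cone_integral c (foldr (\<lambda>i. dird (w i) ^^ \<alpha> i) (sorted_list_of_set UNIV) g)"
proof -
  have pow: "(partial_diff i ^^ a) (cone_integral c g) = cone_integral c ((dird (w i) ^^ a) g)"
    if "test_function g" for i a g
    using that by (induction a) (simp_all add: partial_diff_cone_integral test_function_dird_funpow)
  have "test_function (foldr (\<lambda>i. dird (w i) ^^ \<alpha> i) xs g) \<and>
    foldr (\<lambda>i. partial_diff i ^^ \<alpha> i) xs (cone_integral c g) =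
    cone_integral c (foldr (\<lambda>i. dird (w i) ^^ \<alpha> i) xs g)" for xs
    by (induction xs) (auto simp: assms pow test_function_dird_funpow)
  then show ?thesis by (simp add: multi_diff_def)
qed

text \<open>The list over \<open>J\<close> is extended to all indices by trivial Todd operators and
  multiplied out; each product of derivatives of \<open>g\<close>, integrated over the cone, is a
  derivative at 0 with respect to the shifts.\<close>

lemma todd_cone_expand:
  assumes g: "test_function g" and M: "M \<ge> 1"
  shows "(LINT x:cone (\<lambda>j. of_int (c j))|lborel. foldr (\<lambda>i. todd_trunc M e (w i)) js g x) =
    (\<Sum>\<alpha>\<in>PiE UNIV (\<lambda>_. {..<M}). todd_coeff \<alpha> * e ^ multi_order \<alpha> * multi_diff \<alpha> (cone_integral c g) 0)"
proof -
  let ?xs = "sorted_list_of_set (UNIV :: 'd set)"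
  let ?D = "\<lambda>\<alpha>. foldr (\<lambda>i. dird (w i) ^^ \<alpha> i) ?xs g"
  have D: "test_function (foldr (\<lambda>i. dird (w i) ^^ \<alpha> i) xs g)" for \<alpha> xs
    by (induction xs) (auto intro: test_function_dird_funpow g)
  have "foldr (\<lambda>i. todd_trunc M e (w i)) (filter (\<lambda>j. j \<in> J) xs) g = foldr (\<lambda>i. todd_trunc M e (w i)) xs g" for xs
    by (induction xs) (auto simp: w_outside todd_trunc_0[OF M])
  then have "foldr (\<lambda>i. todd_trunc M e (w i)) js g = foldr (\<lambda>i. todd_trunc M e (w i)) ?xs g"
    by (simp add: js_def)
  also have "\<dots> = (\<lambda>x. \<Sum>\<alpha>\<in>PiE UNIV (\<lambda>_. {..<M}). (\<Prod>i\<in>UNIV. todd1 (\<alpha> i) * e ^ \<alpha> i) * ?D \<alpha> x)"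
    using foldr_todd_trunc_expand[OF g, of ?xs M e w] by simp
  finally have "(LINT x:cone (\<lambda>j. of_int (c j))|lborel. foldr (\<lambda>i. todd_trunc M e (w i)) js g x) =
      (\<Sum>\<alpha>\<in>PiE UNIV (\<lambda>_. {..<M}). (\<Prod>i\<in>UNIV. todd1 (\<alpha> i) * e ^ \<alpha> i) *
        (LINT x:cone (\<lambda>j. of_int (c j))|lborel. ?D \<alpha> x))"
    by (simp only: set_integral_lincomb[OF D borel_cone])
  also have "\<dots> = (\<Sum>\<alpha>\<in>PiE UNIV (\<lambda>_. {..<M}). todd_coeff \<alpha> * e ^ multi_order \<alpha> * multi_diff \<alpha> (cone_integral c g) 0)"
    by (intro sum.cong refl) (simp add: todd_coeff_eq multi_order_def prod.distrib power_sum
      multi_diff_cone_integral[OF g] cone_integral_def linear_0[OF shift_map_linear])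
  finally show ?thesis .
qed

text \<open>Combines the lattice sum with the expansion of the Todd integral. The box of exponents
  below \<open>M\<close> contains all multi-indices of total order below \<open>M\<close>, and the
  surplus terms are of order N^-M.\<close>

lemma vertex_asymptotic:
  assumes g: "test_function g"
  shows "todd_asymptotic (\<lambda>N. 1 / real N ^ CARD('n) * (\<Sum>k | k \<in> int_lattice \<and>
      k /\<^sub>R real N \<in> cone (\<lambda>j. of_int (c j)) \<and> g (k /\<^sub>R real N) \<noteq> 0. g (k /\<^sub>R real N)))
      (cone_integral c g)"
proof -
  let ?S = "\<lambda>N::nat. 1 / real N ^ CARD('n) * (\<Sum>k | k \<in> int_lattice \<and>
      k /\<^sub>R real N \<in> cone (\<lambda>j. of_int (c j)) \<and> g (k /\<^sub>R real N) \<noteq> 0. g (k /\<^sub>R real N))"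
  let ?t = "\<lambda>N \<alpha>. todd_coeff \<alpha> * (1 / real N ^ multi_order \<alpha>) * multi_diff \<alpha> (cone_integral c g) 0"
  have pos: "\<exists>C. \<forall>N::nat. N \<ge> 1 \<longrightarrow> \<bar>?S N - (\<Sum>\<alpha> | multi_order \<alpha> < M. ?t N \<alpha>)\<bar> \<le> C * (1 / real N ^ M)"
    if M: "M \<ge> 1" for M
  proof -
    obtain C where C: "\<And>N::nat. N \<ge> 1 \<Longrightarrow>
      \<bar>(LINT x:cone (\<lambda>j. of_int (c j))|lborel. foldr (\<lambda>i. todd_trunc M (1 / real N) (w i)) js g x) - ?S N\<bar>
        \<le> C * (1 / real N ^ M)"
      using cone_lattice_sum[OF g M, of "\<lambda>j. of_int (c j)"] Ints_of_int by blast
    let ?A = "PiE UNIV (\<lambda>_. {..<M}) :: ('d \<Rightarrow> nat) set"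
    let ?L = "{\<alpha> :: 'd \<Rightarrow> nat. multi_order \<alpha> < M}"
    have finA: "finite ?A" by (intro finite_PiE) auto
    have "\<alpha> i \<le> multi_order \<alpha>" for \<alpha> :: "'d \<Rightarrow> nat" and i
      unfolding multi_order_def by (rule member_le_sum) auto
    then have LA: "?L \<subseteq> ?A"
      by (auto simp: PiE_def intro: le_less_trans)
    \<comment> \<open>Bounds the terms of the box whose total order is at least \<open>M\<close>;
      each of them carries a factor at most N^-M.\<close>
    define K where "K = (\<Sum>\<alpha>\<in>?A - ?L. \<bar>todd_coeff \<alpha> * multi_diff \<alpha> (cone_integral c g) 0\<bar>)"
    have "\<bar>?S N - (\<Sum>\<alpha>\<in>?L. ?t N \<alpha>)\<bar> \<le> (C + K) * (1 / real N ^ M)" if N: "N \<ge> 1" for N :: nat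
    proof -
      have "(\<Sum>\<alpha>\<in>?A. ?t N \<alpha>) = (\<Sum>\<alpha>\<in>?A - ?L. ?t N \<alpha>) + (\<Sum>\<alpha>\<in>?L. ?t N \<alpha>)"
        using finA LA by (rule sum.subset_diff[symmetric, THEN sym, rotated])
      moreover have "\<bar>\<Sum>\<alpha>\<in>?A - ?L. ?t N \<alpha>\<bar> \<le> K * (1 / real N ^ M)"
        unfolding K_def sum_distrib_right
      proof (rule order_trans[OF sum_abs sum_mono])
        fix \<alpha> assume "\<alpha> \<in> ?A - ?L"
        then have "1 / real N ^ multi_order \<alpha> \<le> 1 / real N ^ M"
          using N by (intro divide_left_mono power_increasing) auto
        then have "\<bar>todd_coeff \<alpha> * multi_diff \<alpha> (cone_integral c g) 0\<bar> * (1 / real N ^ multi_order \<alpha>)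
          \<le> \<bar>todd_coeff \<alpha> * multi_diff \<alpha> (cone_integral c g) 0\<bar> * (1 / real N ^ M)"
          by (rule mult_left_mono) simp
        then show "\<bar>?t N \<alpha>\<bar> \<le> \<bar>todd_coeff \<alpha> * multi_diff \<alpha> (cone_integral c g) 0\<bar> * (1 / real N ^ M)"
          by (simp add: abs_mult mult_ac)
      qed
      moreover have "\<bar>(\<Sum>\<alpha>\<in>?A. ?t N \<alpha>) - ?S N\<bar> \<le> C * (1 / real N ^ M)"
        using C[OF N] unfolding todd_cone_expand[OF g M] power_one_over .
      ultimately show ?thesis unfolding distrib_right by linarith
    qed
    then show ?thesis by blast
  qed
  \<comment> \<open>For M = 0 the expansion is empty and boundedness has to be shown. It follows
    from M = 1, where only the multi-index 0 occurs and contributes a constant.\<close>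
  have all: "\<exists>C. \<forall>N::nat. N \<ge> 1 \<longrightarrow> \<bar>?S N - (\<Sum>\<alpha> | multi_order \<alpha> < M. ?t N \<alpha>)\<bar> \<le> C * (1 / real N ^ M)" for M
  proof (cases "M = 0")
    case True
    obtain C where C: "\<And>N::nat. N \<ge> 1 \<Longrightarrow>
      \<bar>?S N - (\<Sum>\<alpha> | multi_order \<alpha> < 1. ?t N \<alpha>)\<bar> \<le> C * (1 / real N ^ 1)"
      using pos[of 1] by blast
    define K where "K = (\<Sum>\<alpha> | multi_order \<alpha> < 1. todd_coeff \<alpha> * multi_diff \<alpha> (cone_integral c g) 0)"
    have "\<bar>?S N\<bar> \<le> \<bar>C\<bar> + \<bar>K\<bar>" if N: "N \<ge> 1" for N :: nat
    proof -
      have "(\<Sum>\<alpha> | multi_order \<alpha> < 1. ?t N \<alpha>) = K"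
        unfolding K_def by (intro sum.cong) auto
      moreover have "C * (1 / real N ^ 1) \<le> \<bar>C\<bar> * 1"
        using N by (intro mult_mono) auto
      ultimately show ?thesis using C[OF N] by linarith
    qed
    then show ?thesis using True by (intro exI[of _ "\<bar>C\<bar> + \<bar>K\<bar>"]) simp
  qed (use pos in auto)
  have "(\<lambda>N. ?S N - (\<Sum>\<alpha> | multi_order \<alpha> < M. ?t N \<alpha>)) \<in> O(\<lambda>N. 1 / real N ^ M)" for M
  proof -
    obtain C where C: "\<And>N::nat. N \<ge> 1 \<Longrightarrow>
      \<bar>?S N - (\<Sum>\<alpha> | multi_order \<alpha> < M. ?t N \<alpha>)\<bar> \<le> C * (1 / real N ^ M)"
      using all by blast
    show ?thesis
      by (rule bigoI[where c = C], rule eventually_sequentiallyI[of 1]) (use C in simp)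
  qed
  then show ?thesis
    unfolding todd_asymptotic_def using smooth_cone_integral[OF g] by blast
qed

end

section \<open>Locality and additivity of the asymptotic relation\<close>

text \<open>What iterated partial derivatives retain when functions are known to be smooth on
  \<open>U\<close> only. Stated for operators, the three properties pass to compositions and hence
  to \<open>multi_diff\<close>.\<close>

definition smooth_op ::
  "(real^'k::finite) set \<Rightarrow> ((real^'k \<Rightarrow> real) \<Rightarrow> real^'k \<Rightarrow> real) \<Rightarrow> bool" where
  "smooth_op U Q \<longleftrightarrow>
     (\<forall>f. smooth_on U f \<longrightarrow> smooth_on U (Q f)) \<and>
     (\<forall>f g. (\<forall>x\<in>U. f x = g x) \<longrightarrow> (\<forall>x\<in>U. Q f x = Q g x)) \<and>
     (\<forall>f g. smooth_on U f \<longrightarrow> smooth_on U g \<longrightarrow> (\<forall>x\<in>U. Q (\<lambda>x. f x + g x) x = Q f x + Q g x))"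

lemma smooth_opD:
  assumes "smooth_op U Q"
  shows "smooth_on U f \<Longrightarrow> smooth_on U (Q f)"
    and "(\<And>x. x \<in> U \<Longrightarrow> f x = g x) \<Longrightarrow> x \<in> U \<Longrightarrow> Q f x = Q g x"
    and "smooth_on U f \<Longrightarrow> smooth_on U g \<Longrightarrow> x \<in> U \<Longrightarrow> Q (\<lambda>x. f x + g x) x = Q f x + Q g x"
  using assms unfolding smooth_op_def by blast+

lemma smooth_op_id: "smooth_op U (\<lambda>f. f)"
  by (simp add: smooth_op_def)

text \<open>Additivity of the composite uses locality of \<open>P\<close>: the inner operator is
  additive on \<open>U\<close> only, not as an identity between total functions.\<close>

lemma smooth_op_compose:
  assumes P: "smooth_op U P" and Q: "smooth_op U Q"
  shows "smooth_op U (\<lambda>f. P (Q f))"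
  unfolding smooth_op_def
proof (intro conjI allI impI ballI)
  show "smooth_on U (P (Q f))" if "smooth_on U f" for f
    using that by (intro smooth_opD(1)[OF P] smooth_opD(1)[OF Q])
  show "P (Q f) x = P (Q g) x" if "\<forall>x\<in>U. f x = g x" "x \<in> U" for f g x
    using that by (intro smooth_opD(2)[OF P] smooth_opD(2)[OF Q]) auto
  show "P (Q (\<lambda>x. f x + g x)) x = P (Q f) x + P (Q g) x"
    if "smooth_on U f" "smooth_on U g" "x \<in> U" for f g x
  proof -
    have "P (Q (\<lambda>x. f x + g x)) x = P (\<lambda>x. Q f x + Q g x) x"
      using that by (intro smooth_opD(2)[OF P] smooth_opD(3)[OF Q])
    then show ?thesis
      using smooth_opD(3)[OF P smooth_opD(1)[OF Q that(1)] smooth_opD(1)[OF Q that(2)] that(3)] by simp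
  qed
qed

lemma smooth_op_partial_diff:
  assumes "open U"
  shows "smooth_op U (partial_diff i)"
  unfolding smooth_op_def
proof (intro conjI allI impI ballI)
  show "smooth_on U (partial_diff i f)" if "smooth_on U f" for f
    using that by (rule smooth_on_partial_diff)
  show "partial_diff i f x = partial_diff i g x" if "\<forall>x\<in>U. f x = g x" "x \<in> U" for f g x
    using that assms unfolding partial_diff_eq_dird by (intro dird_cong_open[of U]) auto
  show "partial_diff i (\<lambda>x. f x + g x) x = partial_diff i f x + partial_diff i g x"
    if "smooth_on U f" "smooth_on U g" "x \<in> U" for f g x
    using that unfolding partial_diff_eq_dird by (intro dird_add smooth_on_differentiable)
qed

lemma smooth_op_multi_diff:
  assumes "open U"
  shows "smooth_op U (multi_diff \<alpha>)"
proof -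
  have pow: "smooth_op U (partial_diff i ^^ a)" for i a
  proof (induction a)
    case 0
    then show ?case using smooth_op_id by (simp add: id_def)
  next
    case (Suc a)
    then show ?case
      using smooth_op_compose[OF smooth_op_partial_diff[OF assms], of "partial_diff i ^^ a" i]
      by (simp add: o_def)
  qed
  have "smooth_op U (foldr (\<lambda>i. partial_diff i ^^ \<alpha> i) xs)" for xs
  proof (induction xs)
    case Nil
    then show ?case using smooth_op_id by (simp add: id_def)
  next
    case (Cons i xs)
    then show ?case
      using smooth_op_compose[OF pow] by (simp add: o_def)
  qed
  from this[of "sorted_list_of_set UNIV"] show ?thesis
    by (simp add: multi_diff_def[abs_def])
qed

lemma todd_asymptoticD:
  assumes "todd_asymptotic S F"
  shows "(\<lambda>N. S N - (\<Sum>\<alpha> | multi_order \<alpha> < M.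
      todd_coeff \<alpha> * (1 / real N ^ multi_order \<alpha>) * multi_diff \<alpha> F 0)) \<in> O(\<lambda>N. 1 / real N ^ M)"
  using assms unfolding todd_asymptotic_def by blast

text \<open>The relation sees only the germ of the function at 0 and the tail of the sequence. This
  is what allows the polytope to be exchanged for a vertex cone.\<close>

lemma todd_asymptotic_cong:
  assumes "todd_asymptotic S F" "\<And>N. N \<ge> 1 \<Longrightarrow> S' N = S N"
    and V: "open V" "0 \<in> V" "\<And>h. h \<in> V \<Longrightarrow> F' h = F h"
  shows "todd_asymptotic S' F'"
proof -
  obtain U where U: "0 \<in> U" "smooth_on U F"
    using assms(1) by (auto simp: todd_asymptotic_def)
  have "smooth_on (U \<inter> V) F"
    using U V(1) smooth_on_open by (intro smooth_on_subset[OF U(2)]) auto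
  then have "smooth_on (U \<inter> V) F'"
    by (rule smooth_on_cong) (simp add: V(3))
  moreover have "multi_diff \<alpha> F' 0 = multi_diff \<alpha> F 0" for \<alpha>
    by (rule smooth_opD(2)[OF smooth_op_multi_diff[OF V(1)] V(3) V(2)])
  moreover have "(\<lambda>N. S' N - (\<Sum>\<alpha> | multi_order \<alpha> < M.
      todd_coeff \<alpha> * (1 / real N ^ multi_order \<alpha>) * multi_diff \<alpha> F 0)) \<in> O(\<lambda>N. 1 / real N ^ M)" for M
  proof -
    have "\<forall>\<^sub>F N in sequentially. S' N - (\<Sum>\<alpha> | multi_order \<alpha> < M.
        todd_coeff \<alpha> * (1 / real N ^ multi_order \<alpha>) * multi_diff \<alpha> F 0) = S N - (\<Sum>\<alpha> | multi_order \<alpha> < M.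
        todd_coeff \<alpha> * (1 / real N ^ multi_order \<alpha>) * multi_diff \<alpha> F 0)"
      by (rule eventually_sequentiallyI[of 1]) (simp add: assms(2))
    from landau_o.big.in_cong[OF this] show ?thesis
      using todd_asymptoticD[OF assms(1)] by blast
  qed
  ultimately show ?thesis
    using U(1) V(2) unfolding todd_asymptotic_def by auto
qed

lemma todd_asymptotic_add:
  assumes "todd_asymptotic S F" "todd_asymptotic S' F'"
  shows "todd_asymptotic (\<lambda>N. S N + S' N) (\<lambda>h. F h + F' h)"
proof -
  obtain U U' where U: "0 \<in> U" "smooth_on U F" "0 \<in> U'" "smooth_on U' F'"
    using assms by (auto simp: todd_asymptotic_def)
  have op: "open (U \<inter> U')" using U smooth_on_open by blast
  have s: "smooth_on (U \<inter> U') F" "smooth_on (U \<inter> U') F'"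
    using smooth_on_subset[OF U(2) op] smooth_on_subset[OF U(4) op] by auto
  have md: "multi_diff \<alpha> (\<lambda>h. F h + F' h) 0 = multi_diff \<alpha> F 0 + multi_diff \<alpha> F' 0" for \<alpha>
    using U by (intro smooth_opD(3)[OF smooth_op_multi_diff[OF op] s]) auto
  have "(\<lambda>N. S N + S' N - (\<Sum>\<alpha> | multi_order \<alpha> < M.
        todd_coeff \<alpha> * (1 / real N ^ multi_order \<alpha>) * multi_diff \<alpha> (\<lambda>h. F h + F' h) 0))
      \<in> O(\<lambda>N. 1 / real N ^ M)" for M
  proof -
    have "(\<lambda>N. (S N - (\<Sum>\<alpha> | multi_order \<alpha> < M.
          todd_coeff \<alpha> * (1 / real N ^ multi_order \<alpha>) * multi_diff \<alpha> F 0)) +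
        (S' N - (\<Sum>\<alpha> | multi_order \<alpha> < M.
          todd_coeff \<alpha> * (1 / real N ^ multi_order \<alpha>) * multi_diff \<alpha> F' 0)))
      \<in> O(\<lambda>N. 1 / real N ^ M)"
      by (rule sum_in_bigo[OF todd_asymptoticD[OF assms(1)] todd_asymptoticD[OF assms(2)]])
    then show ?thesis
      by (simp add: md distrib_left sum.distrib algebra_simps)
  qed
  moreover have "\<exists>U. 0 \<in> U \<and> smooth_on U (\<lambda>h. F h + F' h)"
    using smooth_on_add[OF s] U by blast
  ultimately show ?thesis
    unfolding todd_asymptotic_def by blast
qed

lemma todd_asymptotic_0: "todd_asymptotic (\<lambda>N. 0) (\<lambda>h::real^'d::{finite,linorder}. 0)"
proof -
  have pow: "(partial_diff i ^^ a) (\<lambda>h::real^'d::{finite,linorder}. 0) = (\<lambda>h. 0)" for i a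
    by (induction a) (auto simp: partial_diff_eq_dird)
  have "foldr (\<lambda>i. partial_diff i ^^ \<alpha> i) xs (\<lambda>h::real^'d::{finite,linorder}. 0) = (\<lambda>h. 0)" for \<alpha> xs
    by (induction xs) (simp_all add: pow)
  then have "multi_diff \<alpha> (\<lambda>h::real^'d::{finite,linorder}. 0) = (\<lambda>h. 0)" for \<alpha>
    unfolding multi_diff_def .
  then show ?thesis
    unfolding todd_asymptotic_def using smooth_on_const[OF open_UNIV] by auto
qed

section \<open>Smooth cutoff functions\<close>

text \<open>The classical flat function exp(-1/t), extended by 0; the polynomial factor in 1/t makes
  the family closed under differentiation.\<close>

definition flat_exp :: "real poly \<Rightarrow> real \<Rightarrow> real" where
  "flat_exp p t = (if t > 0 then poly p (1 / t) * exp (- (1 / t)) else 0)"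

lemma poly_times_exp_tendsto_0: "((\<lambda>s::real. poly p s * exp (- s)) \<longlongrightarrow> 0) at_top"
proof -
  have "((\<lambda>s::real. \<Sum>i\<le>degree p. coeff p i * (s ^ i / exp s)) \<longlongrightarrow> (\<Sum>i\<le>degree p. coeff p i * 0)) at_top"
    by (intro tendsto_intros tendsto_power_div_exp_0)
  moreover have "(\<lambda>s::real. \<Sum>i\<le>degree p. coeff p i * (s ^ i / exp s)) = (\<lambda>s. poly p s * exp (- s))"
    by (simp add: fun_eq_iff poly_altdef sum_distrib_right exp_minus divide_inverse mult.assoc)
  ultimately show ?thesis by simp
qed

text \<open>With s = 1/t one has ds/dt = -s^2, so p(s) exp(-s) has the derivative s^2 (p - p')(s)
  exp(-s). At 0 the right-hand difference quotient is s p(s) exp(-s), which tends to 0 as s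
  grows.\<close>

lemma flat_exp_has_derivative:
  "(flat_exp p has_real_derivative flat_exp ([:0, 0, 1:] * (p - pderiv p)) t) (at t)"
proof -
  consider "t > 0" | "t < 0" | "t = 0" by linarith
  then show ?thesis
  proof cases
    case 1
    have "((\<lambda>t. poly p (1 / t) * exp (- (1 / t))) has_real_derivative
        flat_exp ([:0, 0, 1:] * (p - pderiv p)) t) (at t)"
      using 1 by (auto intro!: derivative_eq_intros DERIV_chain2[OF poly_DERIV]
          simp: flat_exp_def power2_eq_square field_simps)
    then show ?thesis
      by (rule has_field_derivative_transform_within_open[where S = "{0<..}"])
        (use 1 in \<open>auto simp: flat_exp_def\<close>)
  next
    case 2
    have "((\<lambda>t. 0) has_real_derivative flat_exp ([:0, 0, 1:] * (p - pderiv p)) t) (at t)"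
      using 2 by (simp add: flat_exp_def)
    then show ?thesis
      by (rule has_field_derivative_transform_within_open[where S = "{..<0}"])
        (use 2 in \<open>auto simp: flat_exp_def\<close>)
  next
    case 3
    have "((\<lambda>t. flat_exp p t / t) \<longlongrightarrow> 0) (at_left 0)"
      by (rule tendsto_eventually) (auto simp: eventually_at_left_field flat_exp_def intro: exI[of _ "-1"])
    moreover have "((\<lambda>t. flat_exp p t / t) \<longlongrightarrow> 0) (at_right 0)"
    proof -
      \<comment> \<open>\<open>pCons 0 p\<close> is p multiplied by the variable, which accounts for
        the division by \<open>t\<close>.\<close>
      have "((\<lambda>t. poly (pCons 0 p) (inverse t) * exp (- inverse t)) \<longlongrightarrow> 0) (at_right (0::real))"
        by (rule filterlim_compose[OF poly_times_exp_tendsto_0 filterlim_inverse_at_top_right])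
      moreover have "\<forall>\<^sub>F t in at_right (0::real). poly (pCons 0 p) (inverse t) * exp (- inverse t) = flat_exp p t / t"
        by (auto simp: eventually_at_right_field flat_exp_def field_simps intro: exI[of _ 1])
      ultimately show ?thesis by (rule Lim_transform_eventually)
    qed
    ultimately have "((\<lambda>t. flat_exp p t / t) \<longlongrightarrow> 0) (at 0)"
      by (simp add: filterlim_at_split)
    then show ?thesis
      using 3 by (simp add: has_field_derivative_iff flat_exp_def)
  qed
qed

text \<open>Composed with an affine function, a partial derivative changes the polynomial and
  multiplies by a component of \<open>v\<close>; the constant factor \<open>k\<close> in the
  invariant family absorbs the latter.\<close>

lemma smooth_flat_exp: "smooth_on UNIV (\<lambda>x::real^'n. flat_exp p (a + v \<bullet> x))"
proof -
  let ?P = "\<lambda>F::real^'n \<Rightarrow> real. \<exists>k p. F = (\<lambda>x. k * flat_exp p (a + v \<bullet> x))"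
  have "smooth_on UNIV (\<lambda>x::real^'n. 1 * flat_exp p (a + v \<bullet> x))"
  proof (rule smooth_on_coinduct[where P = ?P])
    fix F assume "?P F"
    then obtain k p where F: "F = (\<lambda>x. k * flat_exp p (a + v \<bullet> x))" by blast
    define q where "q = [:0, 0, 1:] * (p - pderiv p)"
    have der: "(F has_derivative (\<lambda>w. k * (flat_exp q (a + v \<bullet> x) * (v \<bullet> w)))) (at x)" for x
    proof -
      have "((\<lambda>x. a + v \<bullet> x) has_derivative (\<lambda>w. v \<bullet> w)) (at x)"
        by (auto intro!: derivative_eq_intros)
      moreover have "(flat_exp p has_derivative (*) (flat_exp q (a + v \<bullet> x))) (at (a + v \<bullet> x))"
        using flat_exp_has_derivative unfolding has_field_derivative_def q_def .
      ultimately have "((\<lambda>x. flat_exp p (a + v \<bullet> x)) has_derivative (\<lambda>w. flat_exp q (a + v \<bullet> x) * (v \<bullet> w))) (at x)"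
        by (rule has_derivative_compose)
      then show ?thesis unfolding F by (rule has_derivative_mult_right)
    qed
    then have "F differentiable_on UNIV"
      by (auto simp: differentiable_on_def differentiable_def)
    moreover have "partial_diff i F x = (k * v $ i) * flat_exp q (a + v \<bullet> x)" for i x
      by (simp add: partial_diff_eq_dird dird_eq[OF der] inner_axis)
    ultimately show "F differentiable_on UNIV \<and> (\<forall>i. \<exists>F'. ?P F' \<and> (\<forall>x\<in>UNIV. partial_diff i F x = F' x))"
      by blast
  qed (rule open_UNIV, rule exI[of _ 1], rule exI[of _ p], rule refl)
  then show ?thesis by simp
qed

text \<open>Rises from 0 for t at most e to 1 for t at least 2e, where the second summand of the
  denominator vanishes.\<close>

definition smooth_step :: "real \<Rightarrow> real \<Rightarrow> real" where
  "smooth_step e t = flat_exp 1 (t - e) * inverse (flat_exp 1 (t - e) + flat_exp 1 (2 * e - t))"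

lemma flat_exp_1_pos: "flat_exp 1 t \<ge> 0" "t > 0 \<Longrightarrow> flat_exp 1 t > 0"
  by (simp_all add: flat_exp_def)

text \<open>The two arguments add up to e > 0, so at least one of them is positive.\<close>

lemma smooth_step_denominator: "e > 0 \<Longrightarrow> flat_exp 1 (t - e) + flat_exp 1 (2 * e - t) > 0"
  using flat_exp_1_pos[of "t - e"] flat_exp_1_pos[of "2 * e - t"]
  by (cases "t > e") (auto intro: add_pos_nonneg add_nonneg_pos)

lemma smooth_step_0: "t \<le> e \<Longrightarrow> smooth_step e t = 0"
  by (simp add: smooth_step_def flat_exp_def)

lemma smooth_step_1: "e > 0 \<Longrightarrow> t \<ge> 2 * e \<Longrightarrow> smooth_step e t = 1"
  using smooth_step_denominator[of e t] by (simp add: smooth_step_def flat_exp_def[of _ "2 * e - t"])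

lemma smooth_on_smooth_step:
  fixes v :: "real^'n"
  assumes "e > 0"
  shows "smooth_on UNIV (\<lambda>x. smooth_step e (a - v \<bullet> x))"
proof -
  have 1: "smooth_on UNIV (\<lambda>x. flat_exp 1 (a - v \<bullet> x - e))"
    using smooth_flat_exp[of 1 "a - e" "- v"] by (simp add: algebra_simps)
  have 2: "smooth_on UNIV (\<lambda>x. flat_exp 1 (2 * e - (a - v \<bullet> x)))"
    using smooth_flat_exp[of 1 "2 * e - a" v] by (simp add: algebra_simps)
  show ?thesis
    unfolding smooth_step_def
    by (intro smooth_on_mult smooth_on_inverse smooth_on_add 1 2)
      (use smooth_step_denominator[OF assms] in \<open>simp add: less_imp_neq[symmetric]\<close>)
qed

section \<open>Simple regular lattice polytopes\<close>

lemma finite_int_lattice_bounded: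
  assumes "bounded A"
  shows "finite (int_lattice \<inter> A :: (real^'n) set)"
proof -
  obtain B where B: "\<And>x. x \<in> A \<Longrightarrow> norm x \<le> B"
    using assms bounded_iff by blast
  have "int_lattice \<inter> A \<subseteq> (\<lambda>f :: 'n \<Rightarrow> int. \<chi> i. (of_int (f i) :: real)) ` PiE UNIV (\<lambda>_. {- \<lceil>B\<rceil>..\<lceil>B\<rceil>})"
  proof
    fix x :: "real^'n" assume x: "x \<in> int_lattice \<inter> A"
    have "x = (\<chi> i. of_int \<lfloor>x $ i\<rfloor>)"
      using x by (simp add: int_lattice_def vec_eq_iff)
    moreover have "(\<lambda>i. \<lfloor>x $ i\<rfloor>) \<in> PiE UNIV (\<lambda>_. {- \<lceil>B\<rceil>..\<lceil>B\<rceil>})"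
    proof -
      have "- \<lceil>B\<rceil> \<le> \<lfloor>x $ i\<rfloor> \<and> \<lfloor>x $ i\<rfloor> \<le> \<lceil>B\<rceil>" for i
      proof -
        have "\<bar>x $ i\<bar> \<le> B" using component_le_norm_cart[of x i] B[of x] x by simp
        then show ?thesis by linarith
      qed
      then show ?thesis by auto
    qed
    ultimately show "x \<in> (\<lambda>f :: 'n \<Rightarrow> int. \<chi> i. (of_int (f i) :: real)) ` PiE UNIV (\<lambda>_. {- \<lceil>B\<rceil>..\<lceil>B\<rceil>})"
      by (rule image_eqI[where x = "\<lambda>i. \<lfloor>x $ i\<rfloor>"])
  qed
  then show ?thesis
    by (rule finite_subset) (intro finite_imageI finite_PiE; simp)
qed

text \<open>A finite subfamily of an increasing family is contained in one member; the sum of the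
  indices is a convenient upper bound. It turns pointwise positive slacks into uniform ones.\<close>

lemma compact_increasing_cover:
  fixes Cov :: "nat \<Rightarrow> 'a::topological_space set"
  assumes "compact K" "\<And>m. open (Cov m)" "\<And>m n. m \<le> n \<Longrightarrow> Cov m \<subseteq> Cov n" "K \<subseteq> (\<Union>m. Cov m)"
  obtains m where "K \<subseteq> Cov m"
proof -
  obtain C where C: "finite C" "K \<subseteq> (\<Union>m\<in>C. Cov m)"
    using compactE_image[OF assms(1), of UNIV Cov] assms(2,4) by auto
  have "Cov m \<subseteq> Cov (\<Sum>C)" if "m \<in> C" for m
    using assms(3)[OF member_le_sum[of m C "\<lambda>m. m"]] that C(1) by simp
  with C(2) show ?thesis by (intro that[of "\<Sum>C"]) blast
qed

locale regular_polytope =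
  fixes P :: "(real^'n) set" and u :: "'d::{finite,linorder} \<Rightarrow> real^'n" and c :: "'d \<Rightarrow> int"
  assumes poly: "polytope P" and full_dim: "aff_dim P = int CARD('n)"
    and simple: "simple_polytope P" and presentation: "primitive_facet_presentation P u c"
    and regular: "regular_presentation u c"
begin

section \<open>Vertices, their normals and the dual lattice bases\<close>

definition active :: "real^'n \<Rightarrow> 'd set" where
  "active v = {i. u i \<bullet> v = of_int (c i)}"

lemma P_eq: "P = shifted_polyhedron u c 0"
  using presentation by (simp add: primitive_facet_presentation_def)

lemma mem_P: "x \<in> P \<longleftrightarrow> (\<forall>i. u i \<bullet> x \<le> of_int (c i))"
  by (simp add: P_eq shifted_polyhedron_def)

lemma mem_face_at: "x \<in> face_at u c I \<longleftrightarrow> x \<in> P \<and> I \<subseteq> active x"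
  by (auto simp: face_at_def P_eq active_def)

lemma u_lattice: "u i \<in> int_lattice"
  using presentation by (simp add: primitive_facet_presentation_def primitive_vector_def)

lemma compact_P: "compact P"
  using poly by (rule polytope_imp_compact)

text \<open>Simplicity is applied to the face {v}, of codimension n; the enumeration of the facets
  without repetition translates facets through \<open>v\<close> into active indices.\<close>

lemma vertex_face:
  assumes v: "v extreme_point_of P"
  shows "card (active v) = CARD('n)" "face_at u c (active v) = {v}"
proof -
  have vP: "v \<in> P" using v by (simp add: extreme_point_of_def)
  let ?F = "\<lambda>i. face_at u c {i}"
  have bij: "bij_betw ?F UNIV {H. H facet_of P}"
    using presentation unfolding primitive_facet_presentation_def by blast
  have facets: "{H. H facet_of P \<and> {v} \<subseteq> H} = ?F ` active v"
  proof (intro equalityI subsetI)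
    fix H assume H: "H \<in> {H. H facet_of P \<and> {v} \<subseteq> H}"
    then obtain i where "H = ?F i" using bij by (auto simp: bij_betw_def)
    with H show "H \<in> ?F ` active v" by (auto simp: mem_face_at)
  next
    fix H assume "H \<in> ?F ` active v"
    then obtain i where i: "H = ?F i" "i \<in> active v" by blast
    then have "H facet_of P" using bij by (auto simp: bij_betw_def)
    with i vP show "H \<in> {H. H facet_of P \<and> {v} \<subseteq> H}" by (auto simp: mem_face_at)
  qed
  have "{v} face_of P" using v by (simp add: face_of_singleton)
  then have s: "int (card {H. H facet_of P \<and> {v} \<subseteq> H}) = aff_dim P - aff_dim {v}"
    "{v} = P \<inter> \<Inter>{H. H facet_of P \<and> {v} \<subseteq> H}"
    using simple unfolding simple_polytope_def by blast+
  have "inj_on ?F (active v)"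
    using bij by (auto simp: bij_betw_def intro: inj_on_subset)
  then show "card (active v) = CARD('n)"
    using s(1) unfolding facets by (simp add: card_image full_dim)
  have "x = v" if "x \<in> face_at u c (active v)" for x
  proof -
    have "x \<in> P \<inter> \<Inter>(?F ` active v)"
      using that by (auto simp: mem_face_at)
    then show ?thesis using s(2) unfolding facets by blast
  qed
  moreover have "v \<in> face_at u c (active v)" using vP by (simp add: mem_face_at)
  ultimately show "face_at u c (active v) = {v}" by blast
qed

text \<open>A nonzero vector orthogonal to all active normals would allow \<open>v\<close> to move a
  little inside the polytope without leaving its facets, contradicting that these meet in
  \<open>v\<close> alone.\<close>

lemma span_active:
  assumes v: "v extreme_point_of P"
  shows "span (u ` active v) = UNIV"
proof (rule ccontr)
  assume "span (u ` active v) \<noteq> UNIV"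
  then obtain z where z: "z \<noteq> 0" "\<forall>x\<in>span (u ` active v). z \<bullet> x = 0"
    using span_not_UNIV_orthogonal by blast
  have vP: "v \<in> P" using v by (simp add: extreme_point_of_def)
  \<comment> \<open>A step of length at most \<open>r i\<close> respects the inactive constraint
    \<open>i\<close>; the added 1 avoids division by zero. The 1 inserted in \<open>t\<close> keeps
    the minimum defined even for an empty set of constraints.\<close>
  define r where "r i = (of_int (c i) - u i \<bullet> v) / (\<bar>u i \<bullet> z\<bar> + 1)" for i
  define t where "t = Min (insert 1 (r ` (- active v)))"
  have "r i > 0" if "i \<notin> active v" for i
    using that vP unfolding mem_P by (auto simp: r_def active_def less_le intro!: divide_pos_pos)
  then have t: "t > 0" "\<And>i. i \<notin> active v \<Longrightarrow> t \<le> r i"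
    by (auto simp: t_def)
  have "u i \<bullet> (v + t *\<^sub>R z) \<le> of_int (c i)" for i
  proof (cases "i \<in> active v")
    case True
    then have "z \<bullet> u i = 0" using z(2) by (blast intro: span_base)
    then have "u i \<bullet> z = 0" by (simp add: inner_commute)
    with True show ?thesis by (simp add: inner_add_right active_def)
  next
    case False
    have "t * (u i \<bullet> z) \<le> t * (\<bar>u i \<bullet> z\<bar> + 1)"
      using t(1) by (intro mult_left_mono) auto
    also have "\<dots> \<le> r i * (\<bar>u i \<bullet> z\<bar> + 1)"
      using t(2)[OF False] by (intro mult_right_mono) auto
    also have "\<dots> = of_int (c i) - u i \<bullet> v"
      by (simp add: r_def add_nonneg_eq_0_iff)
    finally show ?thesis by (simp add: inner_add_right)
  qed
  moreover have "active v \<subseteq> active (v + t *\<^sub>R z)"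
    using z(2) by (auto simp: active_def inner_add_right span_base inner_commute)
  ultimately have "v + t *\<^sub>R z \<in> face_at u c (active v)"
    by (simp add: mem_face_at mem_P)
  with vertex_face(2)[OF v] t(1) z(1) show False by simp
qed

text \<open>Since the active normals span the whole space, regularity makes them a basis of the full
  lattice Z^n, and the dual basis is found by expanding the standard basis vectors in it.\<close>

lemma vertex_dual_cone:
  assumes v: "v extreme_point_of P"
  obtains w where "dual_cone u w (active v)"
proof -
  let ?J = "active v"
  have "int (card ?J) = aff_dim (shifted_polyhedron u c 0) - aff_dim (face_at u c ?J)"
    using vertex_face[OF v] full_dim by (simp add: P_eq)
  then have "int_basis_on ?J u (span (u ` ?J) \<inter> int_lattice)"
    using regular vertex_face(2)[OF v] unfolding regular_presentation_def by blast
  then have ex: "\<And>x. x \<in> int_lattice \<Longrightarrow>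
      \<exists>!a :: 'd \<Rightarrow> int. (\<forall>i. i \<notin> ?J \<longrightarrow> a i = 0) \<and> x = (\<Sum>i\<in>?J. of_int (a i) *\<^sub>R u i)"
    by (simp add: span_active[OF v] int_basis_on_def)
  have "\<exists>a :: 'd \<Rightarrow> int. axis k 1 = (\<Sum>i\<in>?J. of_int (a i) *\<^sub>R u i)" for k :: 'n
  proof -
    have "axis k 1 \<in> (int_lattice :: (real^'n) set)" by (simp add: int_lattice_def axis_def)
    from ex[OF this] show ?thesis by blast
  qed
  then obtain a :: "'n \<Rightarrow> 'd \<Rightarrow> int" where a: "\<And>k. axis k 1 = (\<Sum>i\<in>?J. of_int (a k i) *\<^sub>R u i)"
    by metis
  \<comment> \<open>Coordinate \<open>k\<close> of \<open>w j\<close> is the coefficient of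
    \<open>u j\<close> in the \<open>k\<close>-th standard basis vector, hence an integer.\<close>
  define w :: "'d \<Rightarrow> real^'n" where "w j = (if j \<in> ?J then \<chi> k. of_int (a k j) else 0)" for j
  have w_lattice: "w j \<in> int_lattice" for j by (simp add: w_def int_lattice_def)
  have expand: "(\<Sum>j\<in>?J. (u j \<bullet> x) *\<^sub>R w j) = x" for x
  proof -
    have "(\<Sum>j\<in>?J. (u j \<bullet> x) *\<^sub>R w j) $ k = x $ k" for k
    proof -
      have "(\<Sum>j\<in>?J. (u j \<bullet> x) *\<^sub>R w j) $ k = (\<Sum>j\<in>?J. of_int (a k j) *\<^sub>R u j) \<bullet> x"
        by (simp add: w_def inner_sum_left mult.commute)
      also have "\<dots> = axis k 1 \<bullet> x" by (simp flip: a)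
      finally show ?thesis by (simp add: inner_axis')
    qed
    then show ?thesis by (simp add: vec_eq_iff)
  qed
  have dual: "u i \<bullet> w j = (if i = j then 1 else 0)" if i: "i \<in> ?J" and j: "j \<in> ?J" for i j
  proof -
    have "(u i - (\<Sum>j\<in>?J. (u i \<bullet> w j) *\<^sub>R u j)) \<bullet> x = 0" for x
    proof -
      have "u i \<bullet> x = u i \<bullet> (\<Sum>j\<in>?J. (u j \<bullet> x) *\<^sub>R w j)" by (simp add: expand)
      also have "\<dots> = (\<Sum>j\<in>?J. (u i \<bullet> w j) *\<^sub>R u j) \<bullet> x"
        by (simp add: inner_sum_right inner_sum_left mult.commute)
      finally show ?thesis by (simp add: inner_diff_left)
    qed
    then have "u i - (\<Sum>j\<in>?J. (u i \<bullet> w j) *\<^sub>R u j) = 0"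
      using inner_eq_zero_iff by blast
    then have ui: "u i = (\<Sum>j\<in>?J. (u i \<bullet> w j) *\<^sub>R u j)" by simp
    have int: "of_int \<lfloor>u i \<bullet> w j\<rfloor> = u i \<bullet> w j" for j
      using inner_int_lattice[OF u_lattice w_lattice] by simp
    let ?a = "\<lambda>j. if j \<in> ?J then \<lfloor>u i \<bullet> w j\<rfloor> else 0" and ?b = "\<lambda>j. if j = i then 1 else 0 :: int"
    \<comment> \<open>Duality comes from uniqueness of integer coordinates: the pairings with
      \<open>w\<close> and the Kronecker delta both represent \<open>u i\<close> in the
      basis.\<close>
    define Q where "Q a \<longleftrightarrow> (\<forall>j. j \<notin> ?J \<longrightarrow> a j = 0) \<and> u i = (\<Sum>j\<in>?J. of_int (a j) *\<^sub>R u j)"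
      for a :: "'d \<Rightarrow> int"
    have "Q ?a"
      using ui by (simp add: Q_def int)
    moreover have "Q ?b"
      unfolding Q_def
    proof
      show "\<forall>j. j \<notin> ?J \<longrightarrow> ?b j = 0" using i by auto
      have "(\<Sum>j\<in>?J. of_int (?b j) *\<^sub>R u j) = (\<Sum>j\<in>?J. if j = i then u j else 0)"
        by (intro sum.cong) auto
      then show "u i = (\<Sum>j\<in>?J. of_int (?b j) *\<^sub>R u j)" using i by simp
    qed
    moreover have "\<exists>!a. Q a" unfolding Q_def by (rule ex[OF u_lattice])
    ultimately have "?a = ?b" by blast
    then have "?a j = ?b j" by (rule fun_cong)
    then have "\<lfloor>u i \<bullet> w j\<rfloor> = (if i = j then 1 else 0)" using j by auto
    then show ?thesis by (subst int[symmetric]) simp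
  qed
  have "dual_cone u w ?J"
  proof unfold_locales
    show "w j = 0" if "j \<notin> ?J" for j using that by (simp add: w_def)
  qed (use vertex_face(1)[OF v] u_lattice w_lattice dual expand in simp_all)
  then show ?thesis by (rule that)
qed

text \<open>The points of the polytope lying on all facets through \<open>x\<close> form a nonempty
  compact convex set. It has an extreme point, which is extreme in the polytope too, as a segment
  through a point of this set has its endpoints there.\<close>

lemma vertex_covers:
  assumes "x \<in> P"
  obtains v where "v extreme_point_of P" "active x \<subseteq> active v"
proof -
  let ?G = "face_at u c (active x)"
  have G: "?G = P \<inter> (\<Inter>i\<in>active x. {y. u i \<bullet> y = of_int (c i)})"
    by (auto simp: mem_face_at active_def)
  have "compact ?G"
    unfolding G by (intro compact_Int_closed compact_P closed_INT ballI closed_hyperplane)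
  moreover have "convex ?G"
    unfolding G using poly by (intro convex_Int polytope_imp_convex convex_INT convex_hyperplane)
  moreover have "?G \<noteq> {}" using assms by (auto simp: mem_face_at)
  ultimately obtain v where v: "v extreme_point_of ?G"
    by (rule extreme_point_exists_convex)
  have vG: "v \<in> P" "active x \<subseteq> active v"
    using v by (auto simp: extreme_point_of_def mem_face_at)
  have "v extreme_point_of P"
    unfolding extreme_point_of_def
  proof (intro conjI ballI notI vG)
    fix a b assume ab: "a \<in> P" "b \<in> P" "v \<in> open_segment a b"
    then obtain t where t: "0 < t" "t < 1" "v = (1 - t) *\<^sub>R a + t *\<^sub>R b"
      by (auto simp: in_segment)
    have "u i \<bullet> a = of_int (c i) \<and> u i \<bullet> b = of_int (c i)" if "i \<in> active x" for i
    proof -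
      have le: "u i \<bullet> a \<le> of_int (c i)" "u i \<bullet> b \<le> of_int (c i)" using ab by (auto simp: mem_P)
      \<comment> \<open>A vanishing convex combination of nonnegative slacks forces both slacks to
        vanish.\<close>
      have "(1 - t) * (of_int (c i) - u i \<bullet> a) + t * (of_int (c i) - u i \<bullet> b) = 0"
        using vG(2) that by (auto simp: active_def t(3) inner_add_right algebra_simps)
      moreover have "(1 - t) * (of_int (c i) - u i \<bullet> a) \<ge> 0" "t * (of_int (c i) - u i \<bullet> b) \<ge> 0"
        using t(1,2) le by auto
      ultimately have "(1 - t) * (of_int (c i) - u i \<bullet> a) = 0" "t * (of_int (c i) - u i \<bullet> b) = 0"
        by linarith+
      with t(1,2) show ?thesis by simp
    qed
    then have "a \<in> ?G" "b \<in> ?G" using ab by (auto simp: mem_face_at active_def)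
    with v ab(3) show False by (auto simp: extreme_point_of_def)
  qed
  with vG(2) show ?thesis using that by blast
qed

text \<open>By \<open>vertex_covers\<close> each point has positive slack at all facets inactive at
  some vertex. The points where these slacks exceed 1/(m+1) for some vertex form open sets
  increasing with m, so compactness gives a margin valid on the whole polytope.\<close>

lemma vertex_margin:
  obtains e where "e > 0"
    "\<forall>x\<in>P. \<exists>v. v extreme_point_of P \<and> (\<forall>i. i \<notin> active v \<longrightarrow> e < of_int (c i) - u i \<bullet> x)"
proof -
  define Cov where "Cov m = (\<Union>v\<in>{v. v extreme_point_of P}. \<Inter>i\<in>- active v.
      {x. 1 / real (Suc m) < of_int (c i) - u i \<bullet> x})" for m
  obtain m where m: "P \<subseteq> Cov m"
  proof (rule compact_increasing_cover[OF compact_P])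
    show "open (Cov m)" for m
      unfolding Cov_def by (intro open_UN open_INT ballI open_Collect_less continuous_intros) auto
    show "Cov m \<subseteq> Cov n" if "m \<le> n" for m n
    proof -
      have "1 / real (Suc n) \<le> 1 / real (Suc m)" using that by (intro divide_left_mono) auto
      then show ?thesis unfolding Cov_def by (auto; meson le_less_trans)
    qed
    show "P \<subseteq> (\<Union>m. Cov m)"
    proof
      fix x assume x: "x \<in> P"
      then obtain v where v: "v extreme_point_of P" "active x \<subseteq> active v"
        by (rule vertex_covers)
      define d where "d = Min (insert 1 ((\<lambda>i. of_int (c i) - u i \<bullet> x) ` (- active v)))"
      have "of_int (c i) - u i \<bullet> x > 0" if "i \<notin> active v" for i
      proof -
        have "i \<notin> active x" using v(2) that by blast
        with x show ?thesis by (simp add: mem_P active_def less_le)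
      qed
      then have "d > 0" and d: "\<And>i. i \<notin> active v \<Longrightarrow> d \<le> of_int (c i) - u i \<bullet> x"
        by (auto simp: d_def)
      obtain m where "1 / real (Suc m) < d"
        using nat_approx_posE[OF \<open>d > 0\<close>] by auto
      with d v(1) show "x \<in> (\<Union>m. Cov m)"
        unfolding Cov_def by (auto intro!: exI[of _ m] exI[of _ v] intro: less_le_trans)
    qed
  qed
  show ?thesis
  proof (rule that[of "1 / real (Suc m)"]; (intro ballI)?)
    show "\<exists>v. v extreme_point_of P \<and> (\<forall>i. i \<notin> active v \<longrightarrow> 1 / real (Suc m) < of_int (c i) - u i \<bullet> x)"
      if "x \<in> P" for x
      using m that unfolding Cov_def by blast
  qed simp
qed

section \<open>From vertex cones to the polytope\<close>

abbreviation volume :: "(real^'n \<Rightarrow> real) \<Rightarrow> (real, 'd) vec \<Rightarrow> real" where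
  "volume f \<equiv> \<lambda>h. set_lebesgue_integral lborel (shifted_polyhedron u c h) f"

lemma borel_shifted_polyhedron [measurable]: "shifted_polyhedron u c h \<in> sets borel"
proof -
  have "Measurable.pred borel (\<lambda>x. \<forall>i. u i \<bullet> x \<le> of_int (c i) + h $ i)" by measurable
  then show ?thesis by (simp add: shifted_polyhedron_def pred_def)
qed

lemma open_small_shifts: "open {h :: (real, 'd) vec. \<forall>i. \<bar>h $ i\<bar> < e}"
proof -
  have "{h :: (real, 'd) vec. \<forall>i. \<bar>h $ i\<bar> < e} = (\<Inter>i. {h. \<bar>h $ i\<bar> < e})" by auto
  also have "open \<dots>"
    by (intro open_INT ballI open_Collect_less continuous_intros) auto
  finally show ?thesis .
qed

text \<open>On the support of \<open>g\<close> the inactive constraints have slack at least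
  \<open>e\<close>, so they hold automatically for all shifts with components below
  \<open>e\<close>: the shifted polytope and the shifted vertex cone then cannot be distinguished by
  \<open>g\<close>.\<close>

lemma asymptotic_vertex_piece:
  assumes v: "v extreme_point_of P" and g: "test_function g" and e: "e > 0"
    and supp: "\<And>x i. g x \<noteq> 0 \<Longrightarrow> i \<notin> active v \<Longrightarrow> e \<le> of_int (c i) - u i \<bullet> x"
  shows "todd_asymptotic (riemann_sum P g) (volume g)"
proof -
  obtain w where "dual_cone u w (active v)" by (rule vertex_dual_cone[OF v])
  then interpret dual_cone u w "active v" .
  show ?thesis
  proof (rule todd_asymptotic_cong[OF vertex_asymptotic[OF g, of c] _ open_small_shifts[of e]])
    show "(0 :: (real, 'd) vec) \<in> {h. \<forall>i. \<bar>h $ i\<bar> < e}" using e by simp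
    show "volume g h = cone_integral c g h" if h: "h \<in> {h. \<forall>i. \<bar>h $ i\<bar> < e}" for h
      unfolding cone_integral_eq[OF g] set_lebesgue_integral_def
    proof (rule Bochner_Integration.integral_cong[OF refl])
      fix x
      have "x \<in> shifted_polyhedron u c h \<longleftrightarrow> x \<in> cone (\<lambda>j. of_int (c j) + h $ j)" if "g x \<noteq> 0"
      proof -
        have "u i \<bullet> x \<le> of_int (c i) + h $ i" if "i \<notin> active v" for i
        proof -
          have "\<bar>h $ i\<bar> < e" using h by blast
          with supp[OF \<open>g x \<noteq> 0\<close> that] show ?thesis by linarith
        qed
        then show ?thesis by (auto simp: shifted_polyhedron_def cone_def)
      qed
      then show "indicator (shifted_polyhedron u c h) x *\<^sub>R g x =
          indicator (cone (\<lambda>j. of_int (c j) + h $ j)) x *\<^sub>R g x"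
        by (cases "g x = 0") (auto simp: indicator_def)
    qed
    show "riemann_sum P g N = 1 / real N ^ CARD('n) * (\<Sum>k | k \<in> int_lattice \<and>
      k /\<^sub>R real N \<in> cone (\<lambda>j. of_int (c j)) \<and> g (k /\<^sub>R real N) \<noteq> 0. g (k /\<^sub>R real N))"
      if N: "N \<ge> 1" for N :: nat
    proof -
      have fin: "finite (int_lattice \<inter> (*\<^sub>R) (real N) ` P)"
        by (intro finite_int_lattice_bounded bounded_scaling compact_imp_bounded compact_P)
      have scaled: "k \<in> (*\<^sub>R) (real N) ` P \<longleftrightarrow> k /\<^sub>R real N \<in> P" for k
        using N by (force simp: image_iff)
      have cone: "x \<in> P \<longleftrightarrow> x \<in> cone (\<lambda>j. of_int (c j))" if "g x \<noteq> 0" for x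
        using supp[OF that] e by (force simp: mem_P cone_def)
      have "(\<Sum>k\<in>int_lattice \<inter> (*\<^sub>R) (real N) ` P. g (k /\<^sub>R real N)) = (\<Sum>k | k \<in> int_lattice \<and>
          k /\<^sub>R real N \<in> cone (\<lambda>j. of_int (c j)) \<and> g (k /\<^sub>R real N) \<noteq> 0. g (k /\<^sub>R real N))"
        by (rule sum.mono_neutral_right[OF fin]) (use scaled cone in blast)+
      then show ?thesis by (simp add: riemann_sum_def)
    qed
  qed
qed

text \<open>The part of the support ball outside \<open>V\<close> is compact and misses the
  polytope, so its points violate some facet inequality by a uniform amount. Small shifts do not
  reach it, and both sides vanish.\<close>

lemma asymptotic_vanishing_piece:
  assumes f: "test_function f" and V: "open V" "P \<subseteq> V" "\<And>x. x \<in> V \<Longrightarrow> f x = 0"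
  shows "todd_asymptotic (riemann_sum P f) (volume f)"
proof -
  obtain R where R: "\<And>x. norm x > R \<Longrightarrow> f x = 0"
    using f test_function_iff by metis
  define Cov where "Cov m = (\<Union>i. {x. 1 / real (Suc m) < u i \<bullet> x - of_int (c i)})" for m
  have "compact (cball 0 R \<inter> - V)"
    using V(1) by (intro compact_Int_closed) auto
  then obtain m where m: "cball 0 R \<inter> - V \<subseteq> Cov m"
  proof (rule compact_increasing_cover)
    show "open (Cov m)" for m
      unfolding Cov_def by (intro open_UN ballI open_Collect_less continuous_intros)
    show "Cov m \<subseteq> Cov n" if "m \<le> n" for m n
    proof -
      have "1 / real (Suc n) \<le> 1 / real (Suc m)" using that by (intro divide_left_mono) auto
      then show ?thesis unfolding Cov_def by (auto; meson le_less_trans)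
    qed
    show "cball 0 R \<inter> - V \<subseteq> (\<Union>m. Cov m)"
    proof
      fix x assume "x \<in> cball 0 R \<inter> - V"
      then have "x \<notin> P" using V(2) by blast
      then obtain i where i: "u i \<bullet> x - of_int (c i) > 0" by (auto simp: mem_P not_le)
      obtain m where "1 / real (Suc m) < u i \<bullet> x - of_int (c i)"
        by (rule nat_approx_posE[OF i])
      then have "x \<in> Cov m" unfolding Cov_def by blast
      then show "x \<in> (\<Union>m. Cov m)" by blast
    qed
  qed
  have zero: "f x = 0" if "x \<notin> Cov m" for x
  proof (cases "norm x > R")
    case True
    then show ?thesis by (rule R)
  next
    case False
    then have "x \<in> cball 0 R" by simp
    with m that have "x \<in> V" by blast
    then show ?thesis by (rule V(3))
  qed
  show ?thesis
  proof (rule todd_asymptotic_cong[OF todd_asymptotic_0 _ open_small_shifts[of "1 / real (Suc m)"]])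
    show "(0 :: (real, 'd) vec) \<in> {h. \<forall>i. \<bar>h $ i\<bar> < 1 / real (Suc m)}" by simp
    show "volume f h = 0" if h: "h \<in> {h. \<forall>i. \<bar>h $ i\<bar> < 1 / real (Suc m)}" for h
    proof -
      have "indicator (shifted_polyhedron u c h) x *\<^sub>R f x = 0" for x
      proof (cases "x \<in> shifted_polyhedron u c h")
        case True
        have "\<not> 1 / real (Suc m) < u i \<bullet> x - of_int (c i)" for i
        proof -
          have "u i \<bullet> x \<le> of_int (c i) + h $ i" using True by (simp add: shifted_polyhedron_def)
          moreover have "\<bar>h $ i\<bar> < 1 / real (Suc m)" using h by blast
          ultimately show ?thesis by linarith
        qed
        then have "x \<notin> Cov m" by (auto simp: Cov_def)
        then show ?thesis by (simp add: zero)
      qed simp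
      then have "(\<lambda>x. indicator (shifted_polyhedron u c h) x *\<^sub>R f x) = (\<lambda>x. 0)" by (rule ext)
      then show ?thesis by (simp only: set_lebesgue_integral_def Bochner_Integration.integral_zero)
    qed
    show "riemann_sum P f N = 0" if N: "N \<ge> 1" for N
    proof -
      have "f (k /\<^sub>R real N) = 0" if "k \<in> (*\<^sub>R) (real N) ` P" for k
        using that V(2,3) N by auto
      then show ?thesis by (simp add: riemann_sum_def)
    qed
  qed
qed

lemma asymptotic_add:
  assumes "test_function f" "test_function g"
    and "todd_asymptotic (riemann_sum P f) (volume f)" "todd_asymptotic (riemann_sum P g) (volume g)"
  shows "todd_asymptotic (riemann_sum P (\<lambda>x. f x + g x)) (volume (\<lambda>x. f x + g x))"
proof -
  have "riemann_sum P (\<lambda>x. f x + g x) = (\<lambda>N. riemann_sum P f N + riemann_sum P g N)"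
    by (simp add: riemann_sum_def fun_eq_iff sum.distrib distrib_left)
  moreover have "volume (\<lambda>x. f x + g x) = (\<lambda>h. volume f h + volume g h)"
    by (intro ext set_integral_add(2) test_function_set_integrable assms(1,2) borel_shifted_polyhedron)
  ultimately show ?thesis
    using todd_asymptotic_add[OF assms(3,4)] by simp
qed

text \<open>Products of smooth steps in the inactive slacks localise \<open>f\<close> at a vertex.
  Removing the vertices one by one, by induction on a finite set, replaces a normalisation of these
  cutoffs.\<close>

lemma asymptotic:
  assumes "test_function f"
  shows "todd_asymptotic (riemann_sum P f) (volume f)"
proof -
  obtain e' where e': "e' > 0"
    "\<forall>x\<in>P. \<exists>v. v extreme_point_of P \<and> (\<forall>i. i \<notin> active v \<longrightarrow> e' < of_int (c i) - u i \<bullet> x)"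
    by (rule vertex_margin)
  \<comment> \<open>With the margin 2e on \<open>A v\<close>, a cutoff equals 1 there while its
    support still has slack at least e.\<close>
  define e where "e = e' / 2"
  have e: "e > 0" using e'(1) by (simp add: e_def)
  let ?X = "{v. v extreme_point_of P}"
  define A where "A v = (\<Inter>i\<in>- active v. {x. 2 * e < of_int (c i) - u i \<bullet> x})" for v
  define \<rho> where "\<rho> v x = (\<Prod>i\<in>- active v. smooth_step e (of_int (c i) - u i \<bullet> x))" for v x
  have openA: "open (A v)" for v
    unfolding A_def by (intro open_INT ballI open_Collect_less continuous_intros) auto
  have PA: "P \<subseteq> (\<Union>v\<in>?X. A v)"
    using e'(2) by (fastforce simp: A_def e_def)
  have smooth: "smooth_on UNIV (\<rho> v)" for v
    unfolding \<rho>_def[abs_def] by (intro smooth_on_prod smooth_on_smooth_step e) auto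
  \<comment> \<open>\<open>W\<close> holds the vertices still to be treated. Multiplication by
    \<open>1 - \<rho> v\<close> makes the function vanish on \<open>A v\<close> and preserves the
    zeros obtained before; once \<open>W\<close> is empty, it vanishes on a neighbourhood of the
    polytope.\<close>
  have main: "todd_asymptotic (riemann_sum P f) (volume f)"
    if "finite W" "W \<subseteq> ?X" "test_function f" "\<And>v x. v \<in> ?X - W \<Longrightarrow> x \<in> A v \<Longrightarrow> f x = 0" for W f
    using that
  proof (induction W arbitrary: f)
    case empty
    show ?case
      by (rule asymptotic_vanishing_piece[OF empty(2) _ PA]) (use openA empty(3) in auto)
  next
    case (insert v W)
    have v: "v extreme_point_of P" using insert.prems by blast
    let ?f1 = "\<lambda>x. \<rho> v x * f x" and ?f2 = "\<lambda>x. (1 - \<rho> v x) * f x"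
    have t1: "test_function ?f1"
      by (intro test_function_smooth_mult smooth insert.prems)
    have t2: "test_function ?f2"
      by (intro test_function_smooth_mult smooth_on_diff smooth_on_const smooth insert.prems open_UNIV)
    have 1: "todd_asymptotic (riemann_sum P ?f1) (volume ?f1)"
    proof (rule asymptotic_vertex_piece[OF v t1 e])
      fix x i assume "?f1 x \<noteq> 0" "i \<notin> active v"
      then have "smooth_step e (of_int (c i) - u i \<bullet> x) \<noteq> 0" by (auto simp: \<rho>_def)
      then show "e \<le> of_int (c i) - u i \<bullet> x"
        using smooth_step_0[of "of_int (c i) - u i \<bullet> x" e] by linarith
    qed
    have 2: "todd_asymptotic (riemann_sum P ?f2) (volume ?f2)"
    proof (rule insert.IH[OF _ t2])
      fix v' x assume v': "v' \<in> ?X - W" and x: "x \<in> A v'"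
      show "?f2 x = 0"
      proof (cases "v' = v")
        case True
        have "smooth_step e (of_int (c i) - u i \<bullet> x) = 1" if "i \<in> - active v" for i
          using x that unfolding True A_def by (intro smooth_step_1 e) (auto intro: less_imp_le)
        then have "\<rho> v x = 1" by (simp add: \<rho>_def)
        then show ?thesis by simp
      next
        case False
        then have "f x = 0" using v' x by (intro insert.prems(3)[of v']) auto
        then show ?thesis by simp
      qed
    qed (use insert.prems in blast)
    have "(\<lambda>x. ?f1 x + ?f2 x) = f" by (simp add: fun_eq_iff algebra_simps)
    with asymptotic_add[OF t1 t2 1 2] show ?case by simp
  qed
  have "finite ?X"
    using poly by (simp add: finite_polyhedron_extreme_points polytope_imp_polyhedron)
  then show ?thesis
    by (rule main) (use assms in auto)
qed

end

theorem theorem4p1: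
  fixes \<Delta> :: "(real^'n) set"
    and u :: "'d::{finite,linorder} \<Rightarrow> real^'n"
    and c :: "'d \<Rightarrow> int"
    and f :: "real^'n \<Rightarrow> real"
  assumes "lattice_polytope \<Delta>"
    and "aff_dim \<Delta> = int CARD('n)"
    and "simple_polytope \<Delta>"
    and "primitive_facet_presentation \<Delta> u c"
    and "regular_presentation u c"
    and "test_function f"
  shows "todd_asymptotic (riemann_sum \<Delta> f)
           (\<lambda>h. set_lebesgue_integral lborel (shifted_polyhedron u c h) f)"
proof -
  interpret regular_polytope \<Delta> u c
    using assms by unfold_locales (simp_all add: lattice_polytope_def)
  show ?thesis
    by (rule asymptotic) (rule assms(6))
qed

end
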